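(* Let $L$ be a finite-dimensional Lie algebra over a field $F$ of characteristic $p \neq 0$. Suppose that $F$ is not algebraically closed. Then there exists a finite-dimensional faithful irreducible $L$-module.
   Context: Modules are Lie algebra modules over $F$: an $L$-module is an $F$-vector space $V$ with a Lie algebra homomorphism $\rho : L \to \mathfrak{gl}(V)$. It is faithful if $\rho$ is injective, and irreducible if it is non-zero and has no submodules other than $0$ and itself. *)

theory Defs
  imports
    Complex_Main
    "HOL-Computational_Algebra.Polynomial"
    "HOL-Library.FuncSet"
    "HOL-Library.Function_Algebras"
begin

text \<open>
  A predicate on the field type, because the class \<open>alg_closed_field\<close> of the library cannot be
  negated inside a statement.
\<close>

definition is_alg_closed :: "'f::field itself \<Rightarrow> bool" where
  "is_alg_closed (_ :: 'f itself) \<longleftrightarrow>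
     (\<forall>q :: 'f poly. degree q > 0 \<longrightarrow> (\<exists>a. poly q a = 0))"

definition (in vector_space) finite_dim :: "'b set \<Rightarrow> bool" where
  "finite_dim S \<longleftrightarrow> (\<exists>B. finite B \<and> span B = S)"

locale lie_algebra = vector_space scale
  for scale :: "'f::field \<Rightarrow> 'l::ab_group_add \<Rightarrow> 'l" +
  fixes bracket :: "'l \<Rightarrow> 'l \<Rightarrow> 'l"
  assumes linear_bracket_left: "Vector_Spaces.linear scale scale (\<lambda>x. bracket x y)"
    and linear_bracket_right: "Vector_Spaces.linear scale scale (\<lambda>y. bracket x y)"
    and bracket_self: "bracket x x = 0"
    and jacobi: "bracket x (bracket y z) + bracket y (bracket z x) + bracket z (bracket x y) = 0"

text \<open>
  A module is carried by a subspace \<open>V\<close> of an ambient vector space, so that modules of unspecified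
  dimension can be quantified over. Only the values of \<open>\<rho> x\<close> on \<open>V\<close> matter. The
  \<open>rho_closed\<close>, \<open>rho_add\<close>, \<open>rho_scale\<close> axioms say that \<open>\<rho> x\<close> lies in \<open>gl(V)\<close>, the other three that
  \<open>\<rho>\<close> is a Lie algebra homomorphism into \<open>gl(V)\<close> with the commutator bracket.
\<close>

locale lie_module = lie_algebra scaleL bracket + V: vector_space scaleV
  for scaleL :: "'f::field \<Rightarrow> 'l::ab_group_add \<Rightarrow> 'l"
    and bracket :: "'l \<Rightarrow> 'l \<Rightarrow> 'l"
    and scaleV :: "'f \<Rightarrow> 'v::ab_group_add \<Rightarrow> 'v" +
  fixes V :: "'v set" and \<rho> :: "'l \<Rightarrow> 'v \<Rightarrow> 'v"
  assumes subspace_V: "V.subspace V"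
    and rho_closed: "v \<in> V \<Longrightarrow> \<rho> x v \<in> V"
    and rho_add: "v \<in> V \<Longrightarrow> w \<in> V \<Longrightarrow> \<rho> x (v + w) = \<rho> x v + \<rho> x w"
    and rho_scale: "v \<in> V \<Longrightarrow> \<rho> x (scaleV c v) = scaleV c (\<rho> x v)"
    and add_rho: "v \<in> V \<Longrightarrow> \<rho> (x + y) v = \<rho> x v + \<rho> y v"
    and scale_rho: "v \<in> V \<Longrightarrow> \<rho> (scaleL c x) v = scaleV c (\<rho> x v)"
    and bracket_rho: "v \<in> V \<Longrightarrow> \<rho> (bracket x y) v = \<rho> x (\<rho> y v) - \<rho> y (\<rho> x v)"
begin

definition submodule :: "'v set \<Rightarrow> bool" where
  "submodule W \<longleftrightarrow> V.subspace W \<and> W \<subseteq> V \<and> (\<forall>x. \<forall>w\<in>W. \<rho> x w \<in> W)"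

definition faithful :: bool where
  "faithful \<longleftrightarrow> inj (\<lambda>x. restrict (\<rho> x) V)"

definition irreducible :: bool where
  "irreducible \<longleftrightarrow> V \<noteq> {0} \<and> (\<forall>W. submodule W \<longrightarrow> W = {0} \<or> W = V)"

end

text \<open>
  An ambient space with respect to which existence of finite-dimensional modules can be stated
  without loss of generality: every finite-dimensional vector space over the field \<open>'f\<close> is
  isomorphic to a subspace of the space \<open>nat \<Rightarrow> 'f\<close> of sequences.
\<close>

definition seq_scale :: "'f::field \<Rightarrow> (nat \<Rightarrow> 'f) \<Rightarrow> nat \<Rightarrow> 'f" where
  "seq_scale c v = (\<lambda>i. c * v i)"

lemma vector_space_seq_scale: "vector_space seq_scale"
  by unfold_locales (auto simp: seq_scale_def fun_eq_iff algebra_simps)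

end

theory Submission
  imports
    Defs
    "HOL-Number_Theory.Residues"
    "HOL-Algebra.Algebraic_Closure_Type"
    "Jordan_Normal_Form.Determinant"
begin

text \<open>
  Let \<open>x\<^sub>i\<close> (\<open>i < n\<close>) be a basis of \<open>L\<close>. In the universal enveloping algebra every \<open>x\<^sub>i\<close> has a central
  \<open>p\<close>-polynomial \<open>m\<^sub>i x\<^sub>i\<close> of some degree \<open>q\<^sub>i\<close>. Adjoin an indeterminate \<open>t\<close> and impose
  \<open>m\<^sub>i x\<^sub>i = t ^ (q\<^sub>i * w\<^sub>i)\<close> for distinct weights \<open>w\<^sub>i\<close>: by a diamond lemma argument the quotient is free over
  \<open>F[t]\<close> on the ordered monomials with exponents below \<open>q\<^sub>i\<close>. Comparing terms of top weight shows
  that left multiplication by any nonzero element of \<open>L\<close> is injective on it. Hence its determinant is a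
  nonzero polynomial in \<open>t\<close>, of degree bounded independently of the element, and it stays
  invertible modulo every irreducible polynomial \<open>Q\<close> of sufficiently large degree. Over \<open>F[t]/Q\<close> each nonzero
  element of \<open>L\<close> thus acts injectively, so that any minimal nonzero submodule is faithful and irreducible.

  Such \<open>Q\<close> exist: if \<open>F\<close> is finite or not perfect this is easy, and if \<open>F\<close> is infinite and perfect with
  bounded degrees, then the algebraic closure is generated by one element and has an automorphism of
  prime order over \<open>F\<close>, which the Artin--Schreier argument rules out in characteristic \<open>p\<close>.
\<close>

text \<open>The p-polynomials exist because binomial coefficients of p^j vanish in characteristic p,
  so that ad(x)^(p^j) = ad(x^(p^j)): a linear dependence among these operators is a p-polynomial of
  x that commutes with L. The obstacle is uniformity: a single specialisation has to keep every
  nonzero element of a possibly infinite L invertible. The matrix entries are F-linear in x, so one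
  degree bound holds for all determinants, and an irreducible Q beyond it divides none of them. Over
  an algebraically closed field all irreducible polynomials are linear; this is where the hypothesis
  on F enters. The powers of t make the leading parts of the relations homogeneous: modulo lower
  weight the algebra becomes the commutative ring F[t][x_i] with x_i^(q_i) = t^(q_i w_i), where a
  letter times a normal monomial is a power of t times a normal monomial. Distinct w_i prevent
  cancellation between the letters of a linear combination.\<close>

hide_const (open) Divisibility.prime Divisibility.irreducible module.smult Multiset.mult up_ring.monom up_ring.coeff
  Polynomials.degree Polynomials.lead_coeff

section \<open>Rewriting words to normal form\<close>

fun inversions :: "nat list \<Rightarrow> nat" where
  "inversions [] = 0"
| "inversions (x # xs) = length (filter (\<lambda>y. y < x) xs) + inversions xs"

lemma inversions_swap:
  "i < k \<Longrightarrow> inversions (u @ k # i # v) = Suc (inversions (u @ i # k # v))"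
  by (induction u) auto

text \<open>Length comes first because bracket terms and lower powers shorten a word; an adjacent
  swap keeps the length and removes exactly one inversion in any context.\<close>

definition word_less :: "(nat list \<times> nat list) set" where
  "word_less = measures [length, inversions]"

lemma wf_word_less: "wf word_less"
  by (simp add: word_less_def)

lemma word_less_length: "length v < length w \<Longrightarrow> (v, w) \<in> word_less"
  by (simp add: word_less_def)

lemma word_less_swap: "i < k \<Longrightarrow> (u @ i # k # v, u @ k # i # v) \<in> word_less"
  by (simp add: word_less_def inversions_swap)

lemma word_less_trans: "(u, v) \<in> word_less \<Longrightarrow> (v, w) \<in> word_less \<Longrightarrow> (u, w) \<in> word_less"
  by (auto simp: word_less_def)

text \<open>The free algebra is not constructed; its elements are seen only through functions on
  words. This is the value of the linear extension of \<open>f\<close> at the product of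
  \<open>u\<close>, the combination \<open>cs\<close> and \<open>v\<close>.\<close>

definition lcomb :: "(nat list \<Rightarrow> 'r::comm_ring_1) \<Rightarrow> ('r \<times> nat list) list \<Rightarrow> nat list \<Rightarrow> nat list \<Rightarrow> 'r" where
  "lcomb f cs u v = (\<Sum>(a, w)\<leftarrow>cs. a * f (u @ w @ v))"

lemma lcomb_cong:
  assumes "\<And>a w. (a, w) \<in> set cs \<Longrightarrow> f (u @ w @ v) = g (u' @ w @ v')"
  shows "lcomb f cs u v = lcomb g cs u' v'"
  unfolding lcomb_def by (rule arg_cong[where f = sum_list]) (use assms in auto)

text \<open>Replacements at two disjoint places commute: both sides are the same double sum over
  \<open>cs\<close> and \<open>ds\<close>.\<close>

lemma lcomb_swap:
  "(\<Sum>(a, w)\<leftarrow>cs. a * lcomb f ds (u @ w @ m) v) = (\<Sum>(b, w)\<leftarrow>ds. b * lcomb f cs u (m @ w @ v))"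
proof (induction cs)
  case Nil
  show ?case by (simp add: lcomb_def case_prod_unfold)
next
  case (Cons c cs)
  obtain a w where c: "c = (a, w)" by fastforce
  have "(\<Sum>(b, w')\<leftarrow>ds. b * lcomb f (c # cs) u (m @ w' @ v)) =
        (\<Sum>(b, w')\<leftarrow>ds. a * (b * f (u @ w @ m @ w' @ v))) + (\<Sum>(b, w')\<leftarrow>ds. b * lcomb f cs u (m @ w' @ v))"
    by (simp add: c lcomb_def case_prod_unfold algebra_simps sum_list_addf)
  also have "(\<Sum>(b, w')\<leftarrow>ds. a * (b * f (u @ w @ m @ w' @ v))) = a * lcomb f ds (u @ w @ m) v"
    by (simp add: lcomb_def case_prod_unfold sum_list_const_mult)
  finally show ?case using Cons by (simp add: c)
qed

text \<open>\<open>C k i l\<close> is the coefficient of \<open>x_l\<close> in the bracket of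
  \<open>x_k\<close> and \<open>x_i\<close>, and \<open>s i\<close> is the value imposed on the
  p-polynomial of \<open>x_i\<close> with coefficients \<open>c i j\<close>. The last assumption is
  the centrality of that element: bracketing with \<open>x_i\<close> on the right, later
  \<open>D i\<close>, is annihilated by the same p-polynomial. The coefficients form a ring because
  the instance is F[t].\<close>

locale truncated_enveloping =
  fixes n p :: nat
    and C :: "nat \<Rightarrow> nat \<Rightarrow> nat \<Rightarrow> 'r::comm_ring_1"
    and N :: "nat \<Rightarrow> nat"
    and c :: "nat \<Rightarrow> nat \<Rightarrow> 'r"
    and s :: "nat \<Rightarrow> 'r"
  assumes C_self: "i < n \<Longrightarrow> l < n \<Longrightarrow> C i i l = 0"
    and C_anti: "i < n \<Longrightarrow> k < n \<Longrightarrow> l < n \<Longrightarrow> C k i l = - C i k l"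
    and C_jacobi: "i < n \<Longrightarrow> j < n \<Longrightarrow> k < n \<Longrightarrow> m < n \<Longrightarrow>
        (\<Sum>l<n. C i j l * C l k m + C j k l * C l i m + C k i l * C l j m) = 0"
    and char_p: "prime p" "of_nat p = (0::'r)"
    and N_pos: "N i > 0"
    and ad_annihilated: "i < n \<Longrightarrow> k < n \<Longrightarrow> m < n \<Longrightarrow>
        ((\<lambda>y m. \<Sum>l<n. y l * C l i m) ^^ (p ^ N i)) (\<lambda>l. if l = k then 1 else 0) m +
        (\<Sum>j<N i. c i j * ((\<lambda>y m. \<Sum>l<n. y l * C l i m) ^^ (p ^ j)) (\<lambda>l. if l = k then 1 else 0) m) = 0"
begin

lemma p_nonzero [simp]: "p \<noteq> 0" "0 < p"
  using prime_gt_0_nat[OF char_p(1)] by simp_all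

abbreviation q :: "nat \<Rightarrow> nat" where "q i \<equiv> p ^ N i"

definition D :: "nat \<Rightarrow> (nat \<Rightarrow> 'r) \<Rightarrow> nat \<Rightarrow> 'r" where
  "D i y m = (\<Sum>l<n. y l * C l i m)"

definition unit :: "nat \<Rightarrow> nat \<Rightarrow> 'r" where
  "unit k l = (if l = k then 1 else 0)"

lemma D_annihilated:
  "i < n \<Longrightarrow> k < n \<Longrightarrow> m < n \<Longrightarrow>
     (D i ^^ q i) (unit k) m + (\<Sum>j<N i. c i j * (D i ^^ (p ^ j)) (unit k) m) = 0"
  using ad_annihilated[of i k m] unfolding D_def[abs_def] unit_def[abs_def] by simp

lemma q_gt_1: "q i > 1"
  using one_less_power[OF prime_gt_1_nat[OF char_p(1)] N_pos] .

lemma p_power_less: "j < N i \<Longrightarrow> p ^ j < q i"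
  using power_strict_increasing[OF _ prime_gt_1_nat[OF char_p(1)]] .

definition swap_comb :: "nat \<Rightarrow> nat \<Rightarrow> ('r \<times> nat list) list" where
  "swap_comb k i = (1, [i, k]) # map (\<lambda>l. (C k i l, [l])) [0..<n]"

definition power_comb :: "nat \<Rightarrow> ('r \<times> nat list) list" where
  "power_comb i = (s i, []) # map (\<lambda>j. (- c i j, replicate (p ^ j) i)) [0..<N i]"

inductive rule :: "nat list \<Rightarrow> ('r \<times> nat list) list \<Rightarrow> bool" where
  swap: "i < k \<Longrightarrow> k < n \<Longrightarrow> rule [k, i] (swap_comb k i)"
| power: "i < n \<Longrightarrow> rule (replicate (q i) i) (power_comb i)"

lemma lcomb_swap_comb:
  "lcomb f (swap_comb k i) u v = f (u @ i # k # v) + (\<Sum>l<n. C k i l * f (u @ l # v))"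
  by (simp add: lcomb_def swap_comb_def comp_def interv_sum_list_conv_sum_set_nat atLeast0LessThan)

lemma lcomb_power_comb:
  "lcomb f (power_comb i) u v = s i * f (u @ v) - (\<Sum>j<N i. c i j * f (u @ replicate (p ^ j) i @ v))"
  by (simp add: lcomb_def power_comb_def comp_def interv_sum_list_conv_sum_set_nat
        atLeast0LessThan sum_negf)

lemma rule_less:
  assumes "rule pat cs" "(a, w) \<in> set cs"
  shows "(u @ w @ v, u @ pat @ v) \<in> word_less"
  using assms
proof cases
  case (swap i k)
  then show ?thesis using assms
    by (auto simp: swap_comb_def word_less_swap intro: word_less_length)
next
  case (power i)
  then show ?thesis using p_power_less assms
    by (auto simp: power_comb_def intro!: word_less_length)
qed

lemma rule_lists:
  assumes "rule pat cs" "(a, w) \<in> set cs"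
  shows "set w \<subseteq> {..<n}"
  using assms by cases (auto simp: swap_comb_def power_comb_def)

text \<open>A value that one rewriting step somewhere in \<open>x\<close> would force on
  \<open>f x\<close>; confluence means that there is at most one.\<close>

definition candidate :: "(nat list \<Rightarrow> 'r) \<Rightarrow> nat list \<Rightarrow> 'r \<Rightarrow> bool" where
  "candidate f x r \<longleftrightarrow> (\<exists>u pat cs v. x = u @ pat @ v \<and> rule pat cs \<and> r = lcomb f cs u v)"

end

text \<open>In a context where \<open>y x\<^sub>i - x\<^sub>i y = D y\<close>, moving \<open>y\<close> past a power of \<open>x\<^sub>i\<close>; here
  \<open>g a b y\<close> stands for the value of \<open>x\<^sub>i\<^sup>a y x\<^sub>i\<^sup>b\<close>.\<close>

lemma commute_power:
  fixes g :: "nat \<Rightarrow> nat \<Rightarrow> 'y \<Rightarrow> 'r::comm_ring_1"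
  assumes low: "\<And>a b y. a + b + 1 < Q \<Longrightarrow> g a (b + 1) y = g (a + 1) b y + g a b (D y)"
    and top: "\<And>a b. a + b + 1 = Q \<Longrightarrow> g a (b + 1) y0 = g (a + 1) b y0 + g a b (D y0)"
    and "m \<le> Q"
  shows "g 0 m y0 = (\<Sum>r\<le>m. of_nat (m choose r) * g (m - r) 0 ((D ^^ r) y0))"
proof -
  \<comment> \<open>With total exponent \<open>Q\<close> commutation is known only for
    \<open>y0\<close>; the correction \<open>D y0\<close> has total exponent below \<open>Q\<close>,
    where every \<open>y\<close> is allowed. Each step raises the left exponent, hence the
    generalisation over \<open>a\<close>.\<close>
  have gen: "g a m y = (\<Sum>r\<le>m. of_nat (m choose r) * g (a + m - r) 0 ((D ^^ r) y))"
    if "a + m < Q \<or> (a + m = Q \<and> y = y0)" for a m y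
    using that
  proof (induction m arbitrary: a y)
    case 0
    then show ?case by simp
  next
    case (Suc m)
    have 1: "g a (Suc m) y = g (Suc a) m y + g a m (D y)"
      using low[of a m y] top[of a m] Suc.prems by auto
    have 2: "g (Suc a) m y = (\<Sum>r\<le>m. of_nat (m choose r) * g (a + Suc m - r) 0 ((D ^^ r) y))"
      using Suc.IH[of "Suc a" y] Suc.prems by simp
    have 3: "g a m (D y) = (\<Sum>r\<le>m. of_nat (m choose r) * g (a + m - r) 0 ((D ^^ Suc r) y))"
    proof -
      have "a + m < Q" using Suc.prems by auto
      then show ?thesis using Suc.IH[of a "D y"] by (simp add: funpow_swap1)
    qed
    have "(\<Sum>r\<le>Suc m. of_nat (Suc m choose r) * g (a + Suc m - r) 0 ((D ^^ r) y)) =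
          g (a + Suc m) 0 y + (\<Sum>r\<le>m. of_nat (Suc m choose Suc r) * g (a + m - r) 0 ((D ^^ Suc r) y))"
      by (subst sum.atMost_Suc_shift) simp
    also have "\<dots> = (g (a + Suc m) 0 y + (\<Sum>r\<le>m. of_nat (m choose Suc r) * g (a + m - r) 0 ((D ^^ Suc r) y)))
        + g a m (D y)"
      unfolding 3 by (simp add: sum.distrib algebra_simps)
    also have "g (a + Suc m) 0 y + (\<Sum>r\<le>m. of_nat (m choose Suc r) * g (a + m - r) 0 ((D ^^ Suc r) y)) =
       (\<Sum>r\<le>Suc m. of_nat (m choose r) * g (a + Suc m - r) 0 ((D ^^ r) y))"
      unfolding sum.atMost_Suc_shift[of "\<lambda>r. of_nat (m choose r) * g (a + Suc m - r) 0 ((D ^^ r) y)"] by simp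
    also have "\<dots> = (\<Sum>r\<le>m. of_nat (m choose r) * g (a + Suc m - r) 0 ((D ^^ r) y))"
      by (subst sum.atMost_Suc) (simp add: binomial_eq_0)
    also have "\<dots> = g (Suc a) m y" by (simp add: 2)
    finally show ?case using 1 by simp
  qed
  show ?thesis using gen[of 0 m y0] \<open>m \<le> Q\<close> by (cases "m = Q") auto
qed

lemma prime_power_choose_eq_0:
  assumes "prime p" "of_nat p = (0::'r::comm_ring_1)" "0 < r" "r < p ^ N"
  shows "of_nat (p ^ N choose r) = (0::'r)"
proof -
  have "p dvd (p ^ N choose r)"
  proof -
    have "r * (p ^ N choose r) = p ^ N * (p ^ N - 1 choose (r - 1))"
      using times_binomial_minus1_eq[of r "p ^ N"] assms(3) by simp
    then have d: "p ^ N dvd r * (p ^ N choose r)" by simp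
    show ?thesis
    proof (rule ccontr)
      assume "\<not> p dvd (p ^ N choose r)"
      then have "coprime (p ^ N) (p ^ N choose r)"
        using assms(1) by (simp add: prime_imp_coprime)
      then have "p ^ N dvd r" using d by (simp add: coprime_dvd_mult_left_iff)
      then show False using assms(3,4) by (auto dest: dvd_imp_le)
    qed
  qed
  then obtain k where "p ^ N choose r = p * k" by blast
  then show ?thesis by (simp add: assms(2))
qed

text \<open>Only the terms \<open>r = 0\<close> and \<open>r = p ^ N\<close> of the binomial
  expansion survive, so moving \<open>y\<close> across a p-power costs a single iterated bracket.
  This is why the truncation uses p-powers.\<close>

lemma commute_prime_power:
  fixes g :: "nat \<Rightarrow> nat \<Rightarrow> 'y \<Rightarrow> 'r::comm_ring_1"
  assumes low: "\<And>a b y. a + b + 1 < Q \<Longrightarrow> g a (b + 1) y = g (a + 1) b y + g a b (D y)"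
    and top: "\<And>a b. a + b + 1 = Q \<Longrightarrow> g a (b + 1) y0 = g (a + 1) b y0 + g a b (D y0)"
    and p: "prime p" "of_nat p = (0::'r)" and "p ^ N \<le> Q"
  shows "g 0 (p ^ N) y0 = g (p ^ N) 0 y0 + g 0 0 ((D ^^ (p ^ N)) y0)"
proof -
  have pos: "p ^ N > 0" using p(1) prime_gt_0_nat by simp
  have "g 0 (p ^ N) y0 = (\<Sum>r\<le>p ^ N. of_nat (p ^ N choose r) * g (p ^ N - r) 0 ((D ^^ r) y0))"
    using low top \<open>p ^ N \<le> Q\<close> by (rule commute_power)
  also have "\<dots> = (\<Sum>r\<in>{0, p ^ N}. of_nat (p ^ N choose r) * g (p ^ N - r) 0 ((D ^^ r) y0))"
    by (rule sum.mono_neutral_right) (auto simp: prime_power_choose_eq_0[OF p])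
  also have "\<dots> = g (p ^ N) 0 y0 + g 0 0 ((D ^^ (p ^ N)) y0)"
    using pos by simp
  finally show ?thesis .
qed

lemma word_less_move_right:
  "i < k \<Longrightarrow> 0 < a \<Longrightarrow> (u @ replicate a i @ k # v, u @ k # replicate a i @ v) \<in> word_less"
proof (induction a arbitrary: u)
  case (Suc a)
  have 1: "(u @ i # k # replicate a i @ v, u @ k # i # replicate a i @ v) \<in> word_less"
    using Suc.prems by (intro word_less_swap)
  show ?case
  proof (cases "a = 0")
    case False
    then have "((u @ [i]) @ replicate a i @ k # v, (u @ [i]) @ k # replicate a i @ v) \<in> word_less"
      using Suc by blast
    with 1 show ?thesis using word_less_trans by fastforce
  qed (use 1 in simp)
qed simp

lemma word_less_move_left:
  "k < i \<Longrightarrow> 0 < a \<Longrightarrow> (u @ k # replicate a i @ v, u @ replicate a i @ k # v) \<in> word_less"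
proof (induction a arbitrary: v)
  case (Suc a)
  have 1: "((u @ replicate a i) @ k # i # v, (u @ replicate a i) @ i # k # v) \<in> word_less"
    using Suc.prems by (intro word_less_swap)
  have r: "replicate (Suc a) i = replicate a i @ [i]" by (simp add: replicate_append_same)
  show ?case
  proof (cases "a = 0")
    case False
    then have "(u @ k # replicate a i @ i # v, u @ replicate a i @ k # i # v) \<in> word_less"
      using Suc by blast
    with 1 show ?thesis using word_less_trans unfolding r by fastforce
  qed (use 1 in simp)
qed simp

text \<open>For \<open>p = 2\<close> the two signs agree. Needed when letters move leftwards and
  \<open>- D\<close> replaces \<open>D\<close>.\<close>

lemma minus_one_prime_power:
  assumes "prime p" "of_nat p = (0::'r::comm_ring_1)"
  shows "(-1) ^ (p ^ j) = (-1 :: 'r)"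
proof (cases "odd p")
  case False
  then have "p = 2" using assms(1) primes_dvd_imp_eq two_is_prime_nat by blast
  then have "(1::'r) + 1 = 0" using assms(2) by simp
  then have "(-1::'r) = 1" by (metis minus_unique)
  then show ?thesis by (simp only: power_one)
qed simp

lemma append_eq_prefix: "u @ a = u' @ b \<Longrightarrow> length u \<le> length u' \<Longrightarrow> \<exists>d. u' = u @ d \<and> a = d @ b"
  by (auto simp: append_eq_append_conv2)

section \<open>Confluence: resolution of all overlaps\<close>

context truncated_enveloping
begin

text \<open>The induction hypothesis of the diamond lemma: \<open>f\<close> respects every rule at
  words below \<open>x\<close>, while \<open>f x\<close> itself is still undetermined. The goal is
  that all rules applicable to \<open>x\<close> prescribe the same value.\<close>

context
  fixes f :: "nat list \<Rightarrow> 'r" and x :: "nat list"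
  assumes reduced: "\<And>y r. (y, x) \<in> word_less \<Longrightarrow> set y \<subseteq> {..<n} \<Longrightarrow> candidate f y r \<Longrightarrow> f y = r"
    and x_letters: "set x \<subseteq> {..<n}"
begin

lemma reduce:
  assumes "(u @ pat @ v, x) \<in> word_less" "set u \<subseteq> {..<n}" "set pat \<subseteq> {..<n}" "set v \<subseteq> {..<n}" "rule pat cs"
  shows "f (u @ pat @ v) = lcomb f cs u v"
proof (rule reduced[OF assms(1)])
  show "set (u @ pat @ v) \<subseteq> {..<n}" using assms by simp
  show "candidate f (u @ pat @ v) (lcomb f cs u v)" unfolding candidate_def using assms(5) by blast
qed

text \<open>A descent is an instance of the swap rule; an ascent is that rule read backwards,
  combined with the antisymmetry of \<open>C\<close>. Hence both words must lie below
  \<open>x\<close>.\<close>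

lemma reduce_swap:
  assumes "(u @ k # i # v, x) \<in> word_less" "(u @ i # k # v, x) \<in> word_less"
    and "set u \<subseteq> {..<n}" "set v \<subseteq> {..<n}" "i < n" "k < n"
  shows "f (u @ k # i # v) = f (u @ i # k # v) + (\<Sum>l<n. C k i l * f (u @ l # v))"
proof -
  have *: "f (u @ k # i # v) = f (u @ i # k # v) + (\<Sum>l<n. C k i l * f (u @ l # v))"
    if "i < k" "(u @ k # i # v, x) \<in> word_less" "k < n" for i k
    using reduce[of u "[k, i]" v "swap_comb k i"] that assms(3,4) rule.swap[OF that(1,3)]
    by (simp add: lcomb_swap_comb)
  consider "i < k" | "i = k" | "k < i" by linarith
  then show ?thesis
  proof cases
    case 1
    then show ?thesis using * assms by blast
  next
    case 2
    then show ?thesis using assms by (simp add: C_self)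
  next
    case 3
    have "(\<Sum>l<n. C i k l * f (u @ l # v)) = - (\<Sum>l<n. C k i l * f (u @ l # v))"
      unfolding sum_negf[symmetric] by (rule sum.cong) (use assms C_anti[of k i] in auto)
    then show ?thesis using *[of k i] 3 assms by simp
  qed
qed

text \<open>Either rule leaves the other pattern intact, in words that are below \<open>x\<close>;
  applying the second rule there gives the two orders of one double sum.\<close>

lemma confluent_disjoint:
  assumes x: "x = u @ pat @ m @ pat' @ v" and r: "rule pat cs" and r': "rule pat' cs'"
  shows "lcomb f cs u (m @ pat' @ v) = lcomb f cs' (u @ pat @ m) v"
proof -
  have "lcomb f cs u (m @ pat' @ v) = (\<Sum>(a, w)\<leftarrow>cs. a * lcomb f cs' (u @ w @ m) v)"
    unfolding lcomb_def[of f cs]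
  proof (intro arg_cong[where f = sum_list] map_cong refl, clarify)
    fix a w assume aw: "(a, w) \<in> set cs"
    show "a * f (u @ w @ m @ pat' @ v) = a * lcomb f cs' (u @ w @ m) v"
      using reduce[of "u @ w @ m" pat' v cs'] rule_less[OF r aw, of u "m @ pat' @ v"]
        rule_lists[OF r aw] x_letters r' by (simp add: x)
  qed
  also have "\<dots> = (\<Sum>(b, w)\<leftarrow>cs'. b * lcomb f cs u (m @ w @ v))"
    by (rule lcomb_swap)
  also have "\<dots> = lcomb f cs' (u @ pat @ m) v"
    unfolding lcomb_def[of f cs']
  proof (intro arg_cong[where f = sum_list] map_cong refl, clarify)
    fix a w assume aw: "(a, w) \<in> set cs'"
    show "a * lcomb f cs u (m @ w @ v) = a * f ((u @ pat @ m) @ w @ v)"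
      using reduce[of u pat "m @ w @ v" cs] rule_less[OF r' aw, of "u @ pat @ m" v]
        rule_lists[OF r' aw] x_letters r by (simp add: x)
  qed
  finally show ?thesis .
qed

text \<open>Both ways sort \<open>k j i\<close> into \<open>i j k\<close>; the nested brackets left
  over agree by the Jacobi identity.\<close>

lemma confluent_swap_swap:
  assumes x: "x = u @ k # j # i # v" and ij: "i < j" and jk: "j < k"
  shows "lcomb f (swap_comb k j) u (i # v) = lcomb f (swap_comb j i) (u @ [k]) v"
proof -
  have L: "set u \<subseteq> {..<n}" "set v \<subseteq> {..<n}" "i < n" "j < n" "k < n" using x_letters x by auto
  have k1: "(u @ j # k # i # v, x) \<in> word_less" using word_less_swap[OF jk, of u "i # v"] x by simp
  have k2: "(u @ j # i # k # v, x) \<in> word_less"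
    using word_less_trans[OF word_less_swap[of i k "u @ [j]" v]] k1 ij jk by simp
  have k3: "(u @ i # j # k # v, x) \<in> word_less"
    using word_less_trans[OF word_less_swap[OF ij, of u "k # v"]] k2 by simp
  have k4: "(u @ k # i # j # v, x) \<in> word_less" using word_less_swap[OF ij, of "u @ [k]" v] x by simp
  have k5: "(u @ i # k # j # v, x) \<in> word_less"
    using word_less_trans[OF word_less_swap[of i k u "j # v"]] k4 ij jk by simp
  have short: "(u @ a # b # v, x) \<in> word_less" for a b by (rule word_less_length) (simp add: x)
  have e1: "f (u @ j # k # i # v) = f (u @ j # i # k # v) + (\<Sum>l<n. C k i l * f (u @ j # l # v))"
    using reduce_swap[of "u @ [j]" k i v] k1 k2 L by simp
  have e2: "f (u @ j # i # k # v) = f (u @ i # j # k # v) + (\<Sum>l<n. C j i l * f (u @ l # k # v))"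
    using reduce_swap[of u j i "k # v"] k2 k3 L by simp
  have e3: "f (u @ k # i # j # v) = f (u @ i # k # j # v) + (\<Sum>l<n. C k i l * f (u @ l # j # v))"
    using reduce_swap[of u k i "j # v"] k4 k5 L by simp
  have e4: "f (u @ i # k # j # v) = f (u @ i # j # k # v) + (\<Sum>l<n. C k j l * f (u @ i # l # v))"
    using reduce_swap[of "u @ [i]" k j v] k3 k5 L by simp
  \<comment> \<open>Moving \<open>b\<close> in front of a bracket produces a nested bracket. These
    words are one letter shorter than \<open>x\<close>, so either order of the two letters is
    permitted.\<close>
  have br: "(\<Sum>l<n. a l * f (u @ l # b # v)) = (\<Sum>l<n. a l * f (u @ b # l # v)) +
      (\<Sum>m<n. (\<Sum>l<n. a l * C l b m) * f (u @ m # v))" if "b < n" for a b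
  proof -
    have "(\<Sum>l<n. a l * f (u @ l # b # v)) =
       (\<Sum>l<n. a l * f (u @ b # l # v) + (\<Sum>m<n. a l * C l b m * f (u @ m # v)))"
      by (rule sum.cong) (use reduce_swap[of u _ b v] short L that in
          \<open>auto simp: algebra_simps sum_distrib_left\<close>)
    also have "\<dots> = (\<Sum>l<n. a l * f (u @ b # l # v)) + (\<Sum>l<n. \<Sum>m<n. a l * C l b m * f (u @ m # v))"
      by (simp add: sum.distrib)
    also have "(\<Sum>l<n. \<Sum>m<n. a l * C l b m * f (u @ m # v)) =
        (\<Sum>m<n. (\<Sum>l<n. a l * C l b m) * f (u @ m # v))"
      by (subst sum.swap) (simp add: sum_distrib_right)
    finally show ?thesis .
  qed
  have jac: "(\<Sum>l<n. C k i l * C l j m) = (\<Sum>l<n. C j i l * C l k m) + (\<Sum>l<n. C k j l * C l i m)"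
    if "m < n" for m
  proof -
    have "(\<Sum>l<n. C j i l * C l k m) = - (\<Sum>l<n. C i j l * C l k m)"
      "(\<Sum>l<n. C k j l * C l i m) = - (\<Sum>l<n. C j k l * C l i m)"
      unfolding sum_negf[symmetric] using C_anti[of i j] C_anti[of j k] L
      by (auto intro!: sum.cong)
    moreover have "(\<Sum>l<n. C i j l * C l k m) + (\<Sum>l<n. C j k l * C l i m) + (\<Sum>l<n. C k i l * C l j m) = 0"
      using C_jacobi[of i j k m] L that by (simp only: sum.distrib)
    ultimately show ?thesis using minus_unique by fastforce
  qed
  have jac': "(\<Sum>m<n. (\<Sum>l<n. C k i l * C l j m) * f (u @ m # v)) =
     (\<Sum>m<n. (\<Sum>l<n. C j i l * C l k m) * f (u @ m # v)) +
     (\<Sum>m<n. (\<Sum>l<n. C k j l * C l i m) * f (u @ m # v))"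
    unfolding sum.distrib[symmetric] by (rule sum.cong) (simp_all only: jac distrib_right lessThan_iff)
  show ?thesis
    unfolding lcomb_swap_comb append_assoc append_Cons append_Nil e1 e2 e3 e4
    unfolding br[OF L(3), of "C k j"] br[OF L(5), of "C j i"] br[OF L(4), of "C k i"] jac'
    by (simp only: add_ac)
qed

text \<open>The power rule produces only powers of the same letter, and these commute as
  words.\<close>

lemma confluent_power_power:
  assumes "x = u @ replicate d i @ replicate (q i) i @ v"
  shows "lcomb f (power_comb i) u (replicate d i @ v) = lcomb f (power_comb i) (u @ replicate d i) v"
proof -
  have "f (u @ replicate a i @ replicate d i @ v) = f (u @ replicate d i @ replicate a i @ v)" for a
    by (metis add.commute append_assoc replicate_add)
  then show ?thesis unfolding lcomb_power_comb append_assoc by simp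
qed

text \<open>Here \<open>y\<close> is an element of L given by coordinates, standing between powers
  of \<open>x_i\<close>; letting it vary makes iterated brackets \<open>D i\<close>
  expressible.\<close>

definition expand :: "nat \<Rightarrow> nat list \<Rightarrow> nat list \<Rightarrow> nat \<Rightarrow> nat \<Rightarrow> (nat \<Rightarrow> 'r) \<Rightarrow> 'r" where
  "expand i u v a b y = (\<Sum>l<n. y l * f (u @ replicate a i @ l # replicate b i @ v))"

lemma expand_unit: "k < n \<Longrightarrow> expand i u v a b (unit k) = f (u @ replicate a i @ k # replicate b i @ v)"
  by (simp add: expand_def unit_def if_distrib[of "\<lambda>z. z * _"] cong: if_cong)

lemma expand_add: "expand i u v a b y + expand i u v a b z = expand i u v a b (\<lambda>m. y m + z m)"
  by (simp add: expand_def algebra_simps sum.distrib)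

lemma expand_annihilated:
  assumes "i < n" "k < n"
  shows "expand i u v a b ((D i ^^ q i) (unit k)) +
    (\<Sum>j<N i. c i j * expand i u v a b ((D i ^^ (p ^ j)) (unit k))) = 0"
proof -
  have "(\<Sum>j<N i. c i j * expand i u v a b ((D i ^^ (p ^ j)) (unit k))) =
    expand i u v a b (\<lambda>m. \<Sum>j<N i. c i j * (D i ^^ (p ^ j)) (unit k) m)"
    unfolding expand_def sum_distrib_left sum_distrib_right
    by (subst sum.swap) (simp add: algebra_simps)
  moreover have "expand i u v a b (\<lambda>m. (D i ^^ q i) (unit k) m +
     (\<Sum>j<N i. c i j * (D i ^^ (p ^ j)) (unit k) m)) = 0"
    unfolding expand_def by (rule sum.neutral) (use D_annihilated[OF assms] in simp)
  ultimately show ?thesis by (simp only: expand_add)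
qed

lemma expand_D:
  "expand i u v a b (D i y) = (\<Sum>l<n. y l * (\<Sum>m<n. C l i m * f (u @ replicate a i @ m # replicate b i @ v)))"
  unfolding expand_def D_def sum_distrib_left sum_distrib_right
  by (subst sum.swap) (simp add: algebra_simps)

lemma expand_swap:
  assumes "set u \<subseteq> {..<n}" "set v \<subseteq> {..<n}" "i < n"
    and "\<And>l. l < n \<Longrightarrow> y l \<noteq> 0 \<Longrightarrow> (u @ replicate a i @ l # replicate (Suc b) i @ v, x) \<in> word_less"
    and "\<And>l. l < n \<Longrightarrow> y l \<noteq> 0 \<Longrightarrow> (u @ replicate (Suc a) i @ l # replicate b i @ v, x) \<in> word_less"
  shows "expand i u v a (Suc b) y = expand i u v (Suc a) b y + expand i u v a b (D i y)"
proof -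
  have "y l * f (u @ replicate a i @ l # replicate (Suc b) i @ v) =
     y l * f (u @ replicate (Suc a) i @ l # replicate b i @ v) +
     y l * (\<Sum>m<n. C l i m * f (u @ replicate a i @ m # replicate b i @ v))" if "l < n" for l
  proof (cases "y l = 0")
    case False
    have "f ((u @ replicate a i) @ l # i # replicate b i @ v) =
       f ((u @ replicate a i) @ i # l # replicate b i @ v) +
       (\<Sum>m<n. C l i m * f ((u @ replicate a i) @ m # replicate b i @ v))"
      by (rule reduce_swap) (use assms(4)[OF that False] assms(5)[OF that False] assms(1-3) that
          in \<open>auto simp: replicate_app_Cons_same\<close>)
    then show ?thesis by (simp add: algebra_simps replicate_app_Cons_same)
  qed simp
  then show ?thesis unfolding expand_D unfolding expand_def sum.distrib[symmetric]
    by (intro sum.cong) auto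
qed

text \<open>Moving \<open>x_k\<close> rightwards across all copies of \<open>x_i\<close> gives
  \<open>x_i ^ q i\<close> times \<open>x_k\<close> plus the \<open>q i\<close>-fold bracket.
  Applying the power rule and moving the lower powers back leaves the p-polynomial of
  \<open>D i\<close> at \<open>x_k\<close>, which is zero.\<close>

lemma confluent_swap_power:
  assumes x: "x = u @ k # replicate (q i) i @ v" and ik: "i < k"
  shows "lcomb f (swap_comb k i) u (replicate (q i - 1) i @ v) = lcomb f (power_comb i) (u @ [k]) v"
proof -
  have L: "set u \<subseteq> {..<n}" "set v \<subseteq> {..<n}" "i < n" "k < n"
    using x_letters x prime_gt_0_nat[OF char_p(1)] by (auto simp: set_replicate_conv_if split: if_splits)
  note q1 = q_gt_1[of i]
  define val where "val = lcomb f (swap_comb k i) u (replicate (q i - 1) i @ v)"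
  \<comment> \<open>At the overlap word itself \<open>f\<close> has no known value yet;
    \<open>g\<close> uses the one forced by the swap rule instead.\<close>
  define g where "g a b y = (if a = 0 \<and> b = q i then val else expand i u v a b y)" for a b y
  have low: "g a (b + 1) y = g (a + 1) b y + g a b (D i y)" if "a + b + 1 < q i" for a b y
  proof -
    have "expand i u v a (Suc b) y = expand i u v (Suc a) b y + expand i u v a b (D i y)"
      by (rule expand_swap[OF L(1-3)]; rule word_less_length) (use that in \<open>simp_all add: x\<close>)
    then show ?thesis using that by (simp add: g_def)
  qed
  have top: "g a (b + 1) (unit k) = g (a + 1) b (unit k) + g a b (D i (unit k))" if ab: "a + b + 1 = q i" for a b
  proof (cases "a = 0")
    case True
    then have b: "b = q i - 1" "Suc b = q i" "b \<noteq> q i" using ab q1 by auto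
    have "val = expand i u v 1 b (unit k) + expand i u v 0 b (D i (unit k))"
      unfolding expand_D expand_unit[OF L(4)] val_def lcomb_swap_comb b(1) using L(4)
      by (simp add: unit_def if_distrib[of "\<lambda>z. z * _"] cong: if_cong)
    then show ?thesis using b(2,3) True q1 by (auto simp add: g_def)
  next
    case False
    \<comment> \<open>Once a copy of \<open>x_i\<close> stands to the left of \<open>x_k\<close>, an
      inversion has been removed and the word lies below \<open>x\<close>.\<close>
    have *: "(u @ replicate a' i @ k # replicate b' i @ v, x) \<in> word_less" if "0 < a'" "a' + b' = q i" for a' b'
    proof -
      have "replicate (q i) i = replicate a' i @ replicate b' i"
        using that(2) by (metis replicate_add)
      then show ?thesis
        using word_less_move_right[OF ik that(1), of u "replicate b' i @ v"] by (simp add: x)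
    qed
    have "expand i u v a (Suc b) (unit k) = expand i u v (Suc a) b (unit k) + expand i u v a b (D i (unit k))"
    proof (rule expand_swap[OF L(1-3)])
      fix l assume "unit k l \<noteq> 0"
      then have "l = k" by (simp add: unit_def split: if_splits)
      then show "(u @ replicate a i @ l # replicate (Suc b) i @ v, x) \<in> word_less"
        "(u @ replicate (Suc a) i @ l # replicate b i @ v, x) \<in> word_less"
        using *[of a "Suc b"] *[of "Suc a" b] ab False by simp_all
    qed
    then show ?thesis using False by (simp add: g_def)
  qed
  have main: "g 0 (p ^ j) (unit k) = g (p ^ j) 0 (unit k) + g 0 0 ((D i ^^ (p ^ j)) (unit k))" if "p ^ j \<le> q i" for j
    by (rule commute_prime_power[where Q = "q i" and g = g and D = "D i"]) (use low top char_p that in auto)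
  have "val = g 0 (q i) (unit k)" by (simp add: g_def)
  also have "\<dots> = g (q i) 0 (unit k) + g 0 0 ((D i ^^ q i) (unit k))" by (rule main) simp
  also have "g (q i) 0 (unit k) = f (u @ replicate (q i) i @ k # v)"
    using q1 L by (simp add: g_def expand_unit)
  also have "\<dots> = lcomb f (power_comb i) u (k # v)"
    by (rule reduce) (use L word_less_move_right[OF ik, of "q i" u v] q1 rule.power[OF L(3)] in \<open>auto simp: x\<close>)
  also have "\<dots> = s i * f (u @ k # v) - (\<Sum>j<N i. c i j * g (p ^ j) 0 (unit k))"
    using char_p(1) prime_gt_0_nat L by (simp add: lcomb_power_comb g_def expand_unit)
  also have "(\<Sum>j<N i. c i j * g (p ^ j) 0 (unit k)) =
     (\<Sum>j<N i. c i j * g 0 (p ^ j) (unit k)) - (\<Sum>j<N i. c i j * g 0 0 ((D i ^^ (p ^ j)) (unit k)))"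
    unfolding sum_subtractf[symmetric]
    by (rule sum.cong) (simp_all add: main less_imp_le[OF p_power_less] algebra_simps)
  also have "(\<Sum>j<N i. c i j * g 0 (p ^ j) (unit k)) = (\<Sum>j<N i. c i j * f (u @ k # replicate (p ^ j) i @ v))"
  proof (rule sum.cong[OF refl])
    fix j assume "j \<in> {..<N i}"
    then have "p ^ j < q i" using p_power_less by simp
    then show "c i j * g 0 (p ^ j) (unit k) = c i j * f (u @ k # replicate (p ^ j) i @ v)"
      using L by (simp add: g_def expand_unit)
  qed
  finally have "val = s i * f (u @ k # v) - (\<Sum>j<N i. c i j * f (u @ k # replicate (p ^ j) i @ v)) +
     (expand i u v 0 0 ((D i ^^ q i) (unit k)) + (\<Sum>j<N i. c i j * expand i u v 0 0 ((D i ^^ (p ^ j)) (unit k))))"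
    using q1 by (simp add: g_def)
  then show ?thesis
    unfolding expand_annihilated[OF L(3,4)] val_def by (simp add: lcomb_power_comb)
qed

text \<open>Mirror image of the previous overlap: \<open>x_k\<close> moves leftwards, so the two
  exponents exchange roles and the bracket changes sign, \<open>D'\<close> being minus
  \<open>D i\<close>.\<close>

lemma confluent_power_swap:
  assumes x: "x = u @ replicate (q i) i @ k # v" and ki: "k < i"
  shows "lcomb f (swap_comb i k) (u @ replicate (q i - 1) i) v = lcomb f (power_comb i) u (k # v)"
proof -
  have L: "set u \<subseteq> {..<n}" "set v \<subseteq> {..<n}" "i < n" "k < n"
    using x_letters x prime_gt_0_nat[OF char_p(1)] by (auto simp: set_replicate_conv_if split: if_splits)
  note q1 = q_gt_1[of i]
  define val where "val = lcomb f (swap_comb i k) (u @ replicate (q i - 1) i) v"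
  define g where "g a b y = (if a = 0 \<and> b = q i then val else expand i u v b a y)" for a b y
  define D' where "D' y = (\<lambda>m. - D i y m)" for y
  have expand_minus: "expand i u v a b (\<lambda>m. - y m) = - expand i u v a b y" for a b y
    by (simp add: expand_def sum_negf)
  have D'_pow: "(D' ^^ r) y = (\<lambda>m. (-1) ^ r * (D i ^^ r) y m)" for r y
  proof (induction r)
    case (Suc r)
    then show ?case by (simp add: D'_def D_def sum_negf sum_distrib_left algebra_simps)
  qed simp
  have D'_p: "expand i u v 0 0 ((D' ^^ (p ^ j)) y) = - expand i u v 0 0 ((D i ^^ (p ^ j)) y)" for j y
    by (simp add: D'_pow minus_one_prime_power[OF char_p] expand_minus)
  have low: "g a (b + 1) y = g (a + 1) b y + g a b (D' y)" if "a + b + 1 < q i" for a b y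
  proof -
    have "expand i u v b (Suc a) y = expand i u v (Suc b) a y + expand i u v b a (D i y)"
      by (rule expand_swap[OF L(1-3)]; rule word_less_length) (use that in \<open>simp_all add: x\<close>)
    then show ?thesis using that by (simp add: g_def D'_def expand_minus)
  qed
  have top: "g a (b + 1) (unit k) = g (a + 1) b (unit k) + g a b (D' (unit k))" if ab: "a + b + 1 = q i" for a b
  proof (cases "a = 0")
    case True
    then have b: "b = q i - 1" "Suc b = q i" "b \<noteq> q i" using ab q1 by auto
    have "val = expand i u v b 1 (unit k) - expand i u v b 0 (D i (unit k))"
      unfolding expand_D expand_unit[OF L(4)] val_def lcomb_swap_comb b(1) using L(3,4) C_anti[of k i]
      by (simp add: unit_def if_distrib[of "\<lambda>z. z * _"] sum_negf[symmetric] cong: if_cong)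
    then show ?thesis using b(2,3) True q1 by (auto simp add: g_def D'_def expand_minus)
  next
    case False
    have *: "(u @ replicate b' i @ k # replicate a' i @ v, x) \<in> word_less" if "0 < a'" "a' + b' = q i" for a' b'
    proof -
      have "replicate (q i) i = replicate b' i @ replicate a' i"
        using that(2) by (metis add.commute replicate_add)
      then show ?thesis
        using word_less_move_left[OF ki that(1), of "u @ replicate b' i" v] by (simp add: x)
    qed
    have "expand i u v b (Suc a) (unit k) = expand i u v (Suc b) a (unit k) + expand i u v b a (D i (unit k))"
    proof (rule expand_swap[OF L(1-3)])
      fix l assume "unit k l \<noteq> 0"
      then have "l = k" by (simp add: unit_def split: if_splits)
      then show "(u @ replicate b i @ l # replicate (Suc a) i @ v, x) \<in> word_less"
        "(u @ replicate (Suc b) i @ l # replicate a i @ v, x) \<in> word_less"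
        using *[of a "Suc b"] *[of "Suc a" b] ab False by simp_all
    qed
    then show ?thesis using False by (simp add: g_def D'_def expand_minus)
  qed
  have main: "g 0 (p ^ j) (unit k) = g (p ^ j) 0 (unit k) + g 0 0 ((D' ^^ (p ^ j)) (unit k))" if "p ^ j \<le> q i" for j
    by (rule commute_prime_power[where Q = "q i" and g = g and D = D']) (use low top char_p that in auto)
  have "val = g 0 (q i) (unit k)" by (simp add: g_def)
  also have "\<dots> = g (q i) 0 (unit k) + g 0 0 ((D' ^^ q i) (unit k))" by (rule main) simp
  also have "g (q i) 0 (unit k) = f ((u @ [k]) @ replicate (q i) i @ v)"
    using q1 L by (simp add: g_def expand_unit)
  also have "\<dots> = lcomb f (power_comb i) (u @ [k]) v"
    by (rule reduce) (use L word_less_move_left[OF ki, of "q i" u v] q1 rule.power[OF L(3)] in \<open>auto simp: x\<close>)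
  also have "\<dots> = s i * f (u @ k # v) - (\<Sum>j<N i. c i j * g (p ^ j) 0 (unit k))"
    using char_p(1) prime_gt_0_nat L by (simp add: lcomb_power_comb g_def expand_unit)
  also have "(\<Sum>j<N i. c i j * g (p ^ j) 0 (unit k)) =
     (\<Sum>j<N i. c i j * g 0 (p ^ j) (unit k)) - (\<Sum>j<N i. c i j * g 0 0 ((D' ^^ (p ^ j)) (unit k)))"
    unfolding sum_subtractf[symmetric]
    by (rule sum.cong) (simp_all add: main less_imp_le[OF p_power_less] algebra_simps)
  also have "(\<Sum>j<N i. c i j * g 0 (p ^ j) (unit k)) = (\<Sum>j<N i. c i j * f (u @ replicate (p ^ j) i @ k # v))"
  proof (rule sum.cong[OF refl])
    fix j assume "j \<in> {..<N i}"
    then have "p ^ j < q i" using p_power_less by simp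
    then show "c i j * g 0 (p ^ j) (unit k) = c i j * f (u @ replicate (p ^ j) i @ k # v)"
      using L by (simp add: g_def expand_unit)
  qed
  finally have "val = s i * f (u @ k # v) - (\<Sum>j<N i. c i j * f (u @ replicate (p ^ j) i @ k # v)) -
     (expand i u v 0 0 ((D i ^^ q i) (unit k)) + (\<Sum>j<N i. c i j * expand i u v 0 0 ((D i ^^ (p ^ j)) (unit k))))"
    using q1 by (simp add: g_def D'_p sum_negf)
  then show ?thesis
    unfolding expand_annihilated[OF L(3,4)] val_def by (simp add: lcomb_power_comb)
qed

text \<open>\<open>d\<close> is the offset of the second pattern. If it does not clear the first,
  the patterns overlap as two swaps, as a swap and a power in either order, or as two powers of one
  letter; at offset zero only equal rules fit.\<close>

lemma confluent_ordered:
  assumes x: "x = u @ pat @ v" "x = u' @ pat' @ v'" and r: "rule pat cs" "rule pat' cs'"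
    and le: "length u \<le> length u'"
  shows "lcomb f cs u v = lcomb f cs' u' v'"
proof -
  obtain d where d: "u' = u @ d" "pat @ v = d @ pat' @ v'"
    using x le append_eq_prefix by blast
  show ?thesis
  proof (cases "length pat \<le> length d")
    case True
    then obtain m where m: "d = pat @ m" "v = m @ pat' @ v'"
      using append_eq_prefix[OF d(2)] by blast
    then show ?thesis using confluent_disjoint[of u pat m pat' v' cs cs'] x r d by simp
  next
    case False
    from r(1) show ?thesis
    proof cases
      case (swap i k)
      then consider "d = []" | "d = [k]" using False d(2) by (cases d; cases "tl d") auto
      then show ?thesis
      proof cases
        case 1
        from r(2) show ?thesis
        proof cases
          case (swap i' k')
          then show ?thesis using \<open>pat = [k, i]\<close> 1 d \<open>cs = _\<close> by auto
        next
          case (power i')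
          obtain e where "q i' = Suc (Suc e)" using q_gt_1[of i'] by (metis One_nat_def Suc_lessD gr0_implies_Suc less_irrefl_nat not_less_eq)
          then show ?thesis using power swap 1 d by auto
        qed
      next
        case 2
        from r(2) show ?thesis
        proof cases
          case (swap i' k')
          then show ?thesis using \<open>pat = [k, i]\<close> 2 d \<open>cs = _\<close> \<open>i < k\<close> x
            confluent_swap_swap[of u k i i' v'] by auto
        next
          case (power i')
          obtain e where e: "q i' = Suc e" using q_gt_1[of i'] by (metis One_nat_def Suc_lessD gr0_implies_Suc)
          have "i' = i" "v = replicate (q i - 1) i @ v'" using power swap 2 d e by auto
          then show ?thesis using confluent_swap_power[of u k i v'] swap power d 2 x by auto
        qed
      qed
    next
      case (power i)
      have dl: "length d < q i" using False power by simp
      have "d = take (length d) (replicate (q i) i @ v)" using d(2) power by simp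
      then have d': "d = replicate (length d) i" using dl by (simp add: min_def)
      define e where "e = length d"
      have de: "d = replicate e i" "e < q i" using d' dl by (simp_all add: e_def)
      have "replicate e i @ replicate (q i - e) i @ v = replicate e i @ pat' @ v'"
        using d(2) power de by (simp add: append_assoc[symmetric] replicate_add[symmetric] del: append_assoc)
      then have rest: "replicate (q i - e) i @ v = pat' @ v'" by simp
      obtain e' where e': "q i - e = Suc e'" using de(2) by (metis Suc_diff_Suc)
      from r(2) show ?thesis
      proof cases
        case (swap i' k')
        then have "e' = 0" using rest e' by (cases e') auto
        then have "e = q i - 1" "i = k'" "v = i' # v'" using e' rest swap by auto
        then show ?thesis using confluent_power_swap[of u i i' v'] swap power x d de by simp
      next
        case (power i')
        have "i' = i" using power rest e' q_gt_1[of i'] by (cases "q i'") auto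
        have "replicate (q i) i = replicate (q i - e) i @ replicate e i"
          using de(2) by (simp add: replicate_add[symmetric])
        then have "v = replicate e i @ v'" using rest power \<open>i' = i\<close> by simp
        then show ?thesis using confluent_power_power[of u e i v'] power \<open>cs = power_comb i\<close> \<open>i' = i\<close> x d de by simp
      qed
    qed
  qed
qed

lemma confluent: "candidate f x r \<Longrightarrow> candidate f x r' \<Longrightarrow> r = r'"
  unfolding candidate_def by (metis confluent_ordered nat_le_linear)

end

definition normal :: "nat list \<Rightarrow> bool" where
  "normal x \<longleftrightarrow> set x \<subseteq> {..<n} \<and> \<not> (\<exists>u pat cs v. x = u @ pat @ v \<and> rule pat cs)"

lemma candidate_cong:
  assumes "\<And>y. (y, x) \<in> word_less \<Longrightarrow> f y = f' y"
  shows "candidate f x r = candidate f' x r"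
proof -
  have "lcomb f cs u v = lcomb f' cs u v" if "x = u @ pat @ v" "rule pat cs" for u pat cs v
    by (rule lcomb_cong) (use assms rule_less that in blast)
  then show ?thesis unfolding candidate_def by metis
qed

text \<open>Dual form of the diamond lemma: arbitrary values on normal words extend to a functional
  respecting all relations, so normal words stay linearly independent in the quotient. The
  functional is built by well-founded recursion, where confluence makes the forced value
  unique.\<close>

theorem normal_form_functional:
  obtains f where "\<And>w. normal w \<Longrightarrow> f w = g w"
    and "\<And>u pat cs v. rule pat cs \<Longrightarrow> set (u @ pat @ v) \<subseteq> {..<n} \<Longrightarrow> f (u @ pat @ v) = lcomb f cs u v"
proof -
  \<comment> \<open>The forced value if some rule applies, the prescribed value \<open>g x\<close>
    otherwise.\<close>
  define P where "P f x r \<longleftrightarrow> (set x \<subseteq> {..<n} \<longrightarrow>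
     (\<forall>r'. candidate f x r' \<longrightarrow> r = r') \<and> ((\<nexists>r'. candidate f x r') \<longrightarrow> r = g x))" for f x r
  have "\<exists>f. \<forall>x. P f x (f x)"
  proof (rule dependent_wf_choice[OF wf_word_less])
    show "P f x r = P f' x r" if "\<And>z. (z, x) \<in> word_less \<Longrightarrow> f z = f' z" for f f' x r
      unfolding P_def using candidate_cong[of x f f'] that by blast
  next
    fix x f assume IH: "\<And>y. (y, x) \<in> word_less \<Longrightarrow> P f y (f y)"
    show "\<exists>r. P f x r"
    proof (cases "\<exists>r. candidate f x r")
      case True
      then obtain r where r: "candidate f x r" by blast
      have "f y = r'" if "(y, x) \<in> word_less" "set y \<subseteq> {..<n}" "candidate f y r'" for y r'
        using IH[OF that(1)] that(2,3) unfolding P_def by blast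
      then have "r = r'" if "set x \<subseteq> {..<n}" "candidate f x r'" for r'
        using confluent[of x f r r'] r that by blast
      then have "P f x r" unfolding P_def using r by blast
      then show ?thesis ..
    next
      case False
      then show ?thesis unfolding P_def by blast
    qed
  qed
  then obtain f where f: "\<And>x. P f x (f x)" by blast
  show ?thesis
  proof
    show "f w = g w" if "normal w" for w
      using f[of w] that unfolding P_def normal_def candidate_def by blast
    show "f (u @ pat @ v) = lcomb f cs u v" if "rule pat cs" "set (u @ pat @ v) \<subseteq> {..<n}" for u pat cs v
      using f[of "u @ pat @ v"] that unfolding P_def candidate_def by blast
  qed
qed

end

section \<open>The generic truncated enveloping algebra\<close>

lemma sorted_split_filter:
  fixes xs :: "'a::linorder list"
  assumes "sorted xs"
  shows "xs = filter (\<lambda>y. y < a) xs @ filter (\<lambda>y. y = a) xs @ filter (\<lambda>y. a < y) xs"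
  using assms
proof (induction xs)
  case (Cons x xs)
  then have IH: "xs = filter (\<lambda>y. y < a) xs @ filter (\<lambda>y. y = a) xs @ filter (\<lambda>y. a < y) xs"
    and x: "\<And>y. y \<in> set xs \<Longrightarrow> x \<le> y" by auto
  consider "x < a" | "x = a" | "a < x" by fastforce
  then show ?case
  proof cases
    case 1
    then show ?thesis using IH by auto
  next
    case 2
    then have "filter (\<lambda>y. y < a) xs = []" using x by (auto simp: filter_empty_conv not_less)
    then show ?thesis using IH 2 by auto
  next
    case 3
    then have "filter (\<lambda>y. y < a) xs = []" "filter (\<lambda>y. y = a) xs = []"
      using x by (force simp: filter_empty_conv not_less)+
    then show ?thesis using IH 3 by auto
  qed
qed simp

lemma filter_eq_replicate_count: "filter (\<lambda>y. y = a) xs = replicate (count_list xs a) a"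
  by (induction xs) auto

lemma sorted_eqI_count_list:
  fixes xs ys :: "'a::linorder list"
  assumes "sorted xs" "sorted ys" "\<And>a. count_list xs a = count_list ys a"
  shows "xs = ys"
proof -
  have "mset xs = mset ys" using assms(3) by (intro multiset_eqI) (simp add: count_mset)
  then show ?thesis using assms(1,2) by (metis properties_for_sort sorted_sort_id)
qed

section \<open>Normal words and the matrices of left multiplication\<close>

context truncated_enveloping
begin

text \<open>A descent exposes the swap pattern; a sorted word collects each letter in one block, so
  an exponent of at least \<open>q i\<close> exposes the power pattern.\<close>

lemma normal_iff:
  "normal w \<longleftrightarrow> set w \<subseteq> {..<n} \<and> sorted w \<and> (\<forall>i<n. count_list w i < q i)"
proof
  assume nw: "normal w"
  then have set: "set w \<subseteq> {..<n}" by (simp add: normal_def)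
  have "sorted w"
  proof (rule ccontr)
    assume "\<not> sorted w"
    then obtain j where j: "Suc j < length w" "w ! Suc j < w ! j"
      by (auto simp: sorted_iff_nth_Suc not_le)
    have "w = take j w @ [w ! j, w ! Suc j] @ drop (Suc (Suc j)) w"
      using j(1) by (metis Cons_nth_drop_Suc Suc_lessD append_Cons append_Nil append_take_drop_id)
    moreover have "w ! j < n" using j(1) set nth_mem[of j w] Suc_lessD by blast
    then have "rule [w ! j, w ! Suc j] (swap_comb (w ! j) (w ! Suc j))"
      using j by (intro rule.swap)
    ultimately show False using nw unfolding normal_def by blast
  qed
  moreover have "count_list w i < q i" if "i < n" for i
  proof (rule ccontr)
    assume "\<not> count_list w i < q i"
    then have "replicate (count_list w i) i = replicate (q i) i @ replicate (count_list w i - q i) i"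
      by (simp add: replicate_add[symmetric])
    then have "w = filter (\<lambda>y. y < i) w @ replicate (q i) i @
        (replicate (count_list w i - q i) i @ filter (\<lambda>y. i < y) w)"
      using sorted_split_filter[OF \<open>sorted w\<close>, of i] by (simp add: filter_eq_replicate_count)
    then show False using nw rule.power[OF that] unfolding normal_def by blast
  qed
  ultimately show "set w \<subseteq> {..<n} \<and> sorted w \<and> (\<forall>i<n. count_list w i < q i)" using set by blast
next
  assume *: "set w \<subseteq> {..<n} \<and> sorted w \<and> (\<forall>i<n. count_list w i < q i)"
  have False if "w = u @ pat @ v" "rule pat cs" for u pat cs v
    using that(2)
  proof cases
    case (swap i k)
    then show False using * that(1) by (auto simp: sorted_append)
  next
    case (power i)
    have "count_list (replicate m i) i = m" for m by (induction m) auto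
    then have "count_list w i \<ge> q i" using that(1) power by simp
    then show False using * power by fastforce
  qed
  then show "normal w" using * unfolding normal_def by blast
qed

lemma normal_eqI:
  assumes "normal w" "normal z" "\<And>i. i < n \<Longrightarrow> count_list w i = count_list z i"
  shows "w = z"
proof (rule sorted_eqI_count_list)
  show "count_list w i = count_list z i" for i
  proof (cases "i < n")
    case False
    then have "i \<notin> set w" "i \<notin> set z" using assms(1,2) by (auto simp: normal_iff)
    then show ?thesis by simp
  qed (rule assms(3))
qed (use assms normal_iff in auto)

lemma finite_normal: "finite {w. normal w}"
proof -
  have "length w \<le> (\<Sum>i<n. q i)" if "normal w" for w
  proof -
    have "length w = (\<Sum>i\<in>set w. count_list w i)" by (simp add: sum_count_set)
    also have "\<dots> \<le> (\<Sum>i<n. count_list w i)"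
      by (rule sum_mono2) (use that in \<open>auto simp: normal_iff\<close>)
    also have "\<dots> \<le> (\<Sum>i<n. q i)"
      by (rule sum_mono) (use that in \<open>auto simp: normal_iff less_imp_le\<close>)
    finally show ?thesis .
  qed
  then have "{w. normal w} \<subseteq> {w. set w \<subseteq> {..<n} \<and> length w \<le> (\<Sum>i<n. q i)}"
    by (auto simp: normal_iff)
  then show ?thesis by (rule finite_subset) (rule finite_lists_length_le, simp)
qed

text \<open>The coefficient of the normal word \<open>z\<close> in the normal form of \<open>w\<close>.\<close>

definition nf_coeff :: "nat list \<Rightarrow> nat list \<Rightarrow> 'r" where
  "nf_coeff z = (SOME f. (\<forall>w. normal w \<longrightarrow> f w = (if w = z then 1 else 0)) \<and>
     (\<forall>u pat cs v. rule pat cs \<longrightarrow> set (u @ pat @ v) \<subseteq> {..<n} \<longrightarrow> f (u @ pat @ v) = lcomb f cs u v))"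

lemma nf_coeff:
  shows nf_coeff_normal: "normal w \<Longrightarrow> nf_coeff z w = (if w = z then 1 else 0)"
    and nf_coeff_rule: "rule pat cs \<Longrightarrow> set (u @ pat @ v) \<subseteq> {..<n} \<Longrightarrow>
      nf_coeff z (u @ pat @ v) = lcomb (nf_coeff z) cs u v"
proof -
  obtain f where "\<And>w. normal w \<Longrightarrow> f w = (if w = z then 1 else 0)"
    "\<And>u pat cs v. rule pat cs \<Longrightarrow> set (u @ pat @ v) \<subseteq> {..<n} \<Longrightarrow> f (u @ pat @ v) = lcomb f cs u v"
    using normal_form_functional[where g = "\<lambda>w. if w = z then 1 else 0"] by blast
  then have "\<exists>f. (\<forall>w. normal w \<longrightarrow> f w = (if w = z then 1 else 0)) \<and>
     (\<forall>u pat cs v. rule pat cs \<longrightarrow> set (u @ pat @ v) \<subseteq> {..<n} \<longrightarrow> f (u @ pat @ v) = lcomb f cs u v)"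
    by blast
  from someI_ex[OF this]
  show "normal w \<Longrightarrow> nf_coeff z w = (if w = z then 1 else 0)"
    and "rule pat cs \<Longrightarrow> set (u @ pat @ v) \<subseteq> {..<n} \<Longrightarrow>
      nf_coeff z (u @ pat @ v) = lcomb (nf_coeff z) cs u v"
    unfolding nf_coeff_def by blast+
qed

lemma nf_coeff_commute:
  assumes "k < n" "i < n" "set w \<subseteq> {..<n}"
  shows "nf_coeff z (k # i # w) = nf_coeff z (i # k # w) + (\<Sum>l<n. C k i l * nf_coeff z (l # w))"
proof -
  have *: "nf_coeff z (k # i # w) = nf_coeff z (i # k # w) + (\<Sum>l<n. C k i l * nf_coeff z (l # w))"
    if "i < k" "k < n" for i k
    using nf_coeff_rule[OF rule.swap[OF that], of "[]" w z] that assms(3)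
    by (simp add: lcomb_swap_comb)
  consider "i < k" | "i = k" | "k < i" by linarith
  then show ?thesis
  proof cases
    case 3
    have "(\<Sum>l<n. C i k l * nf_coeff z (l # w)) = - (\<Sum>l<n. C k i l * nf_coeff z (l # w))"
      unfolding sum_negf[symmetric] by (rule sum.cong) (use assms C_anti[of k i] in auto)
    then show ?thesis using *[OF 3] assms by simp
  qed (use * assms C_self in simp_all)
qed

text \<open>A rule inside \<open>w\<close> is also a rule inside \<open>k # w\<close>, so
  \<open>w\<close> may be normalised before \<open>k\<close> is prefixed. Consequently composing
  left multiplications means multiplying matrices.\<close>

lemma nf_coeff_Cons:
  assumes "k < n" "set w \<subseteq> {..<n}"
  shows "nf_coeff z (k # w) = (\<Sum>y | normal y. nf_coeff z (k # y) * nf_coeff y w)"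
  using assms(2)
proof (induction w rule: wf_induct_rule[OF wf_word_less])
  case (1 w)
  show ?case
  proof (cases "normal w")
    case True
    then show ?thesis
      using finite_normal by (simp add: nf_coeff_normal if_distrib[of "\<lambda>z. _ * z"] cong: if_cong)
  next
    case False
    then obtain u pat cs v where w: "w = u @ pat @ v" "rule pat cs"
      using 1(2) unfolding normal_def by blast
    have "nf_coeff z (k # w) = lcomb (nf_coeff z) cs (k # u) v"
      using nf_coeff_rule[OF w(2), of "k # u" v z] w 1(2) assms(1) by simp
    also have "\<dots> = (\<Sum>(a, w')\<leftarrow>cs. a * (\<Sum>y | normal y. nf_coeff z (k # y) * nf_coeff y (u @ w' @ v)))"
      unfolding lcomb_def
    proof (intro arg_cong[where f = sum_list] map_cong refl, clarify)
      fix a w' assume "(a, w') \<in> set cs"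
      then show "a * nf_coeff z ((k # u) @ w' @ v) =
        a * (\<Sum>y | normal y. nf_coeff z (k # y) * nf_coeff y (u @ w' @ v))"
        using 1(1)[of "u @ w' @ v"] 1(2) rule_less[OF w(2)] rule_lists[OF w(2)] w(1) by simp
    qed
    also have "\<dots> = (\<Sum>y | normal y. nf_coeff z (k # y) * lcomb (nf_coeff y) cs u v)"
    proof -
      have "(\<Sum>(a, w')\<leftarrow>ds. a * (\<Sum>y | normal y. nf_coeff z (k # y) * nf_coeff y (u @ w' @ v))) =
         (\<Sum>y | normal y. nf_coeff z (k # y) * lcomb (nf_coeff y) ds u v)" for ds
        by (induction ds)
           (auto simp: lcomb_def sum.distrib sum_distrib_left algebra_simps)
      then show ?thesis .
    qed
    also have "\<dots> = (\<Sum>y | normal y. nf_coeff z (k # y) * nf_coeff y w)"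
      using nf_coeff_rule[OF w(2), of u v] w 1(2) by simp
    finally show ?thesis .
  qed
qed

text \<open>\<open>nf_coeff z (k # w)\<close> is the matrix of left multiplication by
  \<open>x_k\<close> in the basis of normal words; these matrices represent the Lie algebra.\<close>

lemma nf_coeff_bracket:
  assumes "k < n" "i < n" "normal w"
  shows "(\<Sum>y | normal y. nf_coeff z (k # y) * nf_coeff y (i # w)) -
     (\<Sum>y | normal y. nf_coeff z (i # y) * nf_coeff y (k # w)) =
     (\<Sum>l<n. C k i l * nf_coeff z (l # w))"
proof -
  have "set w \<subseteq> {..<n}" using assms(3) by (simp add: normal_iff)
  then show ?thesis
    using nf_coeff_Cons[of k "i # w" z] nf_coeff_Cons[of i "k # w" z] nf_coeff_commute[of k i w z] assms
    by (simp add: algebra_simps)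
qed

end

section \<open>Weights, leading terms and injectivity\<close>

lemma coeff_lincomb_mult:
  fixes P :: "nat \<Rightarrow> 'a::comm_ring_1 poly"
  shows "coeff ((\<Sum>k<n. [:a k:] * P k) * V) m = (\<Sum>k<n. \<Sum>b\<le>m. a k * (coeff (P k) (m - b) * coeff V b))"
proof -
  have "(\<Sum>k<n. [:a k:] * P k) * V = (\<Sum>k<n. smult (a k) (V * P k))"
    unfolding sum_distrib_right by (simp add: mult.commute)
  then show ?thesis
    by (simp add: coeff_sum coeff_mult sum_distrib_left mult.commute)
qed

locale generic_enveloping =
  truncated_enveloping n p "\<lambda>k i l. [:C k i l:]" N "\<lambda>i j. [:c i j:]"
    "\<lambda>i. monom 1 (p ^ N i * (n + i))"
  for n p :: nat and C :: "nat \<Rightarrow> nat \<Rightarrow> nat \<Rightarrow> 'f::field" and N :: "nat \<Rightarrow> nat" and c :: "nat \<Rightarrow> nat \<Rightarrow> 'f"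
begin

text \<open>Letters \<open>i < n\<close> get the weights \<open>n + i\<close>, which are distinct and so large that a bracket of two
  letters has smaller weight than their product; the indeterminate gets weight \<open>1\<close>, so that both sides of
  \<open>x\<^sub>i ^ q i = monom 1 (q i * (n + i)) + \<dots>\<close> have the same weight.\<close>

definition wt :: "nat list \<Rightarrow> nat" where
  "wt w = (\<Sum>i<n. count_list w i * (n + i))"

text \<open>In the associated graded ring letters commute and \<open>x_i ^ q i\<close> is
  \<open>t ^ (q i * (n + i))\<close>. There \<open>w\<close> becomes \<open>t ^ top_exp w\<close>
  times the monomial with exponents reduced modulo \<open>q i\<close>; \<open>top_term z b w\<close>
  says that this is \<open>t ^ b\<close> times \<open>z\<close>.\<close>

definition top_exp :: "nat list \<Rightarrow> nat" where
  "top_exp w = (\<Sum>i<n. (count_list w i div q i) * (q i * (n + i)))"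

definition top_term :: "nat list \<Rightarrow> nat \<Rightarrow> nat list \<Rightarrow> bool" where
  "top_term z b w \<longleftrightarrow> (\<forall>i<n. count_list z i = count_list w i mod q i) \<and> b = top_exp w"

lemma count_list_replicate: "count_list (replicate m a) b = (if a = b then m else 0)"
  by (induction m) auto

lemma wt_append: "wt (u @ v) = wt u + wt v"
  by (simp add: wt_def sum.distrib algebra_simps)

lemma wt_replicate: "i < n \<Longrightarrow> wt (replicate m i) = m * (n + i)"
  by (simp add: wt_def count_list_replicate if_distrib[of "\<lambda>z. z * _"] cong: if_cong)

lemma wt_Cons: "i < n \<Longrightarrow> wt (i # w) = n + i + wt w"
  using wt_append[of "[i]" w] wt_replicate[of i 1] by simp

lemma top_term_wt:
  assumes "top_term z b w"
  shows "b + wt z = wt w"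
proof -
  have "b + wt z = (\<Sum>i<n. (count_list w i div q i) * (q i * (n + i)) + (count_list w i mod q i) * (n + i))"
    using assms by (simp add: top_term_def top_exp_def wt_def sum.distrib)
  also have "\<dots> = wt w"
    unfolding wt_def
    by (rule sum.cong[OF refl]) (metis add_mult_distrib div_mult_mod_eq mult.assoc)
  finally show ?thesis .
qed

lemma top_term_cong: "(\<And>i. i < n \<Longrightarrow> count_list w i = count_list w' i) \<Longrightarrow> top_term z b w \<longleftrightarrow> top_term z b w'"
  by (simp add: top_term_def top_exp_def)

lemma top_term_normal:
  assumes "normal w" "normal z"
  shows "top_term z b w \<longleftrightarrow> z = w \<and> b = 0"
proof -
  have c: "count_list w i < q i" if "i < n" for i using assms(1) that by (simp add: normal_iff)
  then have "top_exp w = 0" by (simp add: top_exp_def)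
  moreover have "(\<forall>i<n. count_list z i = count_list w i mod q i) \<longleftrightarrow> z = w"
    using normal_eqI[OF assms(2,1)] c by auto
  ultimately show ?thesis by (simp add: top_term_def)
qed

lemma top_term_power:
  assumes "i < n"
  shows "top_term z b (u @ replicate (q i) i @ v) \<longleftrightarrow>
     q i * (n + i) \<le> b \<and> top_term z (b - q i * (n + i)) (u @ v)"
proof -
  let ?w = "u @ replicate (q i) i @ v" and ?w' = "u @ v"
  have cnt: "count_list ?w j = count_list ?w' j + (if j = i then q i else 0)" for j
    by (simp add: count_list_replicate)
  have "top_exp ?w = (\<Sum>j<n. (count_list ?w' j div q j) * (q j * (n + j)) + (if j = i then q i * (n + i) else 0))"
    unfolding top_exp_def cnt by (rule sum.cong) (auto simp: distrib_right)
  also have "\<dots> = top_exp ?w' + q i * (n + i)"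
    using assms by (simp add: top_exp_def sum.distrib)
  finally have e: "top_exp ?w = top_exp ?w' + q i * (n + i)" .
  have m: "count_list ?w j mod q j = count_list ?w' j mod q j" for j
    unfolding cnt by simp
  show ?thesis unfolding top_term_def e m by auto
qed

text \<open>From weight \<open>wt w\<close> on, coefficients are those of the graded ring: a swap
  and the main term of the power rule preserve weight, whereas brackets and lower p-powers lose
  weight and cannot contribute at \<open>b\<close>.\<close>

lemma coeff_nf_coeff:
  assumes "set w \<subseteq> {..<n}" "normal z" "wt w \<le> b + wt z"
  shows "coeff (nf_coeff z w) b = (if top_term z b w then 1 else 0)"
  using assms
proof (induction w arbitrary: b rule: wf_induct_rule[OF wf_word_less])
  case (1 w)
  have smaller: "coeff (nf_coeff z w') b' = 0"
    if "(w', w) \<in> word_less" "set w' \<subseteq> {..<n}" "wt w' < b' + wt z" for w' b'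
    using 1(1)[of w' b'] that 1(3) top_term_wt[of z b' w'] by auto
  show ?case
  proof (cases "normal w")
    case True
    then show ?thesis using top_term_normal[OF True 1(3), of b] by (simp add: nf_coeff_normal)
  next
    case False
    then obtain u pat cs v where w: "w = u @ pat @ v" "rule pat cs"
      using 1(2) unfolding normal_def by blast
    have L: "set u \<subseteq> {..<n}" "set pat \<subseteq> {..<n}" "set v \<subseteq> {..<n}" using 1(2) w by auto
    from w(2) show ?thesis
    proof cases
      case (swap i k)
      have w': "w = u @ k # i # v" using w swap by simp
      \<comment> \<open>A bracket has weight \<open>n + l\<close>, below \<open>2 * n\<close> and so
        below the weight of the two letters it replaces.\<close>
      have "coeff (nf_coeff z (u @ l # v)) b = 0" if "l < n" for l
        by (rule smaller[OF word_less_length])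
           (use L swap that 1(4) in \<open>auto simp: w' wt_append wt_Cons\<close>)
      then have "coeff (nf_coeff z w) b = coeff (nf_coeff z (u @ i # k # v)) b"
        using nf_coeff_rule[OF w(2), of u v z] L
        by (simp add: w' swap lcomb_swap_comb coeff_sum)
      also have "\<dots> = (if top_term z b (u @ i # k # v) then 1 else 0)"
        by (rule 1(1)) (use L swap 1(3,4) in \<open>auto simp: w' wt_append wt_Cons intro: word_less_swap\<close>)
      also have "top_term z b (u @ i # k # v) = top_term z b w"
        by (rule top_term_cong) (auto simp: w')
      finally show ?thesis .
    next
      case (power i)
      have w': "w = u @ replicate (q i) i @ v" using w power by simp
      let ?m = "q i * (n + i)"
      have wtw: "wt w = wt (u @ v) + ?m" by (simp add: w' wt_append wt_replicate power)
      have "coeff (nf_coeff z (u @ replicate (p ^ j) i @ v)) b = 0" if "j < N i" for j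
      proof (rule smaller[OF word_less_length])
        have "p ^ j * (n + i) < ?m"
          using p_power_less[OF that] power(3) by (intro mult_strict_right_mono) auto
        then show "wt (u @ replicate (p ^ j) i @ v) < b + wt z"
          using 1(4) power(3) unfolding wtw wt_append wt_replicate[OF power(3)] by linarith
      qed (use p_power_less[OF that] L power in \<open>auto simp: w'\<close>)
      then have "coeff (nf_coeff z w) b = coeff (monom 1 ?m * nf_coeff z (u @ v)) b"
        using nf_coeff_rule[OF w(2), of u v z] L
        by (simp add: w' power lcomb_power_comb coeff_sum)
      also have "\<dots> = (if ?m \<le> b then coeff (nf_coeff z (u @ v)) (b - ?m) else 0)"
        by (simp add: coeff_monom_mult)
      also have "\<dots> = (if ?m \<le> b \<and> top_term z (b - ?m) (u @ v) then 1 else 0)"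
        using 1(1)[of "u @ v" "b - ?m"] 1(3,4) L q_gt_1[of i] wtw word_less_length[of "u @ v" w] w' by auto
      also have "(?m \<le> b \<and> top_term z (b - ?m) (u @ v)) = top_term z b w"
        using top_term_power[OF power(3), of z b u v] w' by simp
      finally show ?thesis .
    qed
  qed
qed

lemma top_term_exists:
  obtains z where "normal z" "top_term z (top_exp w) w"
proof
  define e where "e i = count_list w i mod q i" for i
  let ?z = "concat (map (\<lambda>i. replicate (e i) i) [0..<n])"
  have cnt: "count_list (concat (map (\<lambda>i. replicate (e i) i) [0..<m])) j = (if j < m then e j else 0)" for m j
    by (induction m) (auto simp: count_list_replicate)
  have srt: "sorted (concat (map (\<lambda>i. replicate (e i) i) [0..<m]))" for m
    by (induction m) (auto simp: sorted_append)
  show "normal ?z"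
    unfolding normal_iff using cnt[of n] srt[of n] q_gt_1 by (auto simp: e_def split: if_splits)
  show "top_term ?z (top_exp w) w"
    using cnt[of n] by (simp add: top_term_def e_def)
qed

text \<open>Adding one is injective modulo \<open>q k\<close>: in the graded ring a letter sends
  different normal monomials to multiples of different ones.\<close>

lemma top_term_Cons_inj:
  assumes "normal w" "normal w'" "k < n" "top_term z b (k # w)" "top_term z b' (k # w')"
  shows "w = w' \<and> b = b'"
proof -
  have "w = w'"
  proof (rule normal_eqI[OF assms(1,2)])
    fix i assume i: "i < n"
    have "count_list (k # w) i mod q i = count_list (k # w') i mod q i"
      using assms(4,5) i by (simp add: top_term_def)
    moreover have "count_list w i < q i" "count_list w' i < q i"
      using assms(1,2) i by (simp_all add: normal_iff)
    ultimately show "count_list w i = count_list w' i"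
      by (auto simp: mod_Suc split: if_splits)
  qed
  then show ?thesis using assms(4,5) by (simp add: top_term_def)
qed

text \<open>The largest letter with nonzero coefficient times a term of maximal weight of
  \<open>v\<close> cannot cancel: smaller letters give smaller weight, and one letter is injective
  on leading monomials.\<close>

lemma action_injective:
  assumes a: "k < n" "a k \<noteq> 0"
    and v: "\<And>z. normal z \<Longrightarrow> (\<Sum>w | normal w. (\<Sum>k<n. [:a k:] * nf_coeff z (k # w)) * v w) = 0"
    and w: "normal w"
  shows "v w = (0 :: 'f poly)"
proof (rule ccontr)
  assume vw: "v w \<noteq> 0"
  define k0 where "k0 = Max {k. k < n \<and> a k \<noteq> 0}"
  have "k0 \<in> {k. k < n \<and> a k \<noteq> 0}" unfolding k0_def by (rule Max_in) (use a in auto)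
  then have k0: "k0 < n" "a k0 \<noteq> 0" by auto
  have k0_max: "k \<le> k0" if "k < n" "a k \<noteq> 0" for k
    unfolding k0_def by (rule Max_ge) (use that in auto)
  define S where "S = (\<Union>w\<in>{w. normal w}. (\<lambda>b. (w, b)) ` {b. coeff (v w) b \<noteq> 0})"
  have "finite {b. coeff (v w) b \<noteq> 0}" for w
    by (rule finite_subset[of _ "{..degree (v w)}"]) (auto intro: le_degree)
  then have finS: "finite S" unfolding S_def using finite_normal by blast
  have "(w, degree (v w)) \<in> S" unfolding S_def using w vw by auto
  then have "Max ((\<lambda>(w, b). b + wt w) ` S) \<in> (\<lambda>(w, b). b + wt w) ` S"
    using finS by (intro Max_in) auto
  then obtain w0 b0 where S0: "(w0, b0) \<in> S" and mx0: "Max ((\<lambda>(w, b). b + wt w) ` S) = b0 + wt w0"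
    by auto
  have w0: "normal w0" "coeff (v w0) b0 \<noteq> 0" using S0 unfolding S_def by auto
  have mx: "b + wt w \<le> b0 + wt w0" if "normal w" "coeff (v w) b \<noteq> 0" for w b
    unfolding mx0[symmetric] by (rule Max_ge) (use finS that in \<open>auto simp: S_def intro!: image_eqI[of _ _ "(w, b)"]\<close>)
  obtain z where z: "normal z" "top_term z (top_exp (k0 # w0)) (k0 # w0)" by (rule top_term_exists)
  define e where "e = top_exp (k0 # w0)"
  have ez: "e + wt z = n + k0 + wt w0" using top_term_wt[OF z(2)] k0 by (simp add: e_def wt_Cons)
  \<comment> \<open>Comparing weights forces \<open>k = k0\<close> and a term of maximal weight.
    Several terms may share that weight; \<open>top_term_Cons_inj\<close> separates them.\<close>
  have coeffs: "a k * (coeff (nf_coeff z (k # w)) (b0 + e - b) * coeff (v w) b) =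
      (if k = k0 \<and> w = w0 \<and> b = b0 then a k0 * coeff (v w0) b0 else 0)"
    if "k < n" "normal w" "b \<le> b0 + e" for k w b
  proof (cases "a k = 0 \<or> coeff (v w) b = 0")
    case True
    then show ?thesis using k0 w0 by auto
  next
    case False
    have le: "k \<le> k0" "b + wt w \<le> b0 + wt w0" using k0_max mx that False by auto
    have wtkw: "wt (k # w) = n + k + wt w" using that by (simp add: wt_Cons)
    have "set (k # w) \<subseteq> {..<n}" using that by (auto simp: normal_iff)
    then have c: "coeff (nf_coeff z (k # w)) (b0 + e - b) = (if top_term z (b0 + e - b) (k # w) then 1 else 0)"
      by (rule coeff_nf_coeff) (use z wtkw le ez that in auto)
    have "top_term z (b0 + e - b) (k # w) \<longleftrightarrow> k = k0 \<and> w = w0 \<and> b = b0"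
    proof
      assume t: "top_term z (b0 + e - b) (k # w)"
      have "k = k0" using top_term_wt[OF t] wtkw le ez that(3) by linarith
      then show "k = k0 \<and> w = w0 \<and> b = b0"
        using top_term_Cons_inj[OF that(2) w0(1) k0(1), of z "b0 + e - b" e] t z(2) that(3)
        unfolding e_def[symmetric] by auto
    qed (use z(2) in \<open>simp add: e_def\<close>)
    then show ?thesis unfolding c by auto
  qed
  have "0 = coeff (\<Sum>w | normal w. (\<Sum>k<n. [:a k:] * nf_coeff z (k # w)) * v w) (b0 + e)"
    using v[OF z(1)] by simp
  also have "\<dots> = (\<Sum>w | normal w. \<Sum>k<n. \<Sum>b\<le>b0 + e. a k * (coeff (nf_coeff z (k # w)) (b0 + e - b) * coeff (v w) b))"
    unfolding coeff_sum coeff_lincomb_mult ..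
  also have "\<dots> = (\<Sum>w | normal w. \<Sum>k<n. \<Sum>b\<le>b0 + e. if k = k0 \<and> w = w0 \<and> b = b0 then a k0 * coeff (v w0) b0 else 0)"
    by (intro sum.cong refl) (use coeffs in simp)
  also have "\<dots> = (\<Sum>w | normal w. \<Sum>k<n. if k = k0 then (if w = w0 then a k0 * coeff (v w0) b0 else 0) else 0)"
  proof (intro sum.cong refl)
    fix w k
    have "(\<Sum>b\<le>b0 + e. if k = k0 \<and> w = w0 \<and> b = b0 then a k0 * coeff (v w0) b0 else 0) =
       (\<Sum>b\<le>b0 + e. if b = b0 then (if k = k0 \<and> w = w0 then a k0 * coeff (v w0) b0 else 0) else 0)"
      by (rule sum.cong) auto
    then show "(\<Sum>b\<le>b0 + e. if k = k0 \<and> w = w0 \<and> b = b0 then a k0 * coeff (v w0) b0 else 0) =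
        (if k = k0 then (if w = w0 then a k0 * coeff (v w0) b0 else 0) else 0)"
      by simp
  qed
  also have "\<dots> = a k0 * coeff (v w0) b0"
    using k0 w0 finite_normal by simp
  finally show False using k0 w0 by simp
qed

end

section \<open>The representation over a polynomial ring\<close>

lemma vector_space_fun: "vector_space (\<lambda>c (v::'i \<Rightarrow> 'f::field). \<lambda>s. c * v s)"
  by unfold_locales (auto simp: fun_eq_iff algebra_simps)

lemma sum_fun_apply: "(\<Sum>i\<in>I. f i) x = (\<Sum>i\<in>I. f i x)"
  by (induction I rule: infinite_finite_induct) auto

lemma smult_sum_right: "smult a (\<Sum>i\<in>I. f i) = (\<Sum>i\<in>I. smult a (f i))"
  by (induction I rule: infinite_finite_induct) (simp_all add: smult_add_right)

text \<open>Restricted to \<open>S\<close>, the functions lie in a space of dimension at most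
  \<open>card S\<close>, so some member of the sequence depends on earlier ones. It is applied to
  the p-power iterates of a bracket operator, read as matrices.\<close>

lemma finite_support_dependent:
  fixes f :: "nat \<Rightarrow> 'i \<Rightarrow> 'f::field"
  assumes "finite S"
  shows "\<exists>N c. 0 < N \<and> (\<forall>s\<in>S. f N s = (\<Sum>j<N. c j * f j s))"
proof -
  interpret vector_space "\<lambda>c (v::'i \<Rightarrow> 'f). \<lambda>s. c * v s" by (rule vector_space_fun)
  define v where "v j = (\<lambda>s. if s \<in> S then f j s else 0)" for j
  define e :: "'i \<Rightarrow> 'i \<Rightarrow> 'f" where "e s = (\<lambda>t. if t = s then 1 else 0)" for s
  have v_span: "v j \<in> span (e ` S)" for j
  proof -
    have "v j = (\<Sum>s\<in>S. (\<lambda>t. f j s * e s t))"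
      using assms by (auto simp: v_def e_def fun_eq_iff sum_fun_apply if_distrib[of "\<lambda>z. _ * z"] cong: if_cong)
    also have "\<dots> \<in> span (e ` S)"
      by (intro span_sum span_scale span_base) auto
    finally show ?thesis .
  qed
  have "\<exists>N>0. v N \<in> span (v ` {..<N})"
  proof (rule ccontr)
    assume "\<not> ?thesis"
    then have no: "v N \<notin> span (v ` {..<N})" if "N > 0" for N using that by blast
    \<comment> \<open>Non-dependence is available for positive \<open>N\<close> only, so the
      independent family starts at index 1.\<close>
    have "independent (v ` {0<..m}) \<and> card (v ` {0<..m}) = m" for m
    proof (induction m)
      case (Suc m)
      have "span (v ` {0<..m}) \<subseteq> span (v ` {..<Suc m})" by (rule span_mono) auto
      then have out: "v (Suc m) \<notin> span (v ` {0<..m})" using no[of "Suc m"] by blast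
      moreover have "{0<..Suc m} = insert (Suc m) {0<..m}" by auto
      moreover have "v (Suc m) \<notin> v ` {0<..m}" using out span_base by blast
      ultimately show ?case using Suc by (simp add: independent_insert)
    qed (simp add: independent_empty)
    then have "independent (v ` {0<..Suc (card (e ` S))})" "card (v ` {0<..Suc (card (e ` S))}) = Suc (card (e ` S))"
      by blast+
    with independent_span_bound[of "e ` S" "v ` {0<..Suc (card (e ` S))}"] assms v_span
    show False by auto
  qed
  then obtain N where N: "N > 0" "v N \<in> span (v ` {..<N})" by blast
  have "span (v ` {..<N}) \<subseteq> {x. \<exists>c. x = (\<lambda>s. \<Sum>j<N. c j * v j s)}"
  proof (rule span_minimal)
    show "v ` {..<N} \<subseteq> {x. \<exists>c. x = (\<lambda>s. \<Sum>j<N. c j * v j s)}"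
    proof clarify
      fix j assume "j < N"
      then have "v j = (\<lambda>s. \<Sum>i<N. (if i = j then 1 else 0) * v i s)"
        by (auto simp: fun_eq_iff if_distrib[of "\<lambda>z. z * _"] cong: if_cong)
      then show "\<exists>c. v j = (\<lambda>s. \<Sum>i<N. c i * v i s)" by (intro exI)
    qed
    show "subspace {x. \<exists>c. x = (\<lambda>s. \<Sum>j<N. c j * v j s)}"
    proof (rule subspaceI)
      show "0 \<in> {x. \<exists>c. x = (\<lambda>s. \<Sum>j<N. c j * v j s)}"
        by (auto intro!: exI[of _ "\<lambda>_. 0"])
    next
      fix x y assume "x \<in> {x. \<exists>c. x = (\<lambda>s. \<Sum>j<N. c j * v j s)}" "y \<in> {x. \<exists>c. x = (\<lambda>s. \<Sum>j<N. c j * v j s)}"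
      then obtain c c' where "x = (\<lambda>s. \<Sum>j<N. c j * v j s)" "y = (\<lambda>s. \<Sum>j<N. c' j * v j s)" by blast
      then have "x + y = (\<lambda>s. \<Sum>j<N. (c j + c' j) * v j s)"
        by (simp add: fun_eq_iff sum.distrib algebra_simps)
      then show "x + y \<in> {x. \<exists>c. x = (\<lambda>s. \<Sum>j<N. c j * v j s)}"
        by (intro CollectI exI[where x = "\<lambda>j. c j + c' j"])
    next
      fix a x assume "x \<in> {x. \<exists>c. x = (\<lambda>s. \<Sum>j<N. c j * v j s)}"
      then obtain c where "x = (\<lambda>s. \<Sum>j<N. c j * v j s)" by blast
      then have "(\<lambda>s. a * x s) = (\<lambda>s. \<Sum>j<N. (a * c j) * v j s)"
        by (simp add: fun_eq_iff sum_distrib_left algebra_simps)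
      then show "(\<lambda>s. a * x s) \<in> {x. \<exists>c. x = (\<lambda>s. \<Sum>j<N. c j * v j s)}"
        by (intro CollectI exI[where x = "\<lambda>j. a * c j"])
    qed
  qed
  then obtain c where "v N = (\<lambda>s. \<Sum>j<N. c j * v j s)" using N by blast
  then have "f N s = (\<Sum>j<N. c j * f j s)" if "s \<in> S" for s
    using that by (auto simp: v_def fun_eq_iff dest: spec[of _ s])
  with N(1) show ?thesis by blast
qed

context vector_space
begin

lemma finite_dim_coordinates:
  assumes "finite_dim (UNIV :: 'b set)"
  shows "\<exists>(n::nat) (e :: nat \<Rightarrow> 'b) (coord :: 'b \<Rightarrow> nat \<Rightarrow> 'a).
    (\<forall>x. x = (\<Sum>i<n. coord x i *s e i)) \<and>
    (\<forall>x y i. coord (x + y) i = coord x i + coord y i) \<and>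
    (\<forall>c x i. coord (c *s x) i = c * coord x i)"
proof -
  obtain B0 where B0: "finite B0" "span B0 = UNIV" using assms by (auto simp: finite_dim_def)
  obtain B where B: "B \<subseteq> B0" "independent B" "B0 \<subseteq> span B"
    by (rule maximal_independent_subset)
  have spanB: "span B = UNIV" using B(3) B0(2) span_minimal[OF B(3) subspace_span] by auto
  have finB: "finite B" using B(1) B0(1) finite_subset by blast
  obtain e where e: "bij_betw e {..<card B} B"
    using ex_bij_betw_nat_finite[OF finB] by (auto simp: atLeast0LessThan)
  show ?thesis
  proof (intro exI conjI allI impI)
    show "x = (\<Sum>i<card B. representation B x (e i) *s e i)" for x
    proof -
      have "(\<Sum>i<card B. representation B x (e i) *s e i) = (\<Sum>b\<in>B. representation B x b *s b)"
        using e by (rule sum.reindex_bij_betw)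
      also have "\<dots> = x" using sum_representation_eq[OF B(2) _ finB] spanB by simp
      finally show ?thesis by simp
    qed
    show "representation B (x + y) (e i) = representation B x (e i) + representation B y (e i)" for x y i
      using representation_add[OF B(2)] spanB by simp
    show "representation B (c *s x) (e i) = c * representation B x (e i)" for c x i
      using representation_scale[OF B(2)] spanB by simp
  qed
qed

end

section \<open>Structure constants and the generic representation\<close>

context lie_algebra
begin

lemma bracket_add_left: "bracket (x + y) z = bracket x z + bracket y z"
  and bracket_scale_left: "bracket (scale a x) z = scale a (bracket x z)"
proof -
  interpret Vector_Spaces.linear scale scale "\<lambda>x. bracket x z" by (rule linear_bracket_left)
  show "bracket (x + y) z = bracket x z + bracket y z"
    and "bracket (scale a x) z = scale a (bracket x z)" by (rule add, rule scale)
qed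

lemma bracket_add_right: "bracket z (x + y) = bracket z x + bracket z y"
  and bracket_scale_right: "bracket z (scale a x) = scale a (bracket z x)"
proof -
  interpret Vector_Spaces.linear scale scale "\<lambda>x. bracket z x" by (rule linear_bracket_right)
  show "bracket z (x + y) = bracket z x + bracket z y"
    and "bracket z (scale a x) = scale a (bracket z x)" by (rule add, rule scale)
qed

lemma bracket_antisym: "bracket x y = - bracket y x"
proof -
  have "bracket (x + y) (x + y) = 0" by (rule bracket_self)
  then show ?thesis
    by (simp only: bracket_add_left bracket_add_right)
       (simp add: bracket_self eq_neg_iff_add_eq_0 add.commute)
qed

lemma bracket_zero: "bracket 0 x = 0" "bracket x 0 = 0"
  using bracket_scale_left[of 0 0 x] bracket_scale_right[of x 0 0] by simp_all

lemma bracket_sum_left: "bracket (\<Sum>i\<in>I. f i) x = (\<Sum>i\<in>I. bracket (f i) x)"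
  by (induction I rule: infinite_finite_induct) (simp_all add: bracket_zero bracket_add_left)

lemma bracket_sum_right: "bracket x (\<Sum>i\<in>I. f i) = (\<Sum>i\<in>I. bracket x (f i))"
  by (induction I rule: infinite_finite_induct) (simp_all add: bracket_zero bracket_add_right)

lemma jacobi_left: "bracket (bracket x y) z + bracket (bracket y z) x + bracket (bracket z x) y = 0"
proof -
  have "bracket (bracket x y) z = - bracket z (bracket x y)"
    "bracket (bracket y z) x = - bracket x (bracket y z)"
    "bracket (bracket z x) y = - bracket y (bracket z x)"
    by (rule bracket_antisym)+
  moreover have "- (bracket x (bracket y z) + bracket y (bracket z x) + bracket z (bracket x y)) = 0"
    using jacobi[of x y z] by simp
  ultimately show ?thesis by (simp add: algebra_simps)
qed

text \<open>\<open>A x\<close> is the matrix of left multiplication by \<open>x\<close> on normal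
  words. Its entries combine finitely many \<open>nf_coeff\<close> with constant coefficients, which
  gives a degree bound \<open>d\<close> independent of \<open>x\<close>.\<close>

theorem generic_representation:
  assumes fd: "finite_dim (UNIV :: 'l set)" and p: "prime p" "of_nat p = (0::'f)"
  obtains r d :: nat and A :: "'l \<Rightarrow> nat \<Rightarrow> nat \<Rightarrow> 'f poly"
  where "0 < r"
    and "\<And>x y i j. A (x + y) i j = A x i j + A y i j"
    and "\<And>a x i j. A (scale a x) i j = smult a (A x i j)"
    and "\<And>x y i j. i < r \<Longrightarrow> j < r \<Longrightarrow>
           A (bracket x y) i j = (\<Sum>k<r. A x i k * A y k j) - (\<Sum>k<r. A y i k * A x k j)"
    and "\<And>x i j. i < r \<Longrightarrow> j < r \<Longrightarrow> degree (A x i j) \<le> d"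
    and "\<And>x v j. x \<noteq> 0 \<Longrightarrow> (\<And>i. i < r \<Longrightarrow> (\<Sum>j<r. A x i j * v j) = 0) \<Longrightarrow> j < r \<Longrightarrow> v j = 0"
proof -
  have "\<exists>(n::nat) (e :: nat \<Rightarrow> 'l) (coord :: 'l \<Rightarrow> nat \<Rightarrow> 'f). (\<forall>x. x = (\<Sum>i<n. scale (coord x i) (e i))) \<and>
    (\<forall>x y i. coord (x + y) i = coord x i + coord y i) \<and>
    (\<forall>c x i. coord (scale c x) i = c * coord x i)"
    by (rule finite_dim_coordinates[OF fd])
  then obtain n :: nat and e :: "nat \<Rightarrow> 'l" and coord :: "'l \<Rightarrow> nat \<Rightarrow> 'f" where e: "\<And>x. x = (\<Sum>i<n. scale (coord x i) (e i))"
    and coord_add: "\<And>x y i. coord (x + y) i = coord x i + coord y i"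
    and coord_scale: "\<And>c x i. coord (scale c x) i = c * coord x i"
    by blast
  have coord_zero: "coord 0 i = 0" for i using coord_scale[of 0 0 i] by simp
  have coord_neg: "coord (- x) i = - coord x i" for x i
    using coord_add[of x "- x" i] coord_zero by (simp add: eq_neg_iff_add_eq_0 add.commute)
  have coord_sum: "coord (\<Sum>j\<in>J. f j) i = (\<Sum>j\<in>J. coord (f j) i)" for J :: "nat set" and f i
    by (induction J rule: infinite_finite_induct) (simp_all add: coord_zero coord_add)
  define C where "C k i l = coord (bracket (e k) (e i)) l" for k i l
  have bracket_coord: "coord (bracket x (e i)) m = (\<Sum>l<n. coord x l * C l i m)" for x i m
    by (subst e[of x]) (simp add: bracket_sum_left bracket_scale_left coord_sum coord_scale C_def)
  have bracket_coord2: "coord (bracket x y) m = (\<Sum>k<n. \<Sum>i<n. coord x k * coord y i * C k i m)" for x y m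
  proof -
    have "coord (bracket x y) m = (\<Sum>i<n. \<Sum>k<n. coord x k * coord y i * C k i m)"
      by (subst e[of y]) (simp add: bracket_sum_right bracket_scale_right coord_sum coord_scale
          bracket_coord sum_distrib_left mult.left_commute mult.assoc)
    also have "\<dots> = (\<Sum>k<n. \<Sum>i<n. coord x k * coord y i * C k i m)" by (rule sum.swap)
    finally show ?thesis .
  qed
  define D where "D i y m = (\<Sum>l<n. y l * C l i m)" for i y m
  define u :: "nat \<Rightarrow> nat \<Rightarrow> 'f" where "u k l = (if l = k then 1 else 0)" for k l
  \<comment> \<open>\<open>D i\<close> is the bracket with \<open>x_i\<close> in coordinates; a
    dependence among its p-power iterates supplies \<open>N i\<close> and
    \<open>c i\<close>.\<close>
  have "\<forall>i. \<exists>N. \<exists>c. 0 < N \<and> (\<forall>k m. k < n \<longrightarrow> m < n \<longrightarrow> (D i ^^ (p ^ N)) (u k) m =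
       (\<Sum>j<N. c j * (D i ^^ (p ^ j)) (u k) m))"
  proof
    fix i
    have fin: "finite ({..<n} \<times> {..<n})" by simp
    obtain N c where N: "0 < N" and c: "\<forall>s\<in>{..<n} \<times> {..<n}.
        (D i ^^ (p ^ N)) (u (fst s)) (snd s) = (\<Sum>j<N. c j * (D i ^^ (p ^ j)) (u (fst s)) (snd s))"
      using finite_support_dependent[OF fin, where f = "\<lambda>j s. (D i ^^ (p ^ j)) (u (fst s)) (snd s)"] by blast
    show "\<exists>N. \<exists>c. 0 < N \<and> (\<forall>k m. k < n \<longrightarrow> m < n \<longrightarrow> (D i ^^ (p ^ N)) (u k) m =
       (\<Sum>j<N. c j * (D i ^^ (p ^ j)) (u k) m))"
      by (intro exI[of _ N] exI[of _ c] conjI N allI impI) (use c in auto)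
  qed
  from choice[OF this] obtain N where "\<forall>i. \<exists>c. 0 < N i \<and> (\<forall>k m. k < n \<longrightarrow> m < n \<longrightarrow> (D i ^^ (p ^ N i)) (u k) m =
       (\<Sum>j<N i. c j * (D i ^^ (p ^ j)) (u k) m))" ..
  from choice[OF this] obtain c where Nc': "\<forall>i. 0 < N i \<and> (\<forall>k m. k < n \<longrightarrow> m < n \<longrightarrow> (D i ^^ (p ^ N i)) (u k) m =
       (\<Sum>j<N i. c i j * (D i ^^ (p ^ j)) (u k) m))" ..
  then have N: "0 < N i" for i by blast
  have Nc: "(D i ^^ (p ^ N i)) (u k) m = (\<Sum>j<N i. c i j * (D i ^^ (p ^ j)) (u k) m)"
    if "k < n" "m < n" for i k m
    using Nc' that by blast
  \<comment> \<open>The structure constants lie in F, so iterated brackets of basis vectors remain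
    constant polynomials and the relation over F carries over to F[t].\<close>
  have pow_const: "((\<lambda>y m. \<Sum>l<n. y l * [:C l i m:]) ^^ r) (\<lambda>l. if l = k then 1 else 0) = (\<lambda>m. [:(D i ^^ r) (u k) m:])"
    for i r k
  proof (induction r)
    case 0
    show ?case by (auto simp: u_def fun_eq_iff)
  next
    case (Suc r)
    have "(\<Sum>l<n. [:(D i ^^ r) (u k) l:] * [:C l i m:]) = [:D i ((D i ^^ r) (u k)) m:]" for m
      by (simp add: D_def sum_to_poly mult.commute)
    then show ?case using Suc by simp
  qed
  \<comment> \<open>The dependence is moved to the left-hand side, hence the negated
    coefficients.\<close>
  interpret E: generic_enveloping n p C N "\<lambda>i j. - c i j"
  proof
    show "[:C i i l:] = 0" for i l by (simp add: C_def bracket_self coord_zero)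
    show "[:C k i l:] = - [:C i k l:]" for i k l
      using bracket_antisym[of "e k" "e i"] by (simp add: C_def coord_neg)
    fix i j k m
    have "coord (bracket (bracket (e i) (e j)) (e k) + bracket (bracket (e j) (e k)) (e i)
        + bracket (bracket (e k) (e i)) (e j)) m = 0"
      unfolding jacobi_left by (rule coord_zero)
    then have "(\<Sum>l<n. C i j l * C l k m) + (\<Sum>l<n. C j k l * C l i m) + (\<Sum>l<n. C k i l * C l j m) = 0"
      by (simp only: coord_add bracket_coord[of "bracket (e i) (e j)"] bracket_coord[of "bracket (e j) (e k)"]
          bracket_coord[of "bracket (e k) (e i)"] C_def)
    then show "(\<Sum>l<n. [:C i j l:] * [:C l k m:] + [:C j k l:] * [:C l i m:] + [:C k i l:] * [:C l j m:]) = 0"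
      by (simp add: sum_to_poly sum.distrib mult.commute)
  next
    show "prime p" by fact
    show "of_nat p = (0 :: 'f poly)" using p(2) by (simp add: of_nat_poly)
    show "N i > 0" for i by (rule N)
    show "((\<lambda>y m. \<Sum>l<n. y l * [:C l i m:]) ^^ (p ^ N i)) (\<lambda>l. if l = k then 1 else 0) m +
        (\<Sum>j<N i. [:- c i j:] * ((\<lambda>y m. \<Sum>l<n. y l * [:C l i m:]) ^^ (p ^ j)) (\<lambda>l. if l = k then 1 else 0) m) = 0"
      if "k < n" "m < n" for i k m
      unfolding pow_const using Nc[OF that] by (simp add: sum_to_poly sum_negf mult.commute)
  qed
  define S where "S = {w. E.normal w}"
  have finS: "finite S" unfolding S_def by (rule E.finite_normal)
  have "[] \<in> S" by (simp add: S_def E.normal_iff)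
  define r where "r = card S"
  obtain b where b: "bij_betw b {..<r} S"
    using ex_bij_betw_nat_finite[OF finS] by (auto simp: atLeast0LessThan r_def)
  have sum_b: "(\<Sum>i<r. f (b i)) = (\<Sum>w\<in>S. f w)" for f :: "_ \<Rightarrow> 'f poly"
    using b by (rule sum.reindex_bij_betw)
  have bS: "b i \<in> S" if "i < r" for i using b that by (auto simp: bij_betw_def)
  define A where "A x i j = (\<Sum>k<n. [:coord x k:] * E.nf_coeff (b i) (k # b j))" for x i j
  \<comment> \<open>For \<open>n = 0\<close> this is the maximum of the empty set; every entry is
    then an empty sum, of degree 0.\<close>
  define d where "d = Max ((\<lambda>(i, j, k). degree (E.nf_coeff (b i) (k # b j))) ` ({..<r} \<times> {..<r} \<times> {..<n}))"
  show ?thesis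
  proof (rule that[where r = r and d = d and A = A])
    show "0 < r" using \<open>[] \<in> S\<close> finS by (auto simp: r_def card_gt_0_iff)
    show "A (x + y) i j = A x i j + A y i j" for x y i j
      by (simp add: A_def coord_add sum.distrib smult_add_left)
    show "A (scale a x) i j = smult a (A x i j)" for a x i j
      by (simp add: A_def coord_scale smult_sum_right)
    show "degree (A x i j) \<le> d"
      if "i < r" "j < r" for x i j
      unfolding A_def
    proof (rule degree_sum_le)
      fix k assume k: "k \<in> {..<n}"
      have "degree ([:coord x k:] * E.nf_coeff (b i) (k # b j)) \<le> degree (E.nf_coeff (b i) (k # b j))"
        by (simp add: degree_smult_le)
      also have "\<dots> \<le> d"
        unfolding d_def by (rule Max_ge) (use that k in \<open>auto intro!: image_eqI[of _ _ "(i, j, k)"]\<close>)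
      finally show "degree ([:coord x k:] * E.nf_coeff (b i) (k # b j)) \<le> d" .
    qed simp
    show "A (bracket x y) i j = (\<Sum>k<r. A x i k * A y k j) - (\<Sum>k<r. A y i k * A x k j)"
      if "i < r" "j < r" for x y i j
    proof -
      let ?Z = "\<lambda>k i' y. E.nf_coeff (b i) (k # y) * E.nf_coeff y (i' # b j)"
      have prd: "(\<Sum>k<r. A x i k * A y k j) =
         (\<Sum>k<n. \<Sum>l<n. [:coord x k * coord y l:] * (\<Sum>w\<in>S. ?Z k l w))" for x y
      proof -
        have "(\<Sum>k<r. A x i k * A y k j) = (\<Sum>w\<in>S. (\<Sum>k<n. [:coord x k:] * E.nf_coeff (b i) (k # w)) *
            (\<Sum>l<n. [:coord y l:] * E.nf_coeff w (l # b j)))"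
          unfolding A_def by (rule sum_b)
        also have "\<dots> = (\<Sum>w\<in>S. \<Sum>k<n. \<Sum>l<n. [:coord x k * coord y l:] * ?Z k l w)"
          by (simp add: sum_product mult.commute mult.left_commute)
        also have "\<dots> = (\<Sum>k<n. \<Sum>l<n. \<Sum>w\<in>S. [:coord x k * coord y l:] * ?Z k l w)"
          by (subst sum.swap, rule sum.cong[OF refl], subst sum.swap) simp
        finally show ?thesis by (simp add: sum_distrib_left smult_sum_right)
      qed
      have "(\<Sum>k<r. A x i k * A y k j) - (\<Sum>k<r. A y i k * A x k j) =
         (\<Sum>k<n. \<Sum>l<n. [:coord x k * coord y l:] * ((\<Sum>w\<in>S. ?Z k l w) - (\<Sum>w\<in>S. ?Z l k w)))"
      proof -
        have "(\<Sum>k<n. \<Sum>l<n. [:coord y k * coord x l:] * (\<Sum>w\<in>S. ?Z k l w)) =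
           (\<Sum>k<n. \<Sum>l<n. [:coord x k * coord y l:] * (\<Sum>w\<in>S. ?Z l k w))"
          by (subst sum.swap) (simp only: mult.commute[of "coord y _"])
        then show ?thesis unfolding prd by (simp only: right_diff_distrib sum_subtractf)
      qed
      also have "\<dots> = (\<Sum>k<n. \<Sum>l<n. [:coord x k * coord y l:] * (\<Sum>m<n. [:C k l m:] * E.nf_coeff (b i) (m # b j)))"
        using E.nf_coeff_bracket[of _ _ "b j" "b i"] bS[OF that(2)] by (simp add: S_def)
      also have "\<dots> = (\<Sum>m<n. (\<Sum>k<n. \<Sum>l<n. [:coord x k * coord y l * C k l m:]) * E.nf_coeff (b i) (m # b j))"
      proof -
        have "(\<Sum>m<n. (\<Sum>k<n. \<Sum>l<n. [:coord x k * coord y l * C k l m:]) * E.nf_coeff (b i) (m # b j)) =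
          (\<Sum>k<n. \<Sum>m<n. (\<Sum>l<n. [:coord x k * coord y l * C k l m:]) * E.nf_coeff (b i) (m # b j))"
          by (subst sum.swap) (simp only: sum_distrib_right)
        also have "\<dots> = (\<Sum>k<n. \<Sum>l<n. \<Sum>m<n. [:coord x k * coord y l * C k l m:] * E.nf_coeff (b i) (m # b j))"
          unfolding sum_distrib_right by (rule sum.cong[OF refl], rule sum.swap)
        finally show ?thesis by (simp add: sum_distrib_left smult_sum_right mult_ac)
      qed
      also have "\<dots> = A (bracket x y) i j"
        by (simp add: A_def bracket_coord2 sum_to_poly)
      finally show ?thesis by simp
    qed
    show "v j = 0" if x: "x \<noteq> 0" and v: "\<And>i. i < r \<Longrightarrow> (\<Sum>j<r. A x i j * v j) = 0" and j: "j < r" for x v j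
    proof -
      have "\<exists>k<n. coord x k \<noteq> 0"
      proof (rule ccontr)
        assume "\<not> ?thesis"
        then have "(\<Sum>i<n. scale (coord x i) (e i)) = 0" by (intro sum.neutral) auto
        with e[of x] have "x = 0" by (rule trans)
        with x show False ..
      qed
      then obtain k where k: "k < n" "coord x k \<noteq> 0" by blast
      define v' where "v' w = v (inv_into {..<r} b w)" for w
      have v'b: "v' (b i) = v i" if "i < r" for i
        using b that by (simp add: v'_def bij_betw_def inv_into_f_f)
      have "v' (b j) = 0"
      proof (rule E.action_injective[where a = "coord x", OF k])
        show "E.normal (b j)" using bS[OF j] by (simp add: S_def)
        fix z assume "E.normal z"
        then obtain i where i: "i < r" "z = b i" using b by (auto simp: bij_betw_def S_def)
        have "(\<Sum>w\<in>S. (\<Sum>k<n. [:coord x k:] * E.nf_coeff z (k # w)) * v' w) = (\<Sum>j<r. A x i j * v j)"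
          unfolding sum_b[symmetric] A_def i by (rule sum.cong) (simp_all add: v'b)
        then show "(\<Sum>w | E.normal w. (\<Sum>k<n. [:coord x k:] * E.nf_coeff z (k # w)) * v' w) = 0"
          using v[OF i(1)] by (simp add: S_def)
      qed
      then show ?thesis using v'b[OF j] by simp
    qed
  qed
qed

end

section \<open>Irreducible submodules and specialisation\<close>

context lie_module
begin

lemma submodule_self: "submodule V"
  unfolding submodule_def using subspace_V rho_closed by simp

text \<open>A nonzero submodule of least dimension is minimal: a basis of a proper submodule could
  be enlarged by one vector inside it.\<close>

lemma exists_minimal_submodule:
  assumes fin: "finite B0" "V \<subseteq> V.span B0" and "V \<noteq> {0}"
  obtains W where "submodule W" "W \<noteq> {0}" "V.finite_dim W"
    "\<And>U. submodule U \<Longrightarrow> U \<subseteq> W \<Longrightarrow> U = {0} \<or> U = W"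
proof -
  define P where "P k \<longleftrightarrow> (\<exists>W B. submodule W \<and> W \<noteq> {0} \<and> V.independent B \<and> finite B \<and> V.span B = W \<and> card B = k)" for k
  have basis: "\<exists>B. V.independent B \<and> finite B \<and> V.span B = W" if W: "submodule W" for W
  proof -
    obtain B where B: "B \<subseteq> W" "V.independent B" "W \<subseteq> V.span B"
      by (rule V.maximal_independent_subset)
    have "B \<subseteq> V.span B0" using B(1) W fin(2) by (auto simp: submodule_def)
    then have "finite B" using V.independent_span_bound[OF fin(1) B(2)] by simp
    moreover have "V.span B = W"
      using B W by (intro antisym V.span_minimal) (auto simp: submodule_def)
    ultimately show ?thesis using B(2) by blast
  qed
  have "\<exists>k. P k" unfolding P_def using basis[OF submodule_self] submodule_self \<open>V \<noteq> {0}\<close> by blast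
  then have "P (LEAST k. P k)" by (rule LeastI_ex)
  then obtain W B where W: "submodule W" "W \<noteq> {0}"
    and B: "V.independent B" "finite B" "V.span B = W" "card B = (LEAST k. P k)" unfolding P_def by blast
  have "U = {0} \<or> U = W" if U: "submodule U" "U \<subseteq> W" for U
  proof (rule ccontr)
    assume *: "\<not> ?thesis"
    obtain B' where B': "V.independent B'" "finite B'" "V.span B' = U" using basis[OF U(1)] by blast
    have "P (card B')" unfolding P_def using U(1) * B' by blast
    then have le: "card B \<le> card B'" unfolding B(4) by (rule Least_le)
    obtain x where x: "x \<in> W" "x \<notin> V.span B'" using * U(2) B'(3) by blast
    then have "x \<notin> B'" using V.span_base by blast
    have "V.independent (insert x B')" using x(2) B'(1) \<open>x \<notin> B'\<close> by (simp add: V.independent_insert)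
    moreover have "insert x B' \<subseteq> V.span B" using x(1) B' U(2) B(3) V.span_superset[of B'] by auto
    ultimately have "card (insert x B') \<le> card B" using V.independent_span_bound[OF B(2)] by blast
    then show False using le \<open>x \<notin> B'\<close> B'(2) by simp
  qed
  moreover have "V.finite_dim W" unfolding V.finite_dim_def using B by blast
  ultimately show ?thesis using that W by blast
qed

lemma lie_module_submodule:
  assumes "submodule W"
  shows "lie_module scaleL bracket scaleV W \<rho>"
proof unfold_locales
  have "W \<subseteq> V" using assms by (simp add: submodule_def)
  then have W: "v \<in> V" if "v \<in> W" for v using that by blast
  show "V.subspace W" using assms by (simp add: submodule_def)
  show "\<rho> x v \<in> W" if "v \<in> W" for x v using assms that by (simp add: submodule_def)
qed (use assms in \<open>auto simp: submodule_def rho_add rho_scale add_rho scale_rho bracket_rho subset_iff\<close>)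

theorem exists_faithful_irreducible_submodule:
  assumes fin: "finite B0" "V \<subseteq> V.span B0" and "V \<noteq> {0}"
    and inj: "\<And>x v. x \<noteq> 0 \<Longrightarrow> v \<in> V \<Longrightarrow> \<rho> x v = 0 \<Longrightarrow> v = 0"
  shows "\<exists>W. lie_module scaleL bracket scaleV W \<rho> \<and> V.finite_dim W \<and>
    lie_module.faithful W \<rho> \<and> lie_module.irreducible scaleV W \<rho>"
proof -
  obtain W where W: "submodule W" "W \<noteq> {0}" "V.finite_dim W"
    and min: "\<And>U. submodule U \<Longrightarrow> U \<subseteq> W \<Longrightarrow> U = {0} \<or> U = W"
    using exists_minimal_submodule[OF fin \<open>V \<noteq> {0}\<close>] by metis
  interpret W: lie_module scaleL bracket scaleV W \<rho> by (rule lie_module_submodule[OF W(1)])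
  have "W \<subseteq> V" using W(1) by (simp add: submodule_def)
  have "W.irreducible"
    unfolding W.irreducible_def
  proof (intro conjI allI impI)
    fix U assume "W.submodule U"
    then have "submodule U" "U \<subseteq> W"
      using \<open>W \<subseteq> V\<close> by (auto simp: submodule_def W.submodule_def)
    then show "U = {0} \<or> U = W" by (rule min)
  qed (rule W(2))
  moreover have "W.faithful"
    unfolding W.faithful_def
  proof (rule injI)
    fix x y assume eq: "restrict (\<rho> x) W = restrict (\<rho> y) W"
    obtain w where w: "w \<in> W" "w \<noteq> 0" using W(2) V.subspace_0[OF W.subspace_V] by blast
    have wV: "w \<in> V" using w(1) \<open>W \<subseteq> V\<close> by blast
    have "\<rho> x w = \<rho> y w" using fun_cong[OF eq, of w] w(1) by simp
    moreover have "\<rho> (x - y) w + \<rho> y w = \<rho> x w" using add_rho[OF wV, of "x - y" y] by simp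
    ultimately have "\<rho> (x - y) w = 0" by simp
    then show "x = y" using inj[of "x - y" w] wV w(2) by auto
  qed
  ultimately show ?thesis using W.lie_module_axioms W(3) by blast
qed

end

text \<open>A trivial kernel over F[t] makes the determinant nonzero, and its degree is at most
  \<open>d * r\<close>, so \<open>Q\<close> does not divide it. The adjugate turns
  \<open>A v\<close> into \<open>det M * v j\<close>, hence the prime \<open>Q\<close> divides
  \<open>v j\<close>.\<close>

lemma det_nonzero_specialisation:
  fixes A :: "nat \<Rightarrow> nat \<Rightarrow> 'f::field poly"
  assumes Q: "irreducible Q" "d * r < degree Q"
    and deg: "\<And>i j. i < r \<Longrightarrow> j < r \<Longrightarrow> degree (A i j) \<le> d"
    and inj: "\<And>u j. (\<And>i. i < r \<Longrightarrow> (\<Sum>j<r. A i j * u j) = 0) \<Longrightarrow> j < r \<Longrightarrow> u j = 0"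
    and v: "\<And>i. i < r \<Longrightarrow> Q dvd (\<Sum>j<r. A i j * v j)" and j: "j < r"
  shows "Q dvd v j"
proof -
  define M where "M = mat r r (\<lambda>(i, j). A i j)"
  have M: "M \<in> carrier_mat r r" by (simp add: M_def)
  have "det M \<noteq> 0"
  proof
    assume "det M = 0"
    then obtain u where u: "u \<in> carrier_vec r" "u \<noteq> 0\<^sub>v r" "M *\<^sub>v u = 0\<^sub>v r"
      using det_0_iff_vec_prod_zero[OF M] by blast
    have "(\<Sum>j<r. A i j * u $ j) = 0" if i: "i < r" for i
    proof -
      have "(M *\<^sub>v u) $ i = (\<Sum>j<r. A i j * u $ j)"
        using i u(1) by (simp add: M_def scalar_prod_def atLeast0LessThan)
      then show ?thesis using u(3) i by simp
    qed
    then have "u $ j = 0" if "j < r" for j using inj[of "\<lambda>j. u $ j" j] that by blast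
    then have "u = 0\<^sub>v r" using u(1) by (intro eq_vecI) auto
    then show False using u(2) by simp
  qed
  have "degree (det M) \<le> d * r"
    by (rule degree_det_le[OF _ M]) (simp add: M_def deg)
  then have "\<not> Q dvd det M"
    using \<open>det M \<noteq> 0\<close> Q(2) dvd_imp_degree_le[of Q "det M"] by auto
  have adj: "adj_mat M \<in> carrier_mat r r" "adj_mat M * M = det M \<cdot>\<^sub>m 1\<^sub>m r"
    using adj_mat[OF M] by simp_all
  have entry: "(\<Sum>i<r. adj_mat M $$ (j, i) * A i k) = (if j = k then det M else 0)" if k: "k < r" for k
  proof -
    have "(adj_mat M * M) $$ (j, k) = (\<Sum>i<r. adj_mat M $$ (j, i) * A i k)"
      using j k adj(1) M by (simp add: scalar_prod_def atLeast0LessThan) (simp add: M_def)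
    then show ?thesis using adj(2) j k by (cases "j = k") auto
  qed
  have "(\<Sum>i<r. adj_mat M $$ (j, i) * (\<Sum>k<r. A i k * v k)) = (\<Sum>k<r. (\<Sum>i<r. adj_mat M $$ (j, i) * A i k) * v k)"
    unfolding sum_distrib_left sum_distrib_right by (subst sum.swap) (simp only: mult.assoc)
  also have "\<dots> = (\<Sum>k<r. if j = k then det M * v k else 0)"
    by (rule sum.cong) (simp_all add: entry)
  also have "\<dots> = det M * v j" using j by simp
  finally have "det M * v j = (\<Sum>i<r. adj_mat M $$ (j, i) * (\<Sum>k<r. A i k * v k))" by simp
  moreover have "Q dvd (\<Sum>i<r. adj_mat M $$ (j, i) * (\<Sum>k<r. A i k * v k))"
    by (intro dvd_sum dvd_mult v) simp
  ultimately have "Q dvd det M * v j" by simp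
  moreover have "prime_elem Q" using Q(1) by (simp add: field_poly_irreducible_imp_prime)
  ultimately show ?thesis using \<open>\<not> Q dvd det M\<close> prime_elem_dvd_multD by blast
qed

context lie_algebra
begin

text \<open>The module is the \<open>r\<close>-fold power of F[t]/Q with \<open>x\<close> acting as
  \<open>A x\<close> modulo \<open>Q\<close>, transported to sequences over F by listing
  coefficients.\<close>

theorem specialised_representation:
  fixes r d :: nat and A :: "'l \<Rightarrow> nat \<Rightarrow> nat \<Rightarrow> 'f poly"
  assumes r: "0 < r"
    and A_add: "\<And>x y i j. A (x + y) i j = A x i j + A y i j"
    and A_scale: "\<And>a x i j. A (scale a x) i j = smult a (A x i j)"
    and A_bracket: "\<And>x y i j. i < r \<Longrightarrow> j < r \<Longrightarrow>
           A (bracket x y) i j = (\<Sum>k<r. A x i k * A y k j) - (\<Sum>k<r. A y i k * A x k j)"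
    and A_degree: "\<And>x i j. i < r \<Longrightarrow> j < r \<Longrightarrow> degree (A x i j) \<le> d"
    and A_inj: "\<And>x v j. x \<noteq> 0 \<Longrightarrow> (\<And>i. i < r \<Longrightarrow> (\<Sum>j<r. A x i j * v j) = 0) \<Longrightarrow> j < r \<Longrightarrow> v j = 0"
    and Q: "irreducible (Q :: 'f poly)" "d * r < degree Q"
  shows "\<exists>(V :: (nat \<Rightarrow> 'f) set) (\<rho> :: 'l \<Rightarrow> (nat \<Rightarrow> 'f) \<Rightarrow> (nat \<Rightarrow> 'f)).
           lie_module scale bracket seq_scale V \<rho> \<and>
           vector_space.finite_dim seq_scale V \<and>
           lie_module.faithful V \<rho> \<and>
           lie_module.irreducible seq_scale V \<rho>"
proof -
  interpret S: vector_space "seq_scale :: 'f \<Rightarrow> _" by (rule vector_space_seq_scale)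
  define e where "e = degree Q"
  have e: "0 < e" using Q(2) by (simp add: e_def)
  have Q0: "Q \<noteq> 0" using Q(1) by auto
  \<comment> \<open>Entry \<open>i * e + k\<close> of a sequence is the coefficient of
    \<open>t ^ k\<close> in component \<open>i\<close>; \<open>enc\<close> pads with zeros from
    \<open>r * e\<close> on.\<close>
  define dec :: "(nat \<Rightarrow> 'f) \<Rightarrow> nat \<Rightarrow> 'f poly" where "dec s i = (\<Sum>k<e. monom (s (i * e + k)) k)" for s i
  define enc :: "(nat \<Rightarrow> 'f poly) \<Rightarrow> nat \<Rightarrow> 'f" where "enc v n = (if n < r * e then coeff (v (n div e)) (n mod e) else 0)" for v n
  define V where "V = {s :: nat \<Rightarrow> 'f. \<forall>n\<ge>r * e. s n = 0}"
  define act where "act x v i = (\<Sum>j<r. A x i j * v j) mod Q" for x v i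
  define \<rho> where "\<rho> x s = enc (act x (dec s))" for x s
  have coeff_dec: "coeff (dec s i) k = (if k < e then s (i * e + k) else 0)" for s i k
    by (simp add: dec_def coeff_sum)
  have enc_dec: "enc (dec s) = s" if "s \<in> V" for s
    using that e by (auto simp: fun_eq_iff enc_def coeff_dec V_def)
  have dec_enc: "dec (enc v) i = v i" if "i < r" "degree (v i) < e" for v i
  proof (rule poly_eqI)
    fix k
    show "coeff (dec (enc v) i) k = coeff (v i) k"
    proof (cases "k < e")
      case True
      have "i * e + k < r * e"
      proof -
        have "i * e + k < Suc i * e" using True by simp
        also have "\<dots> \<le> r * e" using that(1) by (intro mult_le_mono1) simp
        finally show ?thesis .
      qed
      then show ?thesis using True by (simp add: coeff_dec enc_def)
    next
      case False
      then show ?thesis using that(2) by (simp add: coeff_dec coeff_eq_0)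
    qed
  qed
  have act_degree: "degree (act x v i) < e" for x v i
    unfolding act_def e_def using degree_mod_less[OF Q0] e by (metis degree_0 e_def)
  have act_cong: "act x v = act x v'" if "\<And>j. j < r \<Longrightarrow> v j = v' j" for x v v'
    unfolding act_def using that by (intro ext arg_cong[where f = "\<lambda>z. z mod Q"] sum.cong) auto
  have dec_\<rho>: "dec (\<rho> x s) i = act x (dec s) i" if "i < r" for x s i
    unfolding \<rho>_def using dec_enc[OF that act_degree] .
  have enc_add: "enc (\<lambda>i. v i + w i) = enc v + enc w" and enc_diff: "enc (\<lambda>i. v i - w i) = enc v - enc w"
    and enc_scale: "enc (\<lambda>i. smult c (v i)) = seq_scale c (enc v)" for v w c
    by (auto simp: enc_def fun_eq_iff seq_scale_def)
  have dec_add: "dec (s + t) = (\<lambda>i. dec s i + dec t i)" and dec_scale: "dec (seq_scale c s) = (\<lambda>i. smult c (dec s i))" for s t c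
    by (auto simp: fun_eq_iff poly_eq_iff coeff_dec seq_scale_def)
  have enc_V: "enc v \<in> V" for v by (simp add: enc_def V_def)
  have enc_cong: "enc v = enc w" if "\<And>i. i < r \<Longrightarrow> v i = w i" for v w
  proof
    fix n
    have "n div e < r" if "n < r * e" using that e by (simp add: less_mult_imp_div_less)
    then show "enc v n = enc w n" using that by (simp add: enc_def)
  qed
  interpret M: lie_module scale bracket seq_scale V \<rho>
  proof unfold_locales
    show "S.subspace V" by (intro S.subspaceI) (auto simp: V_def seq_scale_def)
    show "\<rho> x s \<in> V" if "s \<in> V" for x s unfolding \<rho>_def by (rule enc_V)
    show "\<rho> x (s + t) = \<rho> x s + \<rho> x t" for x s t
    proof -
      have "act x (dec (s + t)) = (\<lambda>i. act x (dec s) i + act x (dec t) i)"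
        by (simp add: act_def dec_add distrib_left sum.distrib poly_mod_add_left fun_eq_iff)
      then show ?thesis by (simp add: \<rho>_def enc_add)
    qed
    show "\<rho> x (seq_scale c s) = seq_scale c (\<rho> x s)" for x c s
    proof -
      have "act x (dec (seq_scale c s)) = (\<lambda>i. smult c (act x (dec s) i))"
        by (simp add: act_def dec_scale mod_smult_left fun_eq_iff flip: smult_sum_right)
      then show ?thesis by (simp add: \<rho>_def enc_scale)
    qed
    show "\<rho> (x + y) s = \<rho> x s + \<rho> y s" for x y s
    proof -
      have "act (x + y) (dec s) = (\<lambda>i. act x (dec s) i + act y (dec s) i)"
        by (simp add: act_def A_add distrib_right sum.distrib poly_mod_add_left fun_eq_iff)
      then show ?thesis by (simp add: \<rho>_def enc_add)
    qed
    show "\<rho> (scale c x) s = seq_scale c (\<rho> x s)" for c x s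
    proof -
      have "act (scale c x) (dec s) = (\<lambda>i. smult c (act x (dec s) i))"
        by (simp add: act_def A_scale mod_smult_left fun_eq_iff flip: smult_sum_right)
      then show ?thesis by (simp add: \<rho>_def enc_scale)
    qed
    show "\<rho> (bracket x y) s = \<rho> x (\<rho> y s) - \<rho> y (\<rho> x s)" for x y s
    proof -
      let ?v = "dec s"
      have prd: "act x (dec (\<rho> y s)) i = (\<Sum>j<r. (\<Sum>k<r. A x i k * A y k j) * ?v j) mod Q" for x y i
      proof -
        have "act x (dec (\<rho> y s)) = act x (act y ?v)" by (rule act_cong) (rule dec_\<rho>)
        then have "act x (dec (\<rho> y s)) i = (\<Sum>k<r. A x i k * ((\<Sum>j<r. A y k j * ?v j) mod Q)) mod Q"
          by (simp only: act_def)
        also have "\<dots> = (\<Sum>k<r. (A x i k * ((\<Sum>j<r. A y k j * ?v j) mod Q)) mod Q) mod Q"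
          by (rule mod_sum_eq[symmetric])
        also have "\<dots> = (\<Sum>k<r. (A x i k * (\<Sum>j<r. A y k j * ?v j)) mod Q) mod Q"
          by (simp only: mod_mult_right_eq)
        also have "\<dots> = (\<Sum>k<r. A x i k * (\<Sum>j<r. A y k j * ?v j)) mod Q"
          by (rule mod_sum_eq)
        also have "(\<Sum>k<r. A x i k * (\<Sum>j<r. A y k j * ?v j)) = (\<Sum>j<r. (\<Sum>k<r. A x i k * A y k j) * ?v j)"
          unfolding sum_distrib_left sum_distrib_right by (subst sum.swap) (simp only: mult.assoc)
        finally show ?thesis .
      qed
      have "act (bracket x y) ?v i = act x (dec (\<rho> y s)) i - act y (dec (\<rho> x s)) i" if i: "i < r" for i
      proof -
        have "act (bracket x y) ?v i = ((\<Sum>j<r. (\<Sum>k<r. A x i k * A y k j) * ?v j) -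
            (\<Sum>j<r. (\<Sum>k<r. A y i k * A x k j) * ?v j)) mod Q"
          unfolding act_def sum_subtractf[symmetric]
          by (intro arg_cong[where f = "\<lambda>z. z mod Q"] sum.cong refl) (simp add: A_bracket[OF i] left_diff_distrib)
        then show ?thesis unfolding prd by (simp only: poly_mod_diff_left)
      qed
      then have "enc (act (bracket x y) ?v) = enc (\<lambda>i. act x (dec (\<rho> y s)) i - act y (dec (\<rho> x s)) i)"
        by (rule enc_cong)
      then show ?thesis unfolding enc_diff by (simp only: \<rho>_def)
    qed
  qed
  define unit where "unit m = (\<lambda>n. if n = m then 1 else 0 :: 'f)" for m :: nat
  have "V \<subseteq> S.span (unit ` {..<r * e})"
  proof
    fix s assume "s \<in> V"
    then have "s = (\<Sum>m<r * e. seq_scale (s m) (unit m))"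
      by (auto simp: fun_eq_iff sum_fun_apply seq_scale_def unit_def V_def if_distrib[of "\<lambda>z. _ * z"] not_less cong: if_cong)
    also have "\<dots> \<in> S.span (unit ` {..<r * e})"
      by (intro S.span_sum S.span_scale S.span_base) auto
    finally show "s \<in> S.span (unit ` {..<r * e})" .
  qed
  moreover have "V \<noteq> {0}"
  proof -
    have "unit 0 \<in> V" using r e by (auto simp: V_def unit_def)
    moreover have "unit 0 \<noteq> 0" by (auto simp: unit_def fun_eq_iff)
    ultimately show ?thesis by blast
  qed
  moreover have "s = 0" if x: "x \<noteq> 0" and s: "s \<in> V" and 0: "\<rho> x s = 0" for x s
  proof -
    have "dec 0 i = 0" for i by (simp add: dec_def)
    then have "act x (dec s) i = 0" if "i < r" for i using dec_\<rho>[OF that, of x s] 0 by simp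
    then have dvd: "Q dvd (\<Sum>j<r. A x i j * dec s j)" if "i < r" for i
      using that by (simp add: act_def dvd_eq_mod_eq_0)
    have "dec s j = 0" if j: "j < r" for j
    proof -
      have "Q dvd dec s j"
      proof (rule det_nonzero_specialisation[where A = "A x" and v = "dec s" and r = r and d = d and Q = Q])
        show "u k = 0" if "\<And>i. i < r \<Longrightarrow> (\<Sum>j<r. A x i j * u j) = 0" "k < r" for u k
          by (rule A_inj[OF x that])
      qed (use Q A_degree dvd j in auto)
      moreover have "degree (dec s j) < e"
        using e by (intro le_less_trans[OF degree_le[of "e - 1"]]) (auto simp: coeff_dec)
      ultimately show ?thesis using dvd_imp_degree_le[of Q "dec s j"] by (auto simp: e_def)
    qed
    then have "enc (dec s) = enc (\<lambda>_. 0)" by (intro enc_cong) simp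
    then show "s = 0" using enc_dec[OF s] by (simp add: enc_def fun_eq_iff)
  qed
  ultimately show ?thesis
    using M.exists_faithful_irreducible_submodule[of "unit ` {..<r * e}"] by blast
qed

end

section \<open>Automorphisms of prime order of algebraically closed fields\<close>

lemma root_of_unity_coprime:
  fixes x :: "'a::field"
  assumes "x ^ a = 1" "x ^ b = 1" "coprime a b"
  shows "x = 1"
proof (cases "a = 0 \<or> b = 1")
  case True
  then show ?thesis using assms by auto
next
  case False
  then obtain m k where "a * m = b * k + 1"
    using coprime_bezout_strong[OF assms(3)] by auto
  then have "x ^ (a * m) = x ^ (b * k) * x" by simp
  then show ?thesis using assms by (simp add: power_mult)
qed

text \<open>The \<open>l\<close> powers of \<open>z\<close> are distinct and so exhaust the roots of
  \<open>X ^ l - 1\<close>.\<close>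

lemma roots_of_unity_eq_powers:
  fixes z x :: "'a::field"
  assumes "prime l" "z ^ l = 1" "z \<noteq> 1" "x ^ l = 1"
  obtains j where "j < l" "x = z ^ j"
proof -
  have l: "0 < l" using assms(1) by (rule prime_gt_0_nat)
  have "z \<noteq> 0" using assms(2) l by (auto simp: power_0_left)
  have "inj_on (\<lambda>j. z ^ j) {..<l}"
  proof (rule linorder_inj_onI)
    fix i j assume ij: "i < j" "i \<in> {..<l}" "j \<in> {..<l}"
    show "z ^ i \<noteq> z ^ j"
    proof
      assume "z ^ i = z ^ j"
      moreover have "z ^ j = z ^ i * z ^ (j - i)" using ij less_imp_le by (simp flip: power_add)
      ultimately have "z ^ i * z ^ (j - i) = z ^ i * 1" by simp
      then have "z ^ (j - i) = 1" using \<open>z \<noteq> 0\<close> by simp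
      moreover have "coprime (j - i) l"
        using ij assms(1) by (metis coprime_commute diff_less_mono2 dvd_imp_le lessThan_iff less_imp_diff_less linorder_not_less prime_imp_coprime zero_less_diff)
      ultimately show False using root_of_unity_coprime assms by blast
    qed
  qed auto
  then have card: "card ((\<lambda>j. z ^ j) ` {..<l}) = l" by (simp add: card_image)
  define P :: "'a poly" where "P = monom 1 l - 1"
  have degP: "degree P = l" "P \<noteq> 0"
  proof -
    have "coeff P l = 1" using l by (simp add: P_def)
    then show "P \<noteq> 0" by auto
    show "degree P = l"
      using l unfolding P_def by (intro antisym le_degree degree_diff_le) (auto simp: degree_monom_eq)
  qed
  have poly: "poly P y = y ^ l - 1" for y by (simp add: P_def poly_monom)
  have sub: "(\<lambda>j. z ^ j) ` {..<l} \<subseteq> {y. poly P y = 0}"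
    using assms(2) by (auto simp: poly simp flip: power_mult) (metis mult.commute power_mult power_one)
  have "(\<lambda>j. z ^ j) ` {..<l} = {y. poly P y = 0}"
    by (rule card_seteq[OF poly_roots_finite[OF degP(2)] sub])
       (use card_poly_roots_bound[OF degP(2)] degP card in simp)
  moreover have "x \<in> {y. poly P y = 0}" using assms(4) by (simp add: poly)
  ultimately show ?thesis using that by auto
qed

locale field_endomorphism =
  fixes \<tau> :: "'k::field \<Rightarrow> 'k"
  assumes add: "\<tau> (x + y) = \<tau> x + \<tau> y" and mult: "\<tau> (x * y) = \<tau> x * \<tau> y" and one: "\<tau> 1 = 1"
begin

lemma zero: "\<tau> 0 = 0"
  using add[of 0 0] by (metis add_cancel_right_right add_0)

lemma minus: "\<tau> (- x) = - \<tau> x"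
  using add[of x "- x"] zero by (simp add: eq_neg_iff_add_eq_0 add.commute)

lemma diff: "\<tau> (x - y) = \<tau> x - \<tau> y"
  using add[of x "- y"] minus by simp

lemma power: "\<tau> (x ^ n) = \<tau> x ^ n"
  by (induction n) (simp_all add: one mult)

lemma of_nat: "\<tau> (of_nat n) = of_nat n"
  by (induction n) (simp_all add: zero one add)

lemma sum: "\<tau> (\<Sum>i\<in>I. f i) = (\<Sum>i\<in>I. \<tau> (f i))"
  by (induction I rule: infinite_finite_induct) (simp_all add: zero add)

lemma eq_0_iff: "\<tau> x = 0 \<longleftrightarrow> x = 0"
proof
  assume "\<tau> x = 0"
  show "x = 0"
  proof (rule ccontr)
    assume "x \<noteq> 0"
    then have "\<tau> x * \<tau> (inverse x) = 1" by (simp add: one flip: mult)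
    then show False using \<open>\<tau> x = 0\<close> by simp
  qed
qed (simp add: zero)

lemma inverse: "\<tau> (inverse x) = inverse (\<tau> x)"
proof (cases "x = 0")
  case False
  then have "\<tau> x * \<tau> (inverse x) = 1" by (simp add: one flip: mult)
  then show ?thesis by (simp add: inverse_unique)
qed (simp add: zero)

lemma divide: "\<tau> (x / y) = \<tau> x / \<tau> y"
  by (simp add: divide_inverse mult inverse)

lemma inj: "inj \<tau>"
  using eq_0_iff diff by (metis eq_iff_diff_eq_0 injI)

lemma iterate: "field_endomorphism (\<tau> ^^ n)"
  by (induction n) (unfold_locales, auto simp: add mult one field_endomorphism_def)

end

lemma (in field_endomorphism) difference_operator_power:
  "((\<lambda>x. \<tau> x - x) ^^ m) x = (\<Sum>r\<le>m. of_nat (m choose r) * (-1) ^ (m - r) * (\<tau> ^^ r) x)"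
proof (induction m)
  case (Suc m)
  let ?b = "\<lambda>m r. of_nat (m choose r) * (-1) ^ (m - r) * (\<tau> ^^ r) x"
  have "((\<lambda>x. \<tau> x - x) ^^ Suc m) x = \<tau> (\<Sum>r\<le>m. ?b m r) - (\<Sum>r\<le>m. ?b m r)"
    using Suc by simp
  also have "\<tau> (\<Sum>r\<le>m. ?b m r) = (\<Sum>r\<le>m. of_nat (m choose r) * (-1) ^ (m - r) * (\<tau> ^^ Suc r) x)"
    by (simp add: sum mult power of_nat minus one)
  also have "(\<Sum>r\<le>m. ?b m r) = - (\<Sum>r\<le>Suc m. of_nat (m choose r) * (-1) ^ (Suc m - r) * (\<tau> ^^ r) x)"
  proof -
    have "(\<Sum>r\<le>Suc m. of_nat (m choose r) * (-1) ^ (Suc m - r) * (\<tau> ^^ r) x) =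
      (\<Sum>r\<le>m. of_nat (m choose r) * (-1) ^ (Suc m - r) * (\<tau> ^^ r) x)"
      by (simp add: binomial_eq_0)
    also have "\<dots> = (\<Sum>r\<le>m. - ?b m r)"
      by (rule sum.cong) (auto simp: Suc_diff_le)
    finally show ?thesis by (simp add: sum_negf)
  qed
  also have "(\<Sum>r\<le>Suc m. of_nat (m choose r) * (-1) ^ (Suc m - r) * (\<tau> ^^ r) x) =
      (-1) ^ Suc m * x + (\<Sum>r\<le>m. of_nat (m choose Suc r) * (-1) ^ (m - r) * (\<tau> ^^ Suc r) x)"
    by (subst sum.atMost_Suc_shift) simp
  also have "(\<Sum>r\<le>m. of_nat (m choose r) * (-1) ^ (m - r) * (\<tau> ^^ Suc r) x) -
     - ((-1) ^ Suc m * x + (\<Sum>r\<le>m. of_nat (m choose Suc r) * (-1) ^ (m - r) * (\<tau> ^^ Suc r) x)) =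
     (-1) ^ Suc m * x + (\<Sum>r\<le>m. of_nat (Suc m choose Suc r) * (-1) ^ (m - r) * (\<tau> ^^ Suc r) x)"
    by (simp add: sum.distrib distrib_right)
  also have "\<dots> = (\<Sum>r\<le>Suc m. ?b (Suc m) r)"
    by (subst sum.atMost_Suc_shift) simp
  finally show ?case .
qed simp

text \<open>The algebraically closed field would be an extension of prime degree \<open>l\<close> of
  the fixed field of \<open>\<tau>\<close>. The locale is refuted below.\<close>

locale prime_order_automorphism = field_endomorphism \<tau> for \<tau> :: "'k::alg_closed_field \<Rightarrow> 'k" +
  fixes l :: nat
  assumes l_prime: "prime l" and order: "(\<tau> ^^ l) x = x" and nontrivial: "\<exists>x. \<tau> x \<noteq> x"
    and char_pos: "CHAR('k) > 0"
begin

lemma char_prime: "prime CHAR('k)"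
  using char_pos prime_CHAR_semidom by blast

lemma sum_shift: "(\<Sum>k<l. (\<tau> ^^ Suc k) x) = (\<Sum>k<l. (\<tau> ^^ k) x)"
proof -
  have "(\<Sum>k<Suc l. (\<tau> ^^ k) x) = x + (\<Sum>k<l. (\<tau> ^^ Suc k) x)"
    by (subst sum.lessThan_Suc_shift) simp
  then show ?thesis by (simp add: order)
qed

lemma trace_fixed: "\<tau> (\<Sum>k<l. (\<tau> ^^ k) x) = (\<Sum>k<l. (\<tau> ^^ k) x)"
  using sum_shift[of x] by (simp add: sum)

text \<open>Artin-Schreier case: some \<open>y\<close> has \<open>\<tau> y = y + 1\<close>. Solving
  a suitable equation \<open>z ^ l - z = ...\<close> and taking the trace yields a fixed
  \<open>c\<close> with \<open>c ^ l - c = y ^ l - y\<close>. Then \<open>y - c\<close> lies in the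
  prime field, so \<open>y\<close> is fixed.\<close>

lemma order_neq_char: "l \<noteq> CHAR('k)"
proof
  assume l: "l = CHAR('k)"
  note fd = freshmans_dream[OF char_prime l]
  have l0: "of_nat l = (0::'k)" by (simp add: l)
  define \<Delta> where "\<Delta> = (\<lambda>x. \<tau> x - x)"
  \<comment> \<open>In characteristic \<open>l\<close> the operator \<open>(\<tau> - 1) ^ l\<close>
    equals \<open>\<tau> ^ l - 1\<close>, which is zero.\<close>
  have "(\<Delta> ^^ l) x = 0" for x
  proof -
    have "(\<Delta> ^^ l) x = (\<Sum>r\<le>l. of_nat (l choose r) * (-1) ^ (l - r) * (\<tau> ^^ r) x)"
      unfolding \<Delta>_def by (rule difference_operator_power)
    also have "\<dots> = (\<Sum>r\<in>{0, l}. of_nat (l choose r) * (-1) ^ (l - r) * (\<tau> ^^ r) x)"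
    proof (rule sum.mono_neutral_right)
      show "\<forall>r\<in>{..l} - {0, l}. of_nat (l choose r) * (-1) ^ (l - r) * (\<tau> ^^ r) x = 0"
        using dvd_choose_prime[OF _ _ _ l_prime] by (auto simp: l of_nat_eq_0_iff_char_dvd)
    qed auto
    also have "\<dots> = (-1) ^ l * x + x"
      using prime_gt_0_nat[OF l_prime] by (simp add: order)
    also have "(-1) ^ l = (-1::'k)"
    proof -
      have "(1 + -1) ^ l = 1 ^ l + (-1::'k) ^ l" by (rule fd)
      then show ?thesis using prime_gt_0_nat[OF l_prime] by (simp add: power_0_left eq_neg_iff_add_eq_0 add.commute)
    qed
    finally show ?thesis by simp
  qed
  moreover obtain x where x: "\<tau> x \<noteq> x" using nontrivial by blast
  ultimately have ex: "\<exists>m. (\<Delta> ^^ m) x = 0" by blast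
  define m where "m = (LEAST m. (\<Delta> ^^ m) x = 0)"
  have m: "(\<Delta> ^^ m) x = 0" unfolding m_def using ex by (rule LeastI_ex)
  have least: "(\<Delta> ^^ j) x \<noteq> 0" if "j < m" for j using that not_less_Least unfolding m_def by blast
  have "m \<noteq> 0" using m x zero by (cases m) auto
  moreover have "m \<noteq> 1" using m x by (auto simp: \<Delta>_def)
  ultimately obtain j where j: "m = Suc (Suc j)" by (metis One_nat_def not0_implies_Suc)
  \<comment> \<open>\<open>v\<close> is the last nonzero iterate, hence fixed by
    \<open>\<tau>\<close>, and \<open>\<Delta> u = v\<close>.\<close>
  define v u where "v = (\<Delta> ^^ Suc j) x" and "u = (\<Delta> ^^ j) x"
  have v: "v \<noteq> 0" "\<tau> v = v" "\<tau> u = u + v"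
    using least[of "Suc j"] m j by (auto simp: v_def u_def \<Delta>_def)
  define y where "y = u / v"
  have ty: "\<tau> y = y + 1" using v by (simp add: y_def divide add_divide_distrib)
  have ty_k: "(\<tau> ^^ k) y = y + of_nat k" for k
    by (induction k) (simp_all add: ty add of_nat one)
  have ty_k_pow: "(\<tau> ^^ k) (y ^ m) = (y + of_nat k) ^ m" for k m
    using field_endomorphism.power[OF iterate, of k y m] by (simp add: ty_k)
  define a where "a = y ^ l - y"
  have ta: "\<tau> a = a" by (simp add: a_def diff power ty fd)
  \<comment> \<open>Some power of \<open>y\<close> has nonzero trace: otherwise each polynomial
    would sum to zero over the conjugates \<open>y + k\<close>, but \<open>g\<close> vanishes at all
    of them except \<open>y\<close>.\<close>
  have "\<exists>m. (\<Sum>k<l. (y + of_nat k) ^ m) \<noteq> 0"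
  proof (rule ccontr)
    assume "\<not> ?thesis"
    then have 0: "(\<Sum>k<l. (y + of_nat k) ^ m) = 0" for m by blast
    define g where "g = (\<Prod>k\<in>{0<..<l}. [:- (y + of_nat k), 1:])"
    have "(\<Sum>k<l. poly g (y + of_nat k)) = (\<Sum>i\<le>degree g. coeff g i * (\<Sum>k<l. (y + of_nat k) ^ i))"
      unfolding poly_altdef sum_distrib_left by (rule sum.swap)
    then have "(\<Sum>k<l. poly g (y + of_nat k)) = 0" by (simp add: 0)
    moreover have "poly g (y + of_nat k) = 0" if "k \<in> {..<l} - {0}" for k
      unfolding g_def poly_prod by (rule prod_zero[OF _ bexI[of _ k]]) (use that in auto)
    then have "(\<Sum>k<l. poly g (y + of_nat k)) = poly g y"
      using prime_gt_0_nat[OF l_prime]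
      by (subst sum.remove[of _ 0]) auto
    moreover have "poly g y \<noteq> 0"
      unfolding g_def poly_prod using l
      by (auto simp: of_nat_eq_0_iff_char_dvd dest: dvd_imp_le)
    ultimately show False by simp
  qed
  then obtain m' where m': "(\<Sum>k<l. (y + of_nat k) ^ m') \<noteq> 0" by blast
  define s where "s = (\<Sum>k<l. (\<tau> ^^ k) (y ^ m'))"
  have s: "s \<noteq> 0" "\<tau> s = s" using m' trace_fixed[of "y ^ m'"] by (simp_all add: s_def ty_k_pow)
  have ts: "(\<tau> ^^ k) s = s" "(\<tau> ^^ k) a = a" for k by (induction k) (simp_all add: s ta)
  \<comment> \<open>The constant term is chosen to have trace \<open>a\<close>:
    \<open>y ^ m' / s\<close> has trace 1 and \<open>a\<close> is fixed.\<close>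
  have "degree (monom 1 l - monom 1 1 - [:a * (y ^ m' / s):]) > 0"
  proof -
    have "coeff (monom 1 l - monom 1 1 - [:a * (y ^ m' / s):]) l = 1"
      using prime_gt_1_nat[OF l_prime] by (cases l) (auto simp: coeff_pCons split: nat.splits)
    then have "l \<le> degree (monom 1 l - monom 1 1 - [:a * (y ^ m' / s):])"
      by (metis le_degree zero_neq_one)
    then show ?thesis using prime_gt_0_nat[OF l_prime] by linarith
  qed
  then obtain z where "poly (monom 1 l - monom 1 1 - [:a * (y ^ m' / s):]) z = 0"
    using alg_closed_imp_poly_has_root by blast
  then have z: "z ^ l - z = a * (y ^ m' / s)" by (simp add: poly_monom)
  define c where "c = (\<Sum>k<l. (\<tau> ^^ k) z)"
  have "c ^ l - c = (\<Sum>k<l. (\<tau> ^^ k) (z ^ l - z))"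
  proof -
    have "c ^ l = (\<Sum>k<l. ((\<tau> ^^ k) z) ^ l)"
      unfolding c_def by (rule freshmans_dream_sum[OF char_prime l])
    then show ?thesis
      by (simp add: c_def sum_subtractf field_endomorphism.diff[OF iterate] field_endomorphism.power[OF iterate])
  qed
  also have "\<dots> = (\<Sum>k<l. a / s * (\<tau> ^^ k) (y ^ m'))"
    unfolding z by (simp add: field_endomorphism.mult[OF iterate] field_endomorphism.divide[OF iterate] ts)
  also have "\<dots> = a" unfolding sum_distrib_left[symmetric] s_def[symmetric] using s(1) by simp
  finally have c: "c ^ l - c = y ^ l - y" by (simp add: a_def)
  define e where "e = y - c"
  have "(c + e) ^ l = c ^ l + e ^ l" by (rule fd)
  then have e: "e ^ l = e" using c by (simp add: e_def algebra_simps)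
  \<comment> \<open>Its roots are exactly the elements of the prime field, which
    \<open>\<tau>\<close> fixes.\<close>
  define P :: "'k poly" where "P = monom 1 l - monom 1 1"
  have l1: "1 < l" using prime_gt_1_nat[OF l_prime] .
  have "coeff P l = 1" using l1 by (simp add: P_def)
  then have "P \<noteq> 0" by auto
  have degP: "degree P \<le> l" unfolding P_def using l1
    by (intro degree_diff_le) (auto simp: degree_monom_eq)
  have "inj_on (of_nat :: nat \<Rightarrow> 'k) {..<l}"
    by (intro inj_onI) (auto simp: of_nat_eq_iff_cong_CHAR cong_def l)
  then have card: "card ((of_nat :: nat \<Rightarrow> 'k) ` {..<l}) = l" by (simp add: card_image)
  have "(of_nat k :: 'k) ^ l = of_nat k" for k
    using l1 by (induction k) (simp_all add: fd power_0_left)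
  then have sub: "(of_nat :: nat \<Rightarrow> 'k) ` {..<l} \<subseteq> {x. poly P x = 0}"
    by (auto simp: P_def poly_monom)
  have "(of_nat :: nat \<Rightarrow> 'k) ` {..<l} = {x. poly P x = 0}"
    by (rule card_seteq[OF poly_roots_finite[OF \<open>P \<noteq> 0\<close>] sub])
       (use card_poly_roots_bound[OF \<open>P \<noteq> 0\<close>] degP card in simp)
  moreover have "poly P e = 0" using e by (simp add: P_def poly_monom)
  ultimately obtain k where "e = of_nat k" by blast
  then have "\<tau> e = e" by (simp add: of_nat)
  moreover have "\<tau> c = c" unfolding c_def by (rule trace_fixed)
  moreover have "y = e + c" by (simp add: e_def)
  ultimately have "\<tau> y = y" by (simp add: add)
  then show False using ty by simp
qed

text \<open>Kummer case: a resolvent \<open>y\<close> is multiplied by a nontrivial root of unity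
  \<open>\<xi>\<close>. Iterating \<open>\<tau>\<close> on an \<open>l\<close>-th root of
  \<open>y\<close> gives \<open>\<xi> * \<eta> ^ (l * (l - 1) div 2) = 1\<close>, which is
  impossible for odd \<open>l\<close>. For \<open>l = 2\<close> a square root of -1 is moved, and
  positive characteristic excludes this.\<close>

lemma contradiction: False
proof -
  have l1: "1 < l" using prime_gt_1_nat[OF l_prime] .
  have l0: "of_nat l \<noteq> (0::'k)"
    using order_neq_char char_prime l_prime
    by (simp add: of_nat_eq_0_iff_char_dvd) (metis primes_dvd_imp_eq)
  obtain \<zeta> :: 'k where \<zeta>: "\<zeta> ^ l = 1" "\<zeta> \<noteq> 1"
  proof -
    define G :: "'k poly" where "G = (\<Sum>i<l. monom 1 i)"
    have "coeff G (l - 1) = 1" using l1 by (simp add: G_def coeff_sum)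
    then have "degree G > 0" using l1 le_degree[of G "l - 1"] by auto
    then obtain x where "poly G x = 0" using alg_closed_imp_poly_has_root by blast
    then have x: "(\<Sum>i<l. x ^ i) = 0" by (simp add: G_def poly_sum poly_monom)
    have "x ^ l - 1 = (x - 1) * (\<Sum>i<l. x ^ i)" by (rule power_diff_1_eq)
    then have "x ^ l = 1" by (simp add: x)
    moreover have "x \<noteq> 1" using x l0 by auto
    ultimately show ?thesis by (rule that)
  qed
  \<comment> \<open>\<open>\<tau>\<close> raises \<open>\<zeta>\<close> to some power
    \<open>j\<close>, and \<open>j ^ l\<close> is \<open>j\<close> modulo \<open>l\<close> by
    Fermat; so the identity \<open>\<tau> ^^ l\<close> acts on \<open>\<zeta>\<close> as
    \<open>\<tau>\<close> does.\<close>
  have t\<zeta>: "\<tau> \<zeta> = \<zeta>"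
  proof -
    have "\<tau> \<zeta> ^ l = 1" using \<zeta>(1) by (metis one power)
    then obtain j where j: "\<tau> \<zeta> = \<zeta> ^ j"
      using roots_of_unity_eq_powers[OF l_prime \<zeta>] by metis
    have pw: "(\<tau> ^^ k) \<zeta> = \<zeta> ^ (j ^ k)" for k
      by (induction k) (simp_all add: j power mult.commute flip: power_mult)
    show ?thesis
    proof (cases "l dvd j")
      case True
      then have "\<tau> \<zeta> = 1" using j \<zeta>(1) by (auto simp: power_mult)
      then have "\<zeta> = 1" using inj one by (metis injD)
      then show ?thesis using \<zeta> by simp
    next
      case False
      then have c1: "[j ^ (l - 1) = 1] (mod l)" using l_prime fermat_theorem by blast
      have per: "\<zeta> ^ a = \<zeta> ^ b" if "[a = b] (mod l)" for a b
      proof -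
        have "\<zeta> ^ a = \<zeta> ^ (a mod l)" for a
          using \<zeta>(1) by (metis div_mult_mod_eq mult.left_neutral mult.commute power_add power_mult power_one)
        then show ?thesis using that unfolding cong_def by metis
      qed
      have "[j ^ l = j] (mod l)"
        using cong_scalar_left[OF c1, of j] l1 by (simp add: power_eq_if)
      then have "\<zeta> ^ (j ^ l) = \<zeta> ^ j" by (rule per)
      then show ?thesis using pw[of l] order[of \<zeta>] j by simp
    qed
  qed
  have t\<mu>: "\<tau> x = x" if xl: "x ^ l = 1" for x
  proof -
    obtain j where "x = \<zeta> ^ j" using roots_of_unity_eq_powers[OF l_prime \<zeta> xl] by metis
    then show ?thesis by (simp add: power t\<zeta>)
  qed
  obtain u where u: "\<tau> u \<noteq> u" using nontrivial by blast
  \<comment> \<open>Lagrange resolvents: each is zero or an eigenvector of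
    \<open>\<tau>\<close>.\<close>
  define R where "R j = (\<Sum>k<l. \<zeta> ^ (j * k) * (\<tau> ^^ k) u)" for j
  have tR: "\<zeta> ^ j * \<tau> (R j) = R j" for j
  proof -
    have "\<zeta> ^ j * \<tau> (R j) = (\<Sum>k<l. \<zeta> ^ (j * Suc k) * (\<tau> ^^ Suc k) u)"
      by (simp add: R_def sum mult power t\<zeta> sum_distrib_left power_add mult.assoc)
    moreover have "(\<Sum>k<Suc l. \<zeta> ^ (j * k) * (\<tau> ^^ k) u) = u + (\<Sum>k<l. \<zeta> ^ (j * Suc k) * (\<tau> ^^ Suc k) u)"
      by (subst sum.lessThan_Suc_shift) simp
    moreover have "\<zeta> ^ (j * l) = 1" using \<zeta>(1) by (metis mult.commute power_mult power_one)
    ultimately show ?thesis by (simp add: R_def order)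
  qed
  \<comment> \<open>All resolvents together sum to \<open>l * u\<close>. If only \<open>R 0\<close>,
    which is fixed, survived, then \<open>u\<close> would be fixed.\<close>
  have "\<exists>j. 0 < j \<and> j < l \<and> R j \<noteq> 0"
  proof (rule ccontr)
    assume no: "\<not> ?thesis"
    have "(\<Sum>j<l. R j) = (\<Sum>k<l. (\<Sum>j<l. (\<zeta> ^ k) ^ j) * (\<tau> ^^ k) u)"
      unfolding R_def by (subst sum.swap) (simp add: sum_distrib_left sum_distrib_right mult.commute flip: power_mult)
    also have "\<dots> = (\<Sum>k\<in>{0}. (\<Sum>j<l. (\<zeta> ^ k) ^ j) * (\<tau> ^^ k) u)"
    proof (rule sum.mono_neutral_right)
      show "\<forall>k\<in>{..<l} - {0}. (\<Sum>j<l. (\<zeta> ^ k) ^ j) * (\<tau> ^^ k) u = 0"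
      proof
        fix k assume k: "k \<in> {..<l} - {0}"
        then have "coprime k l" using l_prime
          by (metis DiffE coprime_commute dvd_imp_le insertI1 lessThan_iff linorder_not_less neq0_conv prime_imp_coprime singletonD singleton_iff)
        then have "\<zeta> ^ k \<noteq> 1" using root_of_unity_coprime[of \<zeta> k l] \<zeta> by blast
        moreover have "(\<zeta> ^ k) ^ l = 1" using \<zeta>(1) by (metis mult.commute power_mult power_one)
        then have "(\<zeta> ^ k - 1) * (\<Sum>j<l. (\<zeta> ^ k) ^ j) = 0"
          using power_diff_1_eq[of "\<zeta> ^ k" l] by simp
        ultimately show "(\<Sum>j<l. (\<zeta> ^ k) ^ j) * (\<tau> ^^ k) u = 0" by simp
      qed
    qed (use l1 in auto)
    finally have "(\<Sum>j<l. R j) = of_nat l * u" by simp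
    moreover have "(\<Sum>j<l. R j) = R 0"
    proof -
      have "(\<Sum>j\<in>{..<l} - {0}. R j) = 0" by (rule sum.neutral) (use no in auto)
      then show ?thesis using l1 by (subst sum.remove[of _ 0]) auto
    qed
    moreover have "\<tau> (R 0) = R 0" using tR[of 0] by simp
    ultimately have "of_nat l * \<tau> u = of_nat l * u" by (metis mult of_nat)
    then show False using u l0 by simp
  qed
  then obtain j where j: "0 < j" "j < l" "R j \<noteq> 0" by blast
  define y \<xi> where "y = R j" and "\<xi> = inverse (\<zeta> ^ j)"
  have \<zeta>j: "\<zeta> ^ j \<noteq> 1"
  proof
    assume "\<zeta> ^ j = 1"
    moreover have "coprime j l" using l_prime j
      by (metis coprime_commute dvd_imp_le linorder_not_less prime_imp_coprime)
    ultimately show False using root_of_unity_coprime \<zeta> by blast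
  qed
  have \<xi>: "\<xi> ^ l = 1" "\<xi> \<noteq> 1" "\<tau> y = \<xi> * y"
  proof -
    have "(\<zeta> ^ j) ^ l = 1" using \<zeta>(1) by (metis mult.commute power_mult power_one)
    then show "\<xi> ^ l = 1" by (simp add: \<xi>_def power_inverse)
    show "\<xi> \<noteq> 1" using \<zeta>j by (simp add: \<xi>_def)
    have "\<zeta> \<noteq> 0" using \<zeta>(1) l1 by (auto simp: power_0_left)
    then show "\<tau> y = \<xi> * y" using tR[of j] by (simp add: y_def \<xi>_def field_simps)
  qed
  have y0: "y \<noteq> 0" using j by (simp add: y_def)
  obtain z where z: "z ^ l = y" using nth_root_exists[of l y] l1 by auto
  have z0: "z \<noteq> 0" using z y0 l1 by (auto simp: power_0_left)
  define w where "w = \<tau> z / z"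
  have wl: "w ^ l = \<xi>" using z \<xi>(3) y0 by (simp add: w_def power_divide flip: power)
  have w0: "w \<noteq> 0" using z0 by (simp add: w_def eq_0_iff)
  \<comment> \<open>An \<open>l\<close>-th root of unity, because \<open>w ^ l = \<xi>\<close> is
    fixed. Thus \<open>\<tau>\<close> scales \<open>w\<close> by a fixed factor, and its exponents
    accumulate to \<open>k * (k - 1) div 2\<close>.\<close>
  define \<eta> where "\<eta> = \<tau> w / w"
  have "\<eta> ^ l = \<tau> \<xi> / \<xi>" using wl by (simp add: \<eta>_def power_divide flip: power)
  also have "\<dots> = 1" using t\<mu>[OF \<xi>(1)] \<xi>(1) l1 by (auto simp: power_0_left)
  finally have \<eta>l: "\<eta> ^ l = 1" .
  have t\<eta>: "\<tau> \<eta> = \<eta>" by (rule t\<mu>[OF \<eta>l])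
  have tw: "\<tau> w = \<eta> * w" and tz: "\<tau> z = w * z" using w0 z0 by (simp_all add: \<eta>_def w_def)
  have tz_k: "(\<tau> ^^ k) z = w ^ k * \<eta> ^ (k * (k - 1) div 2) * z" for k
  proof (induction k)
    case (Suc k)
    have "Suc k * (Suc k - 1) div 2 = k + k * (k - 1) div 2"
    proof -
      have "Suc k * (Suc k - 1) = k * 2 + k * (k - 1)" by (cases k) auto
      then show ?thesis by simp
    qed
    then show ?case using Suc by (simp add: mult power tw tz t\<eta> power_add power_mult_distrib)
  qed simp
  have key: "\<xi> * \<eta> ^ (l * (l - 1) div 2) = 1" using tz_k[of l] wl order[of z] z0 by simp
  show False
  proof (cases "odd l")
    case True
    then obtain m where "l = 2 * m + 1" by (elim oddE)
    then have "l * (l - 1) div 2 = l * m" by simp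
    then have "\<eta> ^ (l * (l - 1) div 2) = 1" using \<eta>l by (simp add: power_mult)
    then show False using key \<xi>(2) by simp
  next
    case False
    then have l2: "l = 2" using l_prime primes_dvd_imp_eq two_is_prime_nat by blast
    have two: "(2::'k) \<noteq> 0" using l0 l2 by simp
    have "(\<xi> - 1) * (\<xi> + 1) = 0" using \<xi>(1) l2 by (simp add: power2_eq_square algebra_simps)
    then have \<xi>m: "\<xi> = -1" using \<xi>(2) by (simp add: eq_neg_iff_add_eq_0)
    then have "- \<eta> = 1" using key l2 by simp
    then have \<eta>m: "\<eta> = -1" by (metis minus_minus)
    have w2: "w ^ 2 = -1" using wl l2 \<xi>m by simp
    have tw': "\<tau> w = - w" using tw \<eta>m by simp
    have w_not_fixed: "\<tau> w \<noteq> w" using tw' w0 two by (metis equation_minus_iff mult_2 mult_eq_0_iff neg_eq_iff_add_eq_0)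
    have roots: "x = r \<or> x = - r" if "x ^ 2 = r ^ 2" for x r :: 'k
      using that by (simp add: power2_eq_iff)
    text \<open>The least natural number \<open>m\<close> without square root in the fixed field; then \<open>m - 1\<close> and,
      as \<open>-1\<close> has no such root either, \<open>-m\<close> have one.\<close>
    define m where "m = (LEAST m. \<nexists>x. \<tau> x = x \<and> x ^ 2 = of_nat m)"
    \<comment> \<open>Positive characteristic makes -1 a natural number; its square roots
      \<open>w\<close> and \<open>- w\<close> are both moved, so the least \<open>m\<close>
      exists.\<close>
    have "\<nexists>x. \<tau> x = x \<and> x ^ 2 = of_nat (CHAR('k) - 1)"
    proof
      assume "\<exists>x. \<tau> x = x \<and> x ^ 2 = of_nat (CHAR('k) - 1)"
      then obtain x where x: "\<tau> x = x" "x ^ 2 = of_nat (CHAR('k) - 1)" by blast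
      have "of_nat (CHAR('k) - 1) = (-1::'k)"
        using char_pos by (simp add: of_nat_diff)
      then have "x = w \<or> x = - w" using roots x(2) w2 by metis
      then show False using x(1) w_not_fixed by (auto simp: minus)
    qed
    then have m: "\<nexists>x. \<tau> x = x \<and> x ^ 2 = of_nat m"
      unfolding m_def by (rule LeastI)
    have "m \<noteq> 0" using m zero by (metis of_nat_0 power_zero_numeral)
    then obtain m' where m': "m = Suc m'" by (cases m) auto
    then have "\<exists>x. \<tau> x = x \<and> x ^ 2 = of_nat m'"
      using not_less_Least[of m' "\<lambda>m. \<nexists>x. \<tau> x = x \<and> x ^ 2 = of_nat m"] unfolding m_def by force
    then obtain s where s: "\<tau> s = s" "s ^ 2 = of_nat m'" by blast
    obtain r where r: "r ^ 2 = (of_nat m :: 'k)" using nth_root_exists[of 2] by auto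
    have "\<tau> r ^ 2 = r ^ 2" using r by (metis of_nat power)
    then have tr: "\<tau> r = - r" using roots m r by metis
    define t where "t = w * r"
    have t: "\<tau> t = t" "t ^ 2 = - of_nat m"
      by (simp_all add: t_def mult tw' tr power_mult_distrib w2 r)
    \<comment> \<open>Since \<open>s ^ 2 + t ^ 2 = -1\<close>, a square root \<open>x\<close> of
      \<open>s + t * w\<close> would have as norm a fixed square root of -1.\<close>
    have norm: "(s + t * w) * \<tau> (s + t * w) = -1"
    proof -
      have "(s + t * w) * \<tau> (s + t * w) = s ^ 2 - t ^ 2 * w ^ 2"
        by (simp add: add mult s t tw' power2_eq_square algebra_simps)
      also have "\<dots> = of_nat m' - of_nat m" by (simp add: s t w2)
      also have "\<dots> = -1" by (simp add: m')
      finally show ?thesis .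
    qed
    obtain x where x: "x ^ 2 = s + t * w" using nth_root_exists[of 2] by auto
    have "(x * \<tau> x) ^ 2 = w ^ 2" using norm by (simp add: power_mult_distrib x w2 flip: power)
    then have "x * \<tau> x = w \<or> x * \<tau> x = - w" by (rule roots)
    moreover have "\<tau> (x * \<tau> x) = x * \<tau> x"
      using order[of x] by (simp add: l2 mult mult.commute numeral_2_eq_2)
    ultimately have "\<tau> w = w" by (auto simp: minus)
    then show False using w_not_fixed by simp
  qed
qed

end

section \<open>Irreducible polynomials of large degree\<close>

abbreviation ev :: "'f::field poly \<Rightarrow> 'f alg_closure \<Rightarrow> 'f alg_closure" where
  "ev u a \<equiv> poly (map_poly to_ac u) a"

lemma ev_pCons: "ev (pCons c u) a = to_ac c + a * ev u a"
  by (simp add: map_poly_pCons)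

lemma ev_const: "ev [:c:] a = to_ac c"
  by (simp add: map_poly_pCons)

lemma ev_X: "ev [:0, 1:] a = a"
  by (simp add: map_poly_pCons)

lemma ev_add: "ev (u + v) a = ev u a + ev v a"
  by (induction u v rule: poly_induct2) (simp_all add: ev_pCons algebra_simps)

lemma ev_smult: "ev (smult c u) a = to_ac c * ev u a"
  by (induction u) (simp_all add: ev_pCons algebra_simps)

lemma ev_mult: "ev (u * v) a = ev u a * ev v a"
  by (induction u) (simp_all add: ev_pCons ev_add ev_smult algebra_simps)

lemma ev_diff: "ev (u - v) a = ev u a - ev v a"
  using ev_add[of "u - v" v a] by simp

lemma ev_1: "ev 1 a = 1"
  using ev_const[of 1 a] by (simp add: one_pCons)

lemma ev_monom: "ev (monom c n) a = to_ac c * a ^ n"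
  by (simp add: map_poly_monom poly_monom)

lemma ev_pcompose: "ev (pcompose u v) a = ev u (ev v a)"
  by (induction u) (simp_all add: pcompose_pCons ev_pCons ev_add ev_mult ev_const)

lemma pderiv_map_poly_to_ac: "pderiv (map_poly to_ac u) = map_poly to_ac (pderiv u)"
  by (rule poly_eqI) (simp add: coeff_pderiv coeff_map_poly)

lemma degree_map_poly_to_ac: "degree (map_poly to_ac u) = degree u"
  by (rule degree_map_poly) auto

lemma map_poly_to_ac_eq_0: "map_poly to_ac u = 0 \<longleftrightarrow> u = 0"
  by (auto simp: poly_eq_iff coeff_map_poly)

lemma finite_ev_roots: "u \<noteq> 0 \<Longrightarrow> finite {x. ev u x = 0}"
  by (rule poly_roots_finite) (simp add: map_poly_to_ac_eq_0)

definition min_poly_of :: "'f::field alg_closure \<Rightarrow> 'f poly \<Rightarrow> bool" where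
  "min_poly_of a m \<longleftrightarrow> irreducible m \<and> (\<forall>u. ev u a = 0 \<longleftrightarrow> m dvd u)"

lemma min_poly_exists: "\<exists>m. min_poly_of a m"
proof -
  define P where "P d \<longleftrightarrow> (\<exists>u. u \<noteq> 0 \<and> ev u a = 0 \<and> degree u = d)" for d
  obtain u0 where "u0 \<noteq> 0" "ev u0 a = 0" using alg_closure_algebraic by blast
  then have "P (degree u0)" unfolding P_def by blast
  then have "P (LEAST d. P d)" by (rule LeastI)
  then obtain m where m: "m \<noteq> 0" "ev m a = 0" "degree m = (LEAST d. P d)" unfolding P_def by blast
  have least: "u = 0" if "ev u a = 0" "degree u < degree m" for u
    using that not_less_Least[of "degree u" P] unfolding m(3) P_def by blast
  have dvd: "ev u a = 0 \<longleftrightarrow> m dvd u" for u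
  proof
    assume "m dvd u"
    then show "ev u a = 0" using m(2) by (auto simp: ev_mult)
  next
    assume u: "ev u a = 0"
    have "ev (u mod m) a = ev u a - ev (u div m * m) a"
      by (metis add_diff_cancel_left' div_mult_mod_eq ev_diff)
    then have "ev (u mod m) a = 0" using u m(2) by (simp add: ev_mult)
    moreover have "u mod m = 0 \<or> degree (u mod m) < degree m" using m(1) by (rule degree_mod_less)
    ultimately have "u mod m = 0" using least by blast
    then show "m dvd u" by (simp add: dvd_eq_mod_eq_0)
  qed
  have "prime_elem m"
  proof (rule prime_elemI)
    show "m \<noteq> 0" by fact
    show "\<not> m dvd 1" using dvd[of 1] by (simp add: ev_1)
    show "m dvd u \<or> m dvd v" if "m dvd u * v" for u v
      using that unfolding dvd[symmetric] by (simp add: ev_mult)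
  qed
  then have "irreducible m" by (rule prime_elem_imp_irreducible)
  then show ?thesis using dvd unfolding min_poly_of_def by blast
qed

lemma min_poly_degree_pos: "min_poly_of a m \<Longrightarrow> 0 < degree m"
  unfolding min_poly_of_def Factorial_Ring.irreducible_def using is_unit_iff_degree[of m] by auto

lemma min_poly_dvd: "min_poly_of a m \<Longrightarrow> ev u a = 0 \<longleftrightarrow> m dvd u"
  by (simp add: min_poly_of_def)

lemma min_poly_root: "min_poly_of a m \<Longrightarrow> ev m a = 0"
  by (simp add: min_poly_dvd)

lemma min_poly_nonzero: "min_poly_of a m \<Longrightarrow> m \<noteq> 0"
  using min_poly_degree_pos[of a m] by auto

lemma min_poly_least: "min_poly_of a m \<Longrightarrow> ev u a = 0 \<Longrightarrow> degree u < degree m \<Longrightarrow> u = 0"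
  using min_poly_dvd[of a m u] dvd_imp_degree_le[of m u] by auto

text \<open>As \<open>a\<close> is algebraic, the ring F[a] is already the field F(a); see
  \<open>adjoin_inverse\<close>.\<close>

definition adjoin :: "'f::field alg_closure \<Rightarrow> 'f alg_closure set" where
  "adjoin a = range (\<lambda>u. ev u a)"

lemma adjoinI: "ev u a \<in> adjoin a"
  by (simp add: adjoin_def)

lemma adjoinE:
  assumes "x \<in> adjoin a"
  obtains u where "x = ev u a"
  using assms by (auto simp: adjoin_def)

lemma adjoin_const: "to_ac c \<in> adjoin a"
  using adjoinI[of "[:c:]" a] by (simp only: ev_const)

lemma adjoin_self: "a \<in> adjoin a"
  using adjoinI[of "[:0, 1:]" a] by (simp only: ev_X)

lemma adjoin_0: "0 \<in> adjoin a" and adjoin_1: "1 \<in> adjoin a"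
  using adjoin_const[of 0 a] adjoin_const[of 1 a] by simp_all

lemma adjoin_add: "x \<in> adjoin a \<Longrightarrow> y \<in> adjoin a \<Longrightarrow> x + y \<in> adjoin a"
  and adjoin_diff: "x \<in> adjoin a \<Longrightarrow> y \<in> adjoin a \<Longrightarrow> x - y \<in> adjoin a"
  and adjoin_mult: "x \<in> adjoin a \<Longrightarrow> y \<in> adjoin a \<Longrightarrow> x * y \<in> adjoin a"
  by (elim adjoinE, simp only: adjoinI flip: ev_add ev_diff ev_mult)+

lemma adjoin_power: "x \<in> adjoin a \<Longrightarrow> x ^ n \<in> adjoin a"
  by (induction n) (simp_all add: adjoin_1 adjoin_mult)

lemma adjoin_ev: "x \<in> adjoin a \<Longrightarrow> ev u x \<in> adjoin a"
  by (elim adjoinE) (simp only: adjoinI flip: ev_pcompose)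

text \<open>Write the minimal polynomial of a nonzero \<open>x\<close> as \<open>c + X * w\<close>;
  then \<open>c\<close> is nonzero and \<open>w\<close>, evaluated at \<open>x\<close> and divided
  by \<open>- c\<close>, is the inverse.\<close>

lemma adjoin_inverse:
  assumes "x \<in> adjoin a"
  shows "inverse x \<in> adjoin a"
proof (cases "x = 0")
  case False
  obtain m where m: "min_poly_of x m" using min_poly_exists by blast
  obtain c w where cw: "m = pCons c w" by (cases m) auto
  have "w \<noteq> 0" using min_poly_degree_pos[OF m] cw by auto
  have root: "to_ac c + x * ev w x = 0" using min_poly_root[OF m] by (simp add: cw ev_pCons)
  have "c \<noteq> 0"
  proof
    assume "c = 0"
    then have "ev w x = 0" using root False by simp
    then have "w = 0" using min_poly_least[OF m] cw \<open>w \<noteq> 0\<close> by auto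
    then show False using \<open>w \<noteq> 0\<close> by simp
  qed
  have "ev (smult (- inverse c) w) x = - inverse (to_ac c) * ev w x"
    by (simp only: ev_smult to_ac_minus to_ac_inverse)
  moreover have "x * ev w x = - to_ac c" using root by (simp add: eq_neg_iff_add_eq_0 add.commute)
  ultimately have "x * ev (smult (- inverse c) w) x = 1"
    using \<open>c \<noteq> 0\<close> mult.left_commute[of x "inverse (to_ac c)" "ev w x"] by simp
  then have "inverse x = ev (smult (- inverse c) w) x" by (rule inverse_unique)
  then show ?thesis using adjoin_ev[OF assms] by metis
qed (simp add: adjoin_0)

lemma adjoin_divide: "x \<in> adjoin a \<Longrightarrow> y \<in> adjoin a \<Longrightarrow> x / y \<in> adjoin a"
  by (simp add: divide_inverse adjoin_mult adjoin_inverse)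

interpretation ac: vector_space "\<lambda>(c::'f::field) x. to_ac c * x"
  by unfold_locales (simp_all add: algebra_simps)

lemma subspace_adjoin: "ac.subspace (adjoin a)"
  by (intro ac.subspaceI) (simp_all add: adjoin_0 adjoin_add adjoin_mult adjoin_const)

lemma adjoin_subset_span:
  assumes "min_poly_of a m"
  shows "adjoin a \<subseteq> ac.span ((\<lambda>i. a ^ i) ` {..<degree m})"
proof
  fix x assume "x \<in> adjoin a"
  then obtain u where u: "x = ev u a" unfolding adjoin_def by blast
  have "ev u a = ev (u div m * m) a + ev (u mod m) a"
    by (metis div_mult_mod_eq ev_add)
  then have x: "x = ev (u mod m) a" using u min_poly_root[OF assms] by (simp add: ev_mult)
  have "u mod m = 0 \<or> degree (u mod m) < degree m" using min_poly_nonzero[OF assms] by (rule degree_mod_less)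
  then have "i < degree m" if "i \<le> degree (u mod m)" for i
    using that min_poly_degree_pos[OF assms] by auto
  then show "x \<in> ac.span ((\<lambda>i. a ^ i) ` {..<degree m})"
    unfolding x poly_altdef degree_map_poly_to_ac
    by (intro ac.span_sum, simp only: coeff_map_poly to_ac_0, intro ac.span_scale ac.span_base) auto
qed

lemma card_independent_le_degree:
  assumes "min_poly_of a m" "ac.independent B" "B \<subseteq> adjoin a"
  shows "finite B \<and> card B \<le> degree m"
proof -
  have "finite B \<and> card B \<le> card ((\<lambda>i. a ^ i) ` {..<degree m})"
    by (rule ac.independent_span_bound) (use assms adjoin_subset_span in auto)
  moreover have "card ((\<lambda>i. a ^ i) ` {..<degree m}) \<le> degree m"
    using card_image_le[of "{..<degree m}"] by simp
  ultimately show ?thesis by linarith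
qed

lemma powers_independent:
  assumes "min_poly_of a m" "k \<le> degree m"
  shows "ac.independent ((\<lambda>i. a ^ i) ` {..<k}) \<and> card ((\<lambda>i. a ^ i) ` {..<k}) = k"
  using assms(2)
proof (induction k)
  case 0
  then show ?case by (simp add: ac.independent_empty)
next
  case (Suc k)
  let ?S = "{x. \<exists>u. (\<forall>i\<ge>k. coeff u i = 0) \<and> x = ev u a}"
  have "ac.span ((\<lambda>i. a ^ i) ` {..<k}) \<subseteq> ?S"
  proof (rule ac.span_minimal)
    show "(\<lambda>i. a ^ i) ` {..<k} \<subseteq> ?S"
    proof clarify
      fix i assume "i < k"
      then show "\<exists>u. (\<forall>i\<ge>k. coeff u i = 0) \<and> a ^ i = ev u a"
        by (intro exI[of _ "monom 1 i"]) (auto simp: ev_monom)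
    qed
    show "ac.subspace ?S"
    proof (rule ac.subspaceI)
      show "0 \<in> ?S" by (auto intro!: exI[of _ 0])
    next
      fix x y assume "x \<in> ?S" "y \<in> ?S"
      then obtain u v where "\<forall>i\<ge>k. coeff u i = 0" "x = ev u a" "\<forall>i\<ge>k. coeff v i = 0" "y = ev v a" by blast
      then show "x + y \<in> ?S" by (auto intro!: exI[of _ "u + v"] simp: ev_add)
    next
      fix c x assume "x \<in> ?S"
      then obtain u where "\<forall>i\<ge>k. coeff u i = 0" "x = ev u a" by blast
      then show "to_ac c * x \<in> ?S" by (auto intro!: exI[of _ "smult c u"] simp: ev_smult)
    qed
  qed
  moreover have "a ^ k \<notin> ?S"
  proof
    assume "a ^ k \<in> ?S"
    then obtain u where u: "\<forall>i\<ge>k. coeff u i = 0" "a ^ k = ev u a" by blast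
    have "ev (monom 1 k - u) a = 0" using u(2) by (simp add: ev_diff ev_monom)
    moreover have "degree (monom 1 k - u) \<le> k"
      using u(1) by (intro degree_le) auto
    ultimately have "monom 1 k - u = 0"
      using min_poly_least[OF assms(1)] Suc.prems by (meson Suc_le_lessD le_less_trans)
    then have "coeff (monom 1 k - u) k = 0" by simp
    then show False using u(1) by simp
  qed
  ultimately have out: "a ^ k \<notin> ac.span ((\<lambda>i. a ^ i) ` {..<k})" by blast
  moreover have "a ^ k \<notin> (\<lambda>i. a ^ i) ` {..<k}" using out ac.span_base[of "a ^ k"] by metis
  moreover have IH: "ac.independent ((\<lambda>i. a ^ i) ` {..<k})" "card ((\<lambda>i. a ^ i) ` {..<k}) = k"
    using Suc by simp_all
  moreover have "(\<lambda>i. a ^ i) ` {..<Suc k} = insert (a ^ k) ((\<lambda>i. a ^ i) ` {..<k})"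
    by (simp add: lessThan_Suc)
  ultimately show ?case by (simp only: ac.independent_insert if_False) simp
qed

text \<open>The \<open>degree m\<close> powers of \<open>a\<close> together with \<open>x\<close>
  are independent in F(b), of dimension \<open>degree m'\<close>.\<close>

lemma degree_less_if_adjoin_strict:
  assumes "min_poly_of a m" "min_poly_of b m'" "a \<in> adjoin b" "x \<in> adjoin b" "x \<notin> adjoin a"
  shows "degree m < degree m'"
proof -
  let ?B = "(\<lambda>i. a ^ i) ` {..<degree m}"
  have "?B \<subseteq> adjoin a" using adjoin_power[OF adjoin_self] by blast
  then have "ac.span ?B \<subseteq> adjoin a" by (rule ac.span_minimal[OF _ subspace_adjoin])
  then have out: "x \<notin> ac.span ?B" "x \<notin> ?B" using assms(5) \<open>?B \<subseteq> adjoin a\<close> by blast+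
  have B: "ac.independent ?B" "card ?B = degree m" using powers_independent[OF assms(1)] by auto
  have "ac.independent (insert x ?B)" using out B by (simp add: ac.independent_insert)
  moreover have "insert x ?B \<subseteq> adjoin b" using assms(3,4) adjoin_power by blast
  ultimately have "card (insert x ?B) \<le> degree m'" using card_independent_le_degree[OF assms(2)] by blast
  then show ?thesis using out B by simp
qed

section \<open>Separability and primitive elements\<close>

lemma pderiv_irreducible_nonzero:
  fixes m :: "'f::field poly"
  assumes "irreducible m" and p: "prime p" "CHAR('f) = p" and perfect: "\<forall>c::'f. \<exists>b. b ^ p = c"
  shows "pderiv m \<noteq> 0"
proof
  assume pd: "pderiv m = 0"
  have p0: "0 < p" using p(1) by (rule prime_gt_0_nat)
  have z: "coeff m i = 0" if "\<not> p dvd i" for i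
  proof -
    have "i \<noteq> 0" using that by (intro notI) simp
    then obtain j where j: "i = Suc j" by (cases i) auto
    have "of_nat (Suc j) * coeff m (Suc j) = 0" using pd coeff_pderiv[of m j] by simp
    then show ?thesis using that j p(2) by (auto simp: of_nat_eq_0_iff_char_dvd simp del: of_nat_Suc)
  qed
  obtain r :: "'f \<Rightarrow> 'f" where r: "r c ^ p = c" for c using perfect by metis
  \<comment> \<open>Only exponents divisible by \<open>p\<close> occur in \<open>m\<close>, so
    taking \<open>p\<close>-th roots of the coefficients exhibits \<open>m\<close> as a
    \<open>p\<close>-th power.\<close>
  define w where "w = (\<Sum>i\<le>degree m. monom (r (coeff m (i * p))) i)"
  have chp: "CHAR('f poly) = p" using p by simp
  have "w ^ p = (\<Sum>i\<le>degree m. monom (r (coeff m (i * p))) i ^ p)"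
    unfolding w_def by (rule freshmans_dream_sum) (use p chp in auto)
  also have "\<dots> = (\<Sum>i\<le>degree m. monom (coeff m (i * p)) (i * p))"
    by (simp add: monom_power r mult.commute)
  also have "\<dots> = m"
  proof (rule poly_eqI)
    fix k
    show "coeff (\<Sum>i\<le>degree m. monom (coeff m (i * p)) (i * p)) k = coeff m k"
    proof (cases "p dvd k \<and> k \<le> degree m")
      case True
      then obtain j where j: "k = j * p" by (metis dvd_def mult.commute)
      have "j \<le> degree m" using True j p0 by (metis le_trans mult.right_neutral mult_le_mono2 Suc_leI One_nat_def)
      then show ?thesis using p0 j by (simp add: coeff_sum if_distrib[of "coeff _"] cong: if_cong)
    next
      case False
      then have "coeff m k = 0" using z coeff_eq_0 by (metis linorder_not_less)
      moreover have "coeff (\<Sum>i\<le>degree m. monom (coeff m (i * p)) (i * p)) k = 0"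
        unfolding coeff_sum by (rule sum.neutral) (use \<open>coeff m k = 0\<close> in auto)
      ultimately show ?thesis by simp
    qed
  qed
  finally have w: "w ^ p = m" .
  obtain k where k: "p = 2 + k" using le_Suc_ex[OF prime_ge_2_nat[OF p(1)]] by blast
  have "m = w * w ^ Suc k" unfolding w[symmetric] k by simp
  then have "is_unit w \<or> is_unit (w ^ Suc k)" by (rule Factorial_Ring.irreducibleD[OF assms(1)])
  then have "is_unit w" by (simp only: is_unit_power_iff) simp
  then have "is_unit m" unfolding w[symmetric] by (simp only: is_unit_power_iff) simp
  then show False using irreducible_not_unit[OF assms(1)] by simp
qed

lemma separable:
  fixes a :: "'f::field alg_closure"
  assumes "min_poly_of a m" and p: "prime p" "CHAR('f) = p" and perfect: "\<forall>c::'f. \<exists>b. b ^ p = c"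
  shows "ev (pderiv m) a \<noteq> 0"
proof
  assume "ev (pderiv m) a = 0"
  moreover have "degree (pderiv m) < degree m"
  proof -
    have "degree (pderiv m) \<le> degree m - 1" by (rule degree_le) (auto simp: coeff_pderiv coeff_eq_0)
    then show ?thesis using min_poly_degree_pos[OF assms(1)] by linarith
  qed
  ultimately have "pderiv m = 0" using min_poly_least[OF assms(1)] by blast
  moreover have "irreducible m" using assms(1) by (simp add: min_poly_of_def)
  ultimately show False using pderiv_irreducible_nonzero[OF _ p perfect] by simp
qed

text \<open>By separability \<open>a\<close> is a simple root of \<open>r\<close>, so the cofactor
  of \<open>X - a\<close> has a different root.\<close>

lemma other_root:
  fixes a :: "'f::field alg_closure"
  assumes "min_poly_of a m" and "prime p" "CHAR('f) = p" "\<forall>c::'f. \<exists>b. b ^ p = c"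
    and "1 < degree r" "poly r a = 0" "r dvd map_poly to_ac m"
  obtains b where "b \<noteq> a" "poly r b = 0"
proof -
  obtain r' where r': "r = [:- a, 1:] * r'" using assms(6) by (auto simp: poly_eq_0_iff_dvd)
  have "r' \<noteq> 0" using assms(5) r' by auto
  then have "degree r = Suc (degree r')" unfolding r' by (subst degree_mult_eq) auto
  then have "0 < degree r'" using assms(5) by simp
  then obtain b where b: "poly r' b = 0" using alg_closed_imp_poly_has_root by blast
  have "b \<noteq> a"
  proof
    assume "b = a"
    then obtain r'' where "r' = [:- a, 1:] * r''" using b by (auto simp: poly_eq_0_iff_dvd)
    then obtain s where s: "map_poly to_ac m = [:- a, 1:] * ([:- a, 1:] * s)"
      using assms(7) r' by (metis dvd_def mult.assoc)
    have "poly (pderiv (map_poly to_ac m)) a = 0"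
      unfolding s by (simp only: pderiv_mult poly_add poly_mult) simp
    then show False using separable[OF assms(1-4)] by (simp add: pderiv_map_poly_to_ac)
  qed
  moreover have "poly r b = 0" using b r' by simp
  ultimately show ?thesis by (rule that)
qed

text \<open>For \<open>d = a + c * b\<close> the minimal polynomial \<open>r\<close> of
  \<open>b\<close> over F(d) divides both \<open>g\<close> and \<open>f\<close> at
  \<open>d - c * X\<close>. For all but finitely many \<open>c\<close> their only common root is
  \<open>b\<close>, so \<open>r\<close> is linear by separability and \<open>b\<close> lies in
  F(d).\<close>

lemma primitive_element:
  fixes a b :: "'f::field alg_closure"
  assumes p: "prime p" "CHAR('f) = p" and perfect: "\<forall>c::'f. \<exists>b. b ^ p = c"
    and inf: "infinite (UNIV :: 'f set)"
  shows "\<exists>d. a \<in> adjoin d \<and> b \<in> adjoin d"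
proof -
  obtain f g where f: "min_poly_of a f" and g: "min_poly_of b g" using min_poly_exists by blast
  \<comment> \<open>The \<open>c\<close> for which another pair of roots yields the same
    \<open>d\<close>; pairs with \<open>b' = b\<close> only add the value 0 of a division by
    zero.\<close>
  define bad where "bad = (\<lambda>(a', b'). (a' - a) / (b - b')) ` ({x. ev f x = 0} \<times> {x. ev g x = 0})"
  have "finite bad"
    unfolding bad_def using finite_ev_roots[OF min_poly_nonzero[OF f]] finite_ev_roots[OF min_poly_nonzero[OF g]] by blast
  moreover have "infinite (range (to_ac :: 'f \<Rightarrow> _))"
    using inf inj_to_ac finite_imageD by blast
  ultimately have "\<not> range (to_ac :: 'f \<Rightarrow> _) \<subseteq> bad" using finite_subset by blast
  then obtain c :: 'f where c: "to_ac c \<notin> bad" by blast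
  define d where "d = a + to_ac c * b"
  \<comment> \<open>F(d) is a subset and not a type, so polynomials over it are singled out by their
    coefficients.\<close>
  define coeffs_in where "coeffs_in h \<longleftrightarrow> (\<forall>i. coeff h i \<in> adjoin d)" for h :: "'f alg_closure poly"
  have in_add: "coeffs_in (x + y)" and in_diff: "coeffs_in (x - y)" and in_mult: "coeffs_in (x * y)"
    if "coeffs_in x" "coeffs_in y" for x y
  proof -
    show "coeffs_in (x + y)" "coeffs_in (x - y)" using that by (simp_all add: coeffs_in_def adjoin_add adjoin_diff)
    have "(\<Sum>i\<in>I. h i) \<in> adjoin d" if "\<And>i. h i \<in> adjoin d" for h and I :: "nat set"
      by (induction I rule: infinite_finite_induct) (simp_all add: adjoin_0 adjoin_add that)
    then show "coeffs_in (x * y)" using that by (simp add: coeffs_in_def coeff_mult adjoin_mult)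
  qed
  have in_monom: "coeffs_in (monom x i)" if "x \<in> adjoin d" for x i
    using that by (simp add: coeffs_in_def adjoin_0)
  have in_pCons: "coeffs_in (pCons x y)" if "x \<in> adjoin d" "coeffs_in y" for x y
    using that by (simp add: coeffs_in_def coeff_pCons split: nat.split)
  have in_0: "coeffs_in 0" by (simp add: coeffs_in_def adjoin_0)
  have in_map: "coeffs_in (map_poly to_ac u)" for u by (simp add: coeffs_in_def coeff_map_poly adjoin_const)
  define h where "h = pcompose (map_poly to_ac f) [:d, - to_ac c:]"
  have "coeffs_in (pcompose (map_poly to_ac u) [:d, - to_ac c:])" for u
  proof (induction u)
    case (pCons x u)
    have "- to_ac c \<in> adjoin d" using adjoin_const[of "- c" d] by simp
    then have "coeffs_in [:d, - to_ac c:]" using adjoin_self in_pCons in_0 by blast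
    moreover have "pcompose (map_poly to_ac (pCons x u)) [:d, - to_ac c:] =
        [:to_ac x:] + [:d, - to_ac c:] * pcompose (map_poly to_ac u) [:d, - to_ac c:]"
      by (simp only: map_poly_pCons to_ac_0 pcompose_pCons)
    ultimately show ?case using pCons.IH in_add in_mult in_pCons[OF adjoin_const in_0] by metis
  qed (simp add: in_0)
  then have h: "coeffs_in h" unfolding h_def .
  have poly_h: "poly h x = ev f (d - to_ac c * x)" for x
    by (simp add: h_def poly_pcompose algebra_simps)
  have hb: "poly h b = 0" using min_poly_root[OF f] by (simp add: poly_h d_def)
  define P where "P n \<longleftrightarrow> (\<exists>r. coeffs_in r \<and> r \<noteq> 0 \<and> poly r b = 0 \<and> degree r = n)" for n
  have "P (degree (map_poly to_ac g))"
    unfolding P_def using in_map min_poly_root[OF g] min_poly_nonzero[OF g] map_poly_to_ac_eq_0 by blast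
  then have "P (LEAST n. P n)" by (rule LeastI)
  then obtain r where r: "coeffs_in r" "r \<noteq> 0" "poly r b = 0" "degree r = (LEAST n. P n)" unfolding P_def by blast
  have least: "y = 0" if "coeffs_in y" "poly y b = 0" "degree y < degree r" for y
    using that not_less_Least[of "degree y" P] unfolding r(4) P_def by blast
  have deg_r: "0 < degree r"
  proof (rule ccontr)
    assume "\<not> 0 < degree r"
    then obtain k where "r = [:k:]" using degree_eq_zeroE by blast
    then show False using r(2,3) by simp
  qed
  \<comment> \<open>Division by \<open>r\<close> inside F(d), one leading term at a time.\<close>
  have dvd: "r dvd y" if "coeffs_in y" "poly y b = 0" for y
    using that
  proof (induction "degree y" arbitrary: y rule: less_induct)
    case less
    show ?case
    proof (cases "degree y < degree r")
      case True
      then have "y = 0" using least[OF less.prems] by simp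
      then show ?thesis by simp
    next
      case False
      define t where "t = monom (lead_coeff y / lead_coeff r) (degree y - degree r)"
      define y' where "y' = y - t * r"
      have "coeffs_in t" unfolding t_def
        by (rule in_monom) (use less.prems(1) r(1) in \<open>simp add: coeffs_in_def adjoin_divide\<close>)
      then have 1: "coeffs_in y'" "poly y' b = 0"
        using less.prems r in_diff in_mult by (simp_all add: y'_def)
      have "degree (t * r) \<le> degree y"
        using degree_mult_le[of t r] degree_monom_le[of "lead_coeff y / lead_coeff r" "degree y - degree r"] False
        unfolding t_def by linarith
      then have "degree y' \<le> degree y" unfolding y'_def by (intro degree_diff_le) auto
      moreover have "coeff y' (degree y) = 0"
      proof -
        have "coeff (t * r) (degree y) = lead_coeff y"
          using False r(2) by (simp add: t_def coeff_monom_mult)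
        then show ?thesis by (simp add: y'_def)
      qed
      ultimately have "degree y' < degree y \<or> y' = 0"
        by (metis leading_coeff_0_iff linorder_neqE_nat not_less)
      then have "r dvd y'" using less.hyps[of y'] 1 by auto
      then have "r dvd y' + t * r" by simp
      then show ?thesis by (simp add: y'_def)
    qed
  qed
  have r_g: "r dvd map_poly to_ac g" and r_h: "r dvd h"
    using dvd in_map min_poly_root[OF g] h hb by blast+
  have "degree r = 1"
  proof (rule ccontr)
    assume "degree r \<noteq> 1"
    then have "1 < degree r" using deg_r by simp
    then obtain b' where b': "b' \<noteq> b" "poly r b' = 0"
      using other_root[OF g p perfect _ r(3) r_g] by blast
    have "ev g b' = 0" "poly h b' = 0" using b'(2) r_g r_h by (auto elim!: dvdE)
    then have "(a + to_ac c * (b - b') - a) / (b - b') \<in> bad"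
      unfolding bad_def poly_h d_def
      by (intro image_eqI[of _ _ "(a + to_ac c * (b - b'), b')"]) (auto simp: algebra_simps)
    then show False using c b'(1) by simp
  qed
  define x y where "x = coeff r 0" and "y = coeff r 1"
  have xy: "r = [:x, y:]"
    unfolding x_def y_def using \<open>degree r = 1\<close>
    by (intro poly_eqI) (auto simp: coeff_pCons coeff_eq_0 split: nat.split)
  have "y \<noteq> 0" using \<open>degree r = 1\<close> leading_coeff_0_iff[of r] r(2) by (simp add: y_def)
  then have "b = - x / y" using r(3) xy by (simp add: field_simps eq_neg_iff_add_eq_0)
  moreover have "x \<in> adjoin d" "y \<in> adjoin d"
    using r(1) by (simp_all add: coeffs_in_def x_def y_def)
  ultimately have b: "b \<in> adjoin d"
    using adjoin_divide[OF adjoin_diff[OF adjoin_0, of x d]] by simp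
  have "a = d - to_ac c * b" by (simp add: d_def)
  then have "a \<in> adjoin d" using adjoin_diff[OF adjoin_self[of d] adjoin_mult[OF adjoin_const[of c d] b]] by simp
  with b show ?thesis by blast
qed

section \<open>Irreducible polynomials of unbounded degree\<close>

lemma infinite_alg_closed_field: "infinite (UNIV :: 'k::alg_closed_field set)"
proof
  assume fin: "finite (UNIV :: 'k set)"
  define P :: "'k poly" where "P = (\<Prod>a\<in>UNIV. [:- a, 1:])"
  have P: "poly P x = 0" for x
    unfolding P_def poly_prod using fin by (intro prod_zero bexI[of _ x]) auto
  have "P \<noteq> 0" unfolding P_def using fin by (simp add: prod_zero_iff)
  have "degree (P + 1) = 0"
  proof (rule ccontr)
    assume "degree (P + 1) \<noteq> 0"
    then obtain x where "poly (P + 1) x = 0" using alg_closed_imp_poly_has_root[of "P + 1"] by auto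
    then show False using P by simp
  qed
  then obtain c where "P + 1 = [:c:]" by (rule degree_eq_zeroE)
  then have c: "P = [:c - 1:]" by (simp add: one_pCons eq_diff_eq[symmetric])
  then have "c - 1 = 0" using P[of 0] by simp
  then show False using c \<open>P \<noteq> 0\<close> by simp
qed

lemma finite_polys_of_degree_le:
  assumes "finite (UNIV :: 'f::comm_ring_1 set)"
  shows "finite {u :: 'f poly. degree u \<le> D}"
proof -
  have "{u :: 'f poly. degree u \<le> D} \<subseteq> Poly ` {xs. set xs \<subseteq> UNIV \<and> length xs \<le> Suc D}"
  proof
    fix u :: "'f poly" assume "u \<in> {u. degree u \<le> D}"
    then have "length (coeffs u) \<le> Suc D" by (cases "u = 0") (auto simp: length_coeffs)
    then show "u \<in> Poly ` {xs. set xs \<subseteq> UNIV \<and> length xs \<le> Suc D}"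
      by (intro image_eqI[of _ _ "coeffs u"]) auto
  qed
  then show ?thesis using finite_lists_length_le[OF assms] finite_subset by blast
qed

text \<open>Bounded degrees would leave finitely many polynomials, whose roots would cover the
  infinite closure.\<close>

lemma large_degree_finite_field:
  assumes fin: "finite (UNIV :: 'f::field set)"
  shows "\<exists>Q :: 'f poly. irreducible Q \<and> D < degree Q"
proof (rule ccontr)
  assume no: "\<not> ?thesis"
  have "(UNIV :: 'f alg_closure set) \<subseteq> (\<Union>u\<in>{u. degree u \<le> D} - {0}. {x. ev u x = 0})"
  proof
    fix x :: "'f alg_closure"
    obtain m where m: "min_poly_of x m" using min_poly_exists by blast
    then have "irreducible m" by (simp add: min_poly_of_def)
    then have "degree m \<le> D" using no by (meson linorder_not_less)
    then show "x \<in> (\<Union>u\<in>{u. degree u \<le> D} - {0}. {x. ev u x = 0})"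
      using min_poly_root[OF m] min_poly_nonzero[OF m] by blast
  qed
  moreover have "finite (\<Union>u\<in>{u::'f poly. degree u \<le> D} - {0}. {x. ev u x = 0})"
    using finite_polys_of_degree_le[OF fin] finite_ev_roots by (intro finite_UN_I) auto
  ultimately show False using infinite_alg_closed_field finite_subset by blast
qed

text \<open>Let \<open>x\<close> be a \<open>p ^ m\<close>-th root of \<open>c\<close>. Each
  \<open>x ^ (p ^ i)\<close> with \<open>i < m\<close> lies outside the field generated by its own
  \<open>p\<close>-th power, so these \<open>m\<close> elements of F(x) are independent and
  \<open>x\<close> has degree at least \<open>m\<close>.\<close>

lemma large_degree_imperfect_field:
  fixes c :: "'f::field"
  assumes p: "prime p" "CHAR('f) = p" and c: "\<nexists>b. b ^ p = c"
  shows "\<exists>Q :: 'f poly. irreducible Q \<and> D < degree Q"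
proof -
  define m where "m = Suc D"
  have p0: "p ^ n > 0" for n using prime_gt_0_nat[OF p(1)] by simp
  obtain x :: "'f alg_closure" where x: "x ^ (p ^ m) = to_ac c" using nth_root_exists[OF p0] by blast
  have chK: "prime CHAR('f alg_closure)" using p by simp
  \<comment> \<open>The \<open>n\<close>-fold Frobenius map sends F and \<open>y\<close> into F,
    hence all of F[y].\<close>
  have frob: "\<exists>b. ev u y ^ (p ^ n) = to_ac b" if y: "y ^ (p ^ n) = to_ac c" for u y n
  proof (induction u)
    case 0
    have "ev 0 y ^ (p ^ n) = to_ac 0" using p0[of n] by (simp add: power_0_left)
    then show ?case ..
  next
    case (pCons d u)
    then obtain b where b: "ev u y ^ (p ^ n) = to_ac b" by blast
    have "ev (pCons d u) y ^ (p ^ n) = to_ac d ^ (p ^ n) + (y * ev u y) ^ (p ^ n)"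
      unfolding ev_pCons by (rule freshmans_dream'[OF chK]) (simp add: p)
    also have "\<dots> = to_ac (d ^ (p ^ n) + c * b)"
      by (simp only: power_mult_distrib y b to_ac_add to_ac_mult to_ac_power)
    finally show ?case ..
  qed
  \<comment> \<open>Otherwise Frobenius would place \<open>x ^ (p ^ (m - 1))\<close>, a
    \<open>p\<close>-th root of \<open>c\<close>, in F.\<close>
  have notin: "x ^ (p ^ i) \<notin> adjoin (x ^ (p ^ Suc i))" if i: "i < m" for i
  proof
    assume "x ^ (p ^ i) \<in> adjoin (x ^ (p ^ Suc i))"
    then obtain u where u: "x ^ (p ^ i) = ev u (x ^ (p ^ Suc i))" by (rule adjoinE)
    define n where "n = m - Suc i"
    have mi: "m = Suc i + n" "m - 1 = i + n" using i by (simp_all add: n_def)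
    have "(x ^ (p ^ Suc i)) ^ (p ^ n) = x ^ (p ^ m)" by (simp only: mi(1) power_add power_mult)
    then have "(x ^ (p ^ Suc i)) ^ (p ^ n) = to_ac c" by (simp only: x)
    from frob[OF this] obtain b where "ev u (x ^ (p ^ Suc i)) ^ (p ^ n) = to_ac b" by blast
    then have "(x ^ (p ^ i)) ^ (p ^ n) = to_ac b" by (simp only: u)
    then have b: "x ^ (p ^ (m - 1)) = to_ac b" by (simp only: mi(2) power_add power_mult)
    have "m = (m - 1) + 1" by (simp add: m_def)
    then have "x ^ (p ^ m) = (x ^ (p ^ (m - 1))) ^ p" by (metis power_add power_mult power_one_right)
    then have "to_ac c = to_ac (b ^ p)" using x b by simp
    then have "c = b ^ p" by (simp only: to_ac_eq_iff)
    then show False using c by blast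
  qed
  \<comment> \<open>The family grows downwards from exponent \<open>m - 1\<close>: the elements
    already present lie in the field generated by \<open>x ^ (p ^ Suc i)\<close>, the new one does
    not.\<close>
  have "ac.independent ((\<lambda>i. x ^ (p ^ i)) ` {m - k..<m}) \<and> card ((\<lambda>i. x ^ (p ^ i)) ` {m - k..<m}) = k"
    if "k \<le> m" for k
    using that
  proof (induction k)
    case 0
    then show ?case by (simp add: ac.independent_empty)
  next
    case (Suc k)
    define i where "i = m - Suc k"
    have i: "i < m" "m - k = Suc i" using Suc.prems by (simp_all add: i_def)
    let ?B = "(\<lambda>i. x ^ (p ^ i)) ` {Suc i..<m}"
    have IH: "ac.independent ?B" "card ?B = k" using Suc i(2) by simp_all
    have "?B \<subseteq> adjoin (x ^ (p ^ Suc i))"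
    proof clarify
      fix j assume "j \<in> {Suc i..<m}"
      then have "j = Suc i + (j - Suc i)" by simp
      then have "x ^ (p ^ j) = (x ^ (p ^ Suc i)) ^ (p ^ (j - Suc i))"
        by (metis power_add power_mult)
      then show "x ^ (p ^ j) \<in> adjoin (x ^ (p ^ Suc i))"
        by (simp only: adjoin_power[OF adjoin_self])
    qed
    then have "ac.span ?B \<subseteq> adjoin (x ^ (p ^ Suc i))" by (rule ac.span_minimal[OF _ subspace_adjoin])
    then have out: "x ^ (p ^ i) \<notin> ac.span ?B" using notin[OF i(1)] by blast
    moreover have "x ^ (p ^ i) \<notin> ?B" using out ac.span_base[of "x ^ (p ^ i)" ?B] by blast
    moreover have "{i..<m} = insert i {Suc i..<m}" using i(1) by auto
    then have "(\<lambda>i. x ^ (p ^ i)) ` {m - Suc k..<m} = insert (x ^ (p ^ i)) ?B"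
      unfolding i_def[symmetric] by simp
    ultimately show ?case using IH by (simp only: ac.independent_insert if_False) simp
  qed
  from this[of m] have B: "ac.independent ((\<lambda>i. x ^ (p ^ i)) ` {0..<m})" "card ((\<lambda>i. x ^ (p ^ i)) ` {0..<m}) = m"
    by simp_all
  obtain Q where Q: "min_poly_of x Q" using min_poly_exists by blast
  have "(\<lambda>i. x ^ (p ^ i)) ` {0..<m} \<subseteq> adjoin x" using adjoin_power[OF adjoin_self] by blast
  from card_independent_le_degree[OF Q B(1) this] have "m \<le> degree Q" by (simp only: B(2))
  then show ?thesis using Q unfolding min_poly_of_def m_def by (intro exI[of _ Q]) auto
qed

text \<open>An element \<open>a\<close> of largest degree generates the closure, since a primitive
  element for \<open>a\<close> and \<open>x\<close> cannot have larger degree. Sending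
  \<open>a\<close> to another root of \<open>f\<close> gives an automorphism of finite order, a
  power of which has prime order.\<close>

lemma large_degree_perfect_field:
  assumes p: "prime p" "CHAR('f::field) = p" and perfect: "\<forall>c::'f. \<exists>b. b ^ p = c"
    and inf: "infinite (UNIV :: 'f set)" and nac: "\<not> is_alg_closed TYPE('f)"
  shows "\<exists>Q :: 'f poly. irreducible Q \<and> D < degree Q"
proof (rule ccontr)
  assume no: "\<not> ?thesis"
  define mp where "mp x = (SOME m. min_poly_of x m)" for x :: "'f alg_closure"
  have mp: "min_poly_of x (mp x)" for x unfolding mp_def using min_poly_exists by (rule someI_ex)
  have bound: "degree (mp x) \<le> D" for x
  proof (rule ccontr)
    assume "\<not> degree (mp x) \<le> D"
    moreover have "irreducible (mp x)" using mp[of x] by (simp add: min_poly_of_def)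
    ultimately show False using no by auto
  qed
  obtain a where a: "\<And>x. degree (mp x) \<le> degree (mp a)"
    using ex_has_greatest_nat[of "\<lambda>_. True" undefined "\<lambda>x. degree (mp x)" "Suc D"] bound
    by (auto simp: less_Suc_eq_le)
  define f where "f = mp a"
  have f: "min_poly_of a f" by (simp add: f_def mp)
  have all: "x \<in> adjoin a" for x
  proof (rule ccontr)
    assume x: "x \<notin> adjoin a"
    obtain d where d: "a \<in> adjoin d" "x \<in> adjoin d"
      using primitive_element[OF p perfect inf] by blast
    have "degree f < degree (mp d)" using degree_less_if_adjoin_strict[OF f mp d x] .
    then show False using a[of d] by (simp add: f_def)
  qed
  \<comment> \<open>In degree 1 the closure would coincide with F, which is not algebraically
    closed.\<close>
  have "1 < degree f"
  proof (rule ccontr)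
    assume "\<not> 1 < degree f"
    then have "degree f = 1" using min_poly_degree_pos[OF f] by simp
    have "x \<in> range to_ac" for x :: "'f alg_closure"
    proof -
      have "x \<in> ac.span ((\<lambda>i. a ^ i) ` {..<1})"
        using all adjoin_subset_span[OF f] \<open>degree f = 1\<close> by auto
      moreover have "ac.span ((\<lambda>i. a ^ i) ` {..<1}) \<subseteq> range to_ac"
      proof (rule ac.span_minimal)
        show "(\<lambda>i. a ^ i) ` {..<1} \<subseteq> range to_ac" by (auto intro!: image_eqI[of _ _ 1])
        show "ac.subspace (range (to_ac :: 'f \<Rightarrow> _))"
        proof (rule ac.subspaceI)
          show "0 \<in> range (to_ac :: 'f \<Rightarrow> _)" using rangeI[of to_ac 0] by (simp only: to_ac_0)
        next
          fix x y :: "'f alg_closure" assume "x \<in> range to_ac" "y \<in> range to_ac"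
          then obtain c d where "x = to_ac c" "y = to_ac d" by blast
          then show "x + y \<in> range to_ac" using rangeI[of to_ac "c + d"] by (simp only: to_ac_add)
        next
          fix c and x :: "'f alg_closure" assume "x \<in> range to_ac"
          then obtain d where "x = to_ac d" by blast
          then show "to_ac c * x \<in> range to_ac" using rangeI[of to_ac "c * d"] by (simp only: to_ac_mult)
        qed
      qed
      ultimately show ?thesis by blast
    qed
    note surj = this
    obtain q :: "'f poly" where q: "0 < degree q" "\<nexists>c. poly q c = 0"
      using nac unfolding is_alg_closed_def by blast
    have "0 < degree (map_poly to_ac q)" using q(1) by (simp add: degree_map_poly_to_ac)
    then obtain x where x: "ev q x = 0" using alg_closed_imp_poly_has_root by blast
    obtain c where "x = to_ac c" using surj[of x] by blast
    moreover have "ev q (to_ac c) = to_ac (poly q c)" by (induction q) (simp_all add: map_poly_pCons)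
    ultimately show False using x q(2) by simp
  qed
  then have "1 < degree (map_poly to_ac f)" by (simp add: degree_map_poly_to_ac)
  from other_root[OF f p perfect this min_poly_root[OF f] dvd_refl]
  obtain b where b: "b \<noteq> a" "ev f b = 0" by blast
  define coord where "coord x = (SOME u. x = ev u a)" for x
  have coord: "x = ev (coord x) a" for x
    unfolding coord_def by (rule someI_ex) (use all[of x] in \<open>blast elim: adjoinE\<close>)
  \<comment> \<open>\<open>coord x\<close> matters only modulo \<open>f\<close>, because
    \<open>b\<close> is a root of \<open>f\<close>.\<close>
  define \<sigma> where "\<sigma> x = ev (coord x) b" for x
  have \<sigma>_ev: "\<sigma> (ev u a) = ev u b" for u
  proof -
    have "ev (coord (ev u a) - u) a = 0" using coord[of "ev u a"] by (simp add: ev_diff)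
    then have "f dvd coord (ev u a) - u" using min_poly_dvd[OF f] by simp
    then have "ev (coord (ev u a) - u) b = 0" using b(2) by (auto elim!: dvdE simp: ev_mult)
    then show ?thesis by (simp add: \<sigma>_def ev_diff)
  qed
  interpret \<sigma>: field_endomorphism \<sigma>
  proof
    fix x y
    show "\<sigma> (x + y) = \<sigma> x + \<sigma> y"
      using \<sigma>_ev[of "coord x + coord y"] coord[of x] coord[of y] by (simp add: ev_add \<sigma>_def)
    show "\<sigma> (x * y) = \<sigma> x * \<sigma> y"
      using \<sigma>_ev[of "coord x * coord y"] coord[of x] coord[of y] by (simp add: ev_mult \<sigma>_def)
    show "\<sigma> 1 = 1" using \<sigma>_ev[of 1] by (simp add: ev_1)
  qed
  have \<sigma>_const: "\<sigma> (to_ac c) = to_ac c" for c using \<sigma>_ev[of "[:c:]"] by (simp only: ev_const)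
  have \<sigma>_comm: "\<sigma> (ev u x) = ev u (\<sigma> x)" for u x
    by (induction u) (simp_all add: \<sigma>.zero ev_pCons \<sigma>.add \<sigma>.mult \<sigma>_const)
  have \<sigma>_pow_comm: "(\<sigma> ^^ k) (ev u x) = ev u ((\<sigma> ^^ k) x)" for k u x
    by (induction k) (simp_all add: \<sigma>_comm)
  have \<sigma>a: "\<sigma> a = b" using \<sigma>_ev[of "[:0, 1:]"] by (simp only: ev_X)
  have roots: "ev f ((\<sigma> ^^ k) a) = 0" for k
    using \<sigma>_pow_comm[of k f a] min_poly_root[OF f] field_endomorphism.zero[OF \<sigma>.iterate, of k] by simp
  \<comment> \<open>All iterates of \<open>a\<close> are roots of \<open>f\<close>, so two of them
    agree; an iterate of \<open>\<sigma>\<close> that fixes the generator \<open>a\<close> is the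
    identity.\<close>
  have "finite (range (\<lambda>k. (\<sigma> ^^ k) a))"
    by (rule finite_subset[OF _ finite_ev_roots[OF min_poly_nonzero[OF f]]]) (use roots in auto)
  then have "\<not> inj (\<lambda>k. (\<sigma> ^^ k) a)" using finite_imageD infinite_UNIV_nat by blast
  then obtain i j where ij: "i < j" "(\<sigma> ^^ i) a = (\<sigma> ^^ j) a"
    unfolding inj_def by (metis linorder_neqE_nat)
  have "(\<sigma> ^^ i) ((\<sigma> ^^ (j - i)) a) = (\<sigma> ^^ i) a"
  proof -
    have "(\<sigma> ^^ (i + (j - i))) a = (\<sigma> ^^ i) ((\<sigma> ^^ (j - i)) a)" by (simp only: funpow_add o_apply)
    then show ?thesis using ij by simp
  qed
  then have "(\<sigma> ^^ (j - i)) a = a"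
    using field_endomorphism.inj[OF \<sigma>.iterate, of i] by (rule injD[rotated])
  then have "(\<sigma> ^^ (j - i)) x = x" for x
    using \<sigma>_pow_comm[of "j - i" "coord x" a] coord[of x] by simp
  then have ex: "\<exists>k. 0 < k \<and> (\<forall>x. (\<sigma> ^^ k) x = x)" using ij(1) by (intro exI[of _ "j - i"]) simp
  define k where "k = (LEAST k. 0 < k \<and> (\<forall>x. (\<sigma> ^^ k) x = x))"
  have k: "0 < k" "\<And>x. (\<sigma> ^^ k) x = x" using LeastI_ex[OF ex] unfolding k_def by blast+
  have least: "\<exists>x. (\<sigma> ^^ k') x \<noteq> x" if "0 < k'" "k' < k" for k'
    using that not_less_Least[of k' "\<lambda>k. 0 < k \<and> (\<forall>x. (\<sigma> ^^ k) x = x)"] unfolding k_def by blast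
  have "k \<noteq> 1" using k(2)[of a] \<sigma>a b(1) by auto
  then obtain l where l: "prime l" "l dvd k" using prime_factor_nat by blast
  have "0 < k div l" "k div l < k" using l k(1) prime_gt_1_nat[OF l(1)] by (auto simp: dvd_imp_le div_greater_zero_iff)
  interpret \<tau>: field_endomorphism "\<sigma> ^^ (k div l)" by (rule \<sigma>.iterate)
  interpret \<tau>: prime_order_automorphism "\<sigma> ^^ (k div l)" l
  proof
    show "prime l" by fact
    show "((\<sigma> ^^ (k div l)) ^^ l) x = x" for x
      using k(2)[of x] l(2) by (simp add: funpow_mult)
    show "\<exists>x. (\<sigma> ^^ (k div l)) x \<noteq> x" using least \<open>0 < k div l\<close> \<open>k div l < k\<close> by blast
    show "0 < CHAR('f alg_closure)" using p prime_gt_0_nat by simp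
  qed
  show False by (rule \<tau>.contradiction)
qed

theorem irreducible_of_large_degree:
  assumes "CHAR('f::field) = p" "p \<noteq> 0" "\<not> is_alg_closed TYPE('f)"
  shows "\<exists>Q :: 'f poly. irreducible Q \<and> D < degree Q"
proof -
  have p: "prime p" using prime_CHAR_semidom[where 'a = 'f] assms(1,2) by simp
  show ?thesis
  proof (cases "finite (UNIV :: 'f set)")
    case True
    then show ?thesis by (rule large_degree_finite_field)
  next
    case False
    then show ?thesis
      using large_degree_imperfect_field[OF p assms(1)] large_degree_perfect_field[OF p assms(1) _ _ assms(3)]
      by blast
  qed
qed

theorem theorem3p2:
  fixes scale :: "'f::field \<Rightarrow> 'l::ab_group_add \<Rightarrow> 'l"
    and bracket :: "'l \<Rightarrow> 'l \<Rightarrow> 'l"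
    and p :: nat
  assumes "lie_algebra scale bracket"
    and "vector_space.finite_dim scale (UNIV :: 'l set)"
    and "CHAR('f) = p" and "p \<noteq> 0"
    and "\<not> is_alg_closed TYPE('f)"
  shows "\<exists>(V :: (nat \<Rightarrow> 'f) set) (\<rho> :: 'l \<Rightarrow> (nat \<Rightarrow> 'f) \<Rightarrow> (nat \<Rightarrow> 'f)).
           lie_module scale bracket seq_scale V \<rho> \<and>
           vector_space.finite_dim seq_scale V \<and>
           lie_module.faithful V \<rho> \<and>
           lie_module.irreducible seq_scale V \<rho>"
proof -
  interpret L: lie_algebra scale bracket by fact
  have p: "prime p" "of_nat p = (0::'f)"
    using prime_CHAR_semidom[where 'a = 'f] assms(3,4) of_nat_CHAR[where 'a = 'f] by auto
  show ?thesis
  proof (rule L.generic_representation[OF assms(2) p], goal_cases)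
    case (1 r d A)
    \<comment> \<open>\<open>d\<close> and \<open>r\<close> are the same for all elements of L, so
      one \<open>Q\<close> serves them all.\<close>
    obtain Q :: "'f poly" where Q: "Factorial_Ring.irreducible Q" "d * r < degree Q"
      using irreducible_of_large_degree[OF assms(3-5)] by blast
    show ?case by (rule L.specialised_representation[where r = r and d = d and A = A and Q = Q]) (fact 1 Q)+
  qed
qed

end
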